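(* Let $X$ be a smooth and geometrically irreducible variety over a field $k$ of characteristic $0$. Splittings of the exact sequence of profinite groups $$1 \to G^{\mathrm{ab}}_{\bar k(X)} \to G^{[\mathrm{ab}]}_{k(X)} \to G_k \to 1,$$ up to conjugation by $G^{\mathrm{ab}}_{\bar k(X)}$, are canonically in one-to-one correspondence with triples $(E,i_E,p_E)$ up to isomorphism, where $E$ is a discrete $G_k$-module and $i_E\colon \bar k(X)^\star\to E$ and $p_E\colon E\to(\bar k(X)^\star/\bar k^\star)\otimes_{\mathbf Z}\mathbf Q$ are $G_k$-equivariant maps fitting into a commutative diagram with exact rows $$\begin{array}{ccccccccc} 0&\to&\bar k^\star&\to&\bar k(X)^\star&\to&\bar k(X)^\star/\bar k^\star&\to&0\\ &&\|&&\downarrow{\scriptstyle i_E}&&\downarrow&&\\ 0&\to&\bar k^\star&\to&E&\xrightarrow{p_E}&(\bar k(X)^\star/\bar k^\star)\otimes_{\mathbf Z}\mathbf Q&\to&0 \end{array}$$ in which the left vertical map is the identity and the right vertical map is the natural one, $x\mapsto x\otimes 1$. Here an isomorphism of triples $(E,i_E,p_E)\to(E',i_{E'},p_{E'})$ is an isomorphism $h\colon E\to E'$ of discrete $G_k$-modules such that $h\circ i_E=i_{E'}$ and $p_{E'}\circ h=p_E$. The canonical correspondence sends the class of a splitting $s$ to the class of the triple $(M_s,i,p)$ defined in the context.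
   Context: Notation: $\bar k$ is a separable closure of $k$ and $G_k=\mathrm{Gal}(\bar k/k)$. $k(X)$ is the function field of $X$, $\bar k(X)=k(X)\otimes_k\bar k$ (a field, on which $G_k$ acts through the second factor), $\overline{k(X)}$ is a separable closure of $\bar k(X)$, and $\bar k(X)^{\mathrm{ab}}$ is the maximal abelian subextension of $\overline{k(X)}/\bar k(X)$. Set $G^{\mathrm{ab}}_{\bar k(X)}=\mathrm{Gal}(\bar k(X)^{\mathrm{ab}}/\bar k(X))$ and $G^{[\mathrm{ab}]}_{k(X)}=\mathrm{Gal}(\bar k(X)^{\mathrm{ab}}/k(X))$; the map $G^{[\mathrm{ab}]}_{k(X)}\to G_k$ is restriction to $\bar k$. A splitting of the sequence is a continuous homomorphic section $s\colon G_k\to G^{[\mathrm{ab}]}_{k(X)}$ of this map. $F^\star$ denotes the multiplicative group of a field $F$. Let $M=\{f\in\bar k(X)^{\mathrm{ab}\,\star} : \exists\, n\geq 1,\ f^n\in\bar k(X)^\star\}$, a discrete $G^{[\mathrm{ab}]}_{k(X)}$-module, let $i\colon\bar k(X)^\star\to M$ be the inclusion, and let $p\colon M\to(\bar k(X)^\star/\bar k^\star)\otimes_{\mathbf Z}\mathbf Q$ be given by $p(f)=f^n\otimes\frac1n$ for any $n\geq1$ such that $f^n\in\bar k(X)^\star$. For a splitting $s$, $M_s$ denotes $M$ with $G_k$ acting via $s$. *)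

theory Defs
  imports
    "HOL-Analysis.Analysis"
    "HOL-Computational_Algebra.Polynomial"
    "HOL-Algebra.QuotRing"
    "HOL-Algebra.Group_Action"
    "HOL-Algebra.Free_Abelian_Groups"
begin

text \<open>
  All fields live inside one field of characteristic 0, the type \<open>'a\<close>, which plays the role of
  \<open>\<Omega>\<close>, the chosen separable closure of \<open>kbar(X)\<close>.  Subrings and subfields are sets \<open>A\<close> such that
  \<open>ring_on A\<close> is a commutative ring, respectively a field.
\<close>

definition ring_on :: "'a::comm_ring_1 set \<Rightarrow> 'a ring" where
  "ring_on A = \<lparr>carrier = A, monoid.mult = (*), monoid.one = 1, ring.zero = 0, ring.add = (+)\<rparr>"

abbreviation is_subring :: "'a::field set \<Rightarrow> bool" where
  "is_subring A \<equiv> cring (ring_on A)"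

abbreviation is_subfield :: "'a::field set \<Rightarrow> bool" where
  "is_subfield F \<equiv> Ring.field (ring_on F)"

definition units_group :: "'a::field set \<Rightarrow> 'a monoid" where
  "units_group F = \<lparr>carrier = F - {0}, monoid.mult = (*), monoid.one = 1\<rparr>"

definition subring_gen :: "'a::field set \<Rightarrow> 'a set" where
  "subring_gen S = \<Inter>{R. is_subring R \<and> S \<subseteq> R}"

definition fraction_field :: "'a::field set \<Rightarrow> 'a set" where
  "fraction_field A = {a / b | a b. a \<in> A \<and> b \<in> A \<and> b \<noteq> 0}"


section \<open>Galois theory\<close>

definition poly_over :: "'a::field set \<Rightarrow> 'a poly set" where
  "poly_over F = {p. set (coeffs p) \<subseteq> F}"

definition separable_poly :: "'a::field poly \<Rightarrow> bool" where
  "separable_poly p \<longleftrightarrow> p \<noteq> 0 \<and> coprime p (pderiv p)"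

definition separable_over :: "'a::field set \<Rightarrow> 'a \<Rightarrow> bool" where
  "separable_over F x \<longleftrightarrow> (\<exists>p \<in> poly_over F. separable_poly p \<and> poly p x = 0)"

definition is_separable_closure :: "'a::field set \<Rightarrow> 'a set \<Rightarrow> bool" where
  "is_separable_closure F L \<longleftrightarrow>
     is_subfield L \<and> F \<subseteq> L \<and> (\<forall>x\<in>L. separable_over F x) \<and>
     (\<forall>p \<in> poly_over L. separable_poly p \<and> degree p > 0 \<longrightarrow> (\<exists>x\<in>L. poly p x = 0))"

text \<open>
  The separable closure of \<open>F\<close> relative to the ambient field.  When the ambient field is separably
  closed, this is the unique separable closure of \<open>F\<close> inside it.
\<close>
definition sep_closure :: "'a::field set \<Rightarrow> 'a set" where
  "sep_closure F = {x. separable_over F x}"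

definition Gal :: "'a::field set \<Rightarrow> 'a set \<Rightarrow> ('a \<Rightarrow> 'a) monoid" where
  "Gal L F = BijGroup L \<lparr>carrier := {\<sigma> \<in> Bij L.
      (\<forall>x\<in>L. \<forall>y\<in>L. \<sigma> (x + y) = \<sigma> x + \<sigma> y \<and> \<sigma> (x * y) = \<sigma> x * \<sigma> y) \<and> (\<forall>x\<in>F. \<sigma> x = x)}\<rparr>"

text \<open>
  The Krull topology: \<open>\<sigma>\<close> has as basic neighbourhoods the sets of all \<open>\<tau>\<close> that agree with \<open>\<sigma>\<close>
  on a given finite subset of \<open>L\<close>.
\<close>
definition krull_topology :: "'a::field set \<Rightarrow> 'a set \<Rightarrow> ('a \<Rightarrow> 'a) topology" where
  "krull_topology L F =
     subtopology (product_topology (\<lambda>_. discrete_topology L) L) (carrier (Gal L F))"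

text \<open>
  Normal and separable: the minimal polynomial of \<open>x\<close> over \<open>F\<close> divides the displayed product, so it
  has distinct roots, all in \<open>L\<close>; conversely one may take for \<open>R\<close> the set of its roots.
\<close>
definition galois_ext :: "'a::field set \<Rightarrow> 'a set \<Rightarrow> bool" where
  "galois_ext L F \<longleftrightarrow> is_subfield L \<and> is_subfield F \<and> F \<subseteq> L \<and>
     (\<forall>x\<in>L. \<exists>R. finite R \<and> R \<subseteq> L \<and> x \<in> R \<and> (\<Prod>r\<in>R. [:- r, 1:]) \<in> poly_over F)"

definition abelian_ext :: "'a::field set \<Rightarrow> 'a set \<Rightarrow> bool" where
  "abelian_ext L F \<longleftrightarrow> galois_ext L F \<and> comm_group (Gal L F)"

definition max_abelian_ext :: "'a::field set \<Rightarrow> 'a set" where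
  "max_abelian_ext F = \<Union>{L. abelian_ext L F}"


section \<open>Tensor products\<close>

text \<open>\<open>A \<otimes>\<^sub>\<int> B\<close> for abelian groups, as the quotient of the free abelian group on \<open>A \<times> B\<close>.\<close>

definition bilinear_relations ::
    "('a, 'm) monoid_scheme \<Rightarrow> ('b, 'n) monoid_scheme \<Rightarrow> (('a \<times> 'b) \<Rightarrow>\<^sub>0 int) set" where
  "bilinear_relations A B =
     {frag_of (a \<otimes>\<^bsub>A\<^esub> a', b) - frag_of (a, b) - frag_of (a', b) | a a' b.
        a \<in> carrier A \<and> a' \<in> carrier A \<and> b \<in> carrier B} \<union>
     {frag_of (a, b \<otimes>\<^bsub>B\<^esub> b') - frag_of (a, b) - frag_of (a, b') | a b b'.
        a \<in> carrier A \<and> b \<in> carrier B \<and> b' \<in> carrier B}"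

definition tensor_kernel ::
    "('a, 'm) monoid_scheme \<Rightarrow> ('b, 'n) monoid_scheme \<Rightarrow> (('a \<times> 'b) \<Rightarrow>\<^sub>0 int) set" where
  "tensor_kernel A B =
     generate (free_Abelian_group (carrier A \<times> carrier B)) (bilinear_relations A B)"

definition tensor_group ::
    "('a, 'm) monoid_scheme \<Rightarrow> ('b, 'n) monoid_scheme \<Rightarrow> (('a \<times> 'b) \<Rightarrow>\<^sub>0 int) set monoid" where
  "tensor_group A B = free_Abelian_group (carrier A \<times> carrier B) Mod tensor_kernel A B"

definition pure_tensor ::
    "('a, 'm) monoid_scheme \<Rightarrow> ('b, 'n) monoid_scheme \<Rightarrow> 'a \<Rightarrow> 'b \<Rightarrow> (('a \<times> 'b) \<Rightarrow>\<^sub>0 int) set" where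
  "pure_tensor A B a b =
     tensor_kernel A B #>\<^bsub>free_Abelian_group (carrier A \<times> carrier B)\<^esub> frag_of (a, b)"

text \<open>
  \<open>A \<otimes>\<^sub>k B\<close> as a ring, for \<open>k\<close>-subalgebras \<open>A\<close>, \<open>B\<close> of the ambient field: the monoid ring
  \<open>\<int>[A \<times> B]\<close>, with \<open>(a, b) (a', b') = (a a', b b')\<close>, modulo the ideal of bilinear and
  \<open>k\<close>-balancing relations.
\<close>

definition pair_ring :: "'a::field set \<Rightarrow> 'a set \<Rightarrow> (('a \<times> 'a) \<Rightarrow>\<^sub>0 int) ring" where
  "pair_ring A B =
     \<lparr>carrier = {c. Poly_Mapping.keys c \<subseteq> A \<times> B},
      monoid.mult = (\<lambda>x y. frag_extend (\<lambda>(a, b). frag_extend (\<lambda>(a', b'). frag_of (a * a', b * b')) y) x),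
      monoid.one = frag_of (1, 1), ring.zero = 0, ring.add = (+)\<rparr>"

definition tensor_algebra :: "'a::field set \<Rightarrow> 'a set \<Rightarrow> 'a set \<Rightarrow> (('a \<times> 'a) \<Rightarrow>\<^sub>0 int) set ring" where
  "tensor_algebra k A B = pair_ring A B Quot
     Idl\<^bsub>pair_ring A B\<^esub> (bilinear_relations (add_monoid (ring_on A)) (add_monoid (ring_on B)) \<union>
       {frag_of (c * a, b) - frag_of (a, c * b) | a b c. a \<in> A \<and> b \<in> B \<and> c \<in> k})"

definition Spec :: "('r, 'm) ring_scheme \<Rightarrow> 'r set set" where
  "Spec R = {P. primeideal P R}"

definition zariski_closed :: "('r, 'm) ring_scheme \<Rightarrow> 'r set \<Rightarrow> 'r set set" where
  "zariski_closed R S = {P \<in> Spec R. S \<subseteq> P}"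

definition irreducible_Spec :: "('r, 'm) ring_scheme \<Rightarrow> bool" where
  "irreducible_Spec R \<longleftrightarrow> Spec R \<noteq> {} \<and>
     (\<forall>S T. S \<subseteq> carrier R \<and> T \<subseteq> carrier R \<and> zariski_closed R S \<union> zariski_closed R T = Spec R \<longrightarrow>
        zariski_closed R S = Spec R \<or> zariski_closed R T = Spec R)"


section \<open>Varieties\<close>

text \<open>
  An integral separated scheme \<open>X\<close> of finite type over \<open>k\<close> is determined by its local rings,
  regarded as subrings of the function field (Chevalley's schemata, EGA I, section 8).  We thus
  represent \<open>X\<close> by the set of its local rings.  An affine scheme \<open>Spec A\<close> becomes the set of
  all localisations of \<open>A\<close> at prime ideals, and separatedness becomes the condition that distinct
  local rings of \<open>X\<close> are never dominated by one and the same local ring.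
\<close>

definition fg_algebra :: "'a::field set \<Rightarrow> 'a set \<Rightarrow> bool" where
  "fg_algebra k A \<longleftrightarrow> (\<exists>S. finite S \<and> A = subring_gen (k \<union> S))"

definition localizations :: "'a::field set \<Rightarrow> 'a set set" where
  "localizations A = {{a / b | a b. a \<in> A \<and> b \<in> A - P} | P. primeideal P (ring_on A)}"

definition nonunits :: "'a::field set \<Rightarrow> 'a set" where
  "nonunits R = {x \<in> R. x = 0 \<or> inverse x \<notin> R}"

definition local_subring :: "'a::field set \<Rightarrow> bool" where
  "local_subring R \<longleftrightarrow> is_subring R \<and> (\<forall>x \<in> nonunits R. \<forall>y \<in> nonunits R. x + y \<in> nonunits R)"

definition dominates :: "'a::field set \<Rightarrow> 'a set \<Rightarrow> bool" where
  "dominates T R \<longleftrightarrow> R \<subseteq> T \<and> nonunits R \<subseteq> nonunits T"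

text \<open>The local ring at the generic point is the function field, and it contains all others.\<close>
definition function_field :: "'a set set \<Rightarrow> 'a set" where
  "function_field X = \<Union>X"

definition variety :: "'a::field set \<Rightarrow> 'a set set \<Rightarrow> bool" where
  "variety k X \<longleftrightarrow>
     (\<exists>\<A>. finite \<A> \<and> \<A> \<noteq> {} \<and> X = (\<Union>A\<in>\<A>. localizations A) \<and>
        (\<forall>A\<in>\<A>. fg_algebra k A \<and> fraction_field A = function_field X)) \<and>
     (\<forall>R\<in>X. \<forall>S\<in>X. (\<exists>T. local_subring T \<and> T \<subseteq> function_field X \<and> dominates T R \<and> dominates T S)
        \<longrightarrow> R = S)"

text \<open>The coordinate rings of the nonempty affine open subschemes of \<open>X\<close>.\<close>
definition affine_open :: "'a::field set \<Rightarrow> 'a set set \<Rightarrow> 'a set \<Rightarrow> bool" where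
  "affine_open k X A \<longleftrightarrow> fg_algebra k A \<and> localizations A \<subseteq> X"

text \<open>
  Irreducibility of \<open>X \<times>\<^sub>k kbar\<close>: it is covered by the open subschemes \<open>Spec (A \<otimes>\<^sub>k kbar)\<close>,
  any two of which meet because any two nonempty affine opens of the irreducible \<open>X\<close> contain a third
  one.  Such a space is irreducible iff all the members of the covering are.
\<close>
definition geometrically_irreducible :: "'a::field set \<Rightarrow> 'a set set \<Rightarrow> bool" where
  "geometrically_irreducible k X \<longleftrightarrow>
     (\<forall>A. affine_open k X A \<longrightarrow> irreducible_Spec (tensor_algebra k A (sep_closure k)))"

text \<open>
  Smoothness: locally on \<open>X\<close>, the coordinate ring is a standard smooth algebra, that is
  \<open>k[T\<^sub>0, \<dots>, T\<^sub>n\<^sub>-\<^sub>1] / (f\<^sub>0, \<dots>, f\<^sub>c\<^sub>-\<^sub>1)\<close> with the matrix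
  \<open>(\<partial>f\<^sub>j / \<partial>T\<^sub>i)\<close>, \<open>i, j < c\<close>, invertible over the quotient.
\<close>

type_synonym 'b mpoly = "(nat \<Rightarrow>\<^sub>0 nat) \<Rightarrow>\<^sub>0 'b"

definition mpolys :: "'a::field set \<Rightarrow> nat \<Rightarrow> 'a mpoly set" where
  "mpolys k n = {p. \<forall>m \<in> Poly_Mapping.keys p.
     Poly_Mapping.lookup p m \<in> k \<and> Poly_Mapping.keys m \<subseteq> {..<n}}"

definition mpoly_eval :: "(nat \<Rightarrow> 'a::field) \<Rightarrow> 'a mpoly \<Rightarrow> 'a" where
  "mpoly_eval x p = (\<Sum>m \<in> Poly_Mapping.keys p.
     Poly_Mapping.lookup p m * (\<Prod>i \<in> Poly_Mapping.keys m. x i ^ Poly_Mapping.lookup m i))"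

definition mpoly_deriv :: "nat \<Rightarrow> 'a::field mpoly \<Rightarrow> 'a mpoly" where
  "mpoly_deriv i p = (\<Sum>m \<in> Poly_Mapping.keys p.
     Poly_Mapping.single (m - Poly_Mapping.single i 1)
       (of_nat (Poly_Mapping.lookup m i) * Poly_Mapping.lookup p m))"

definition standard_smooth :: "'a::field set \<Rightarrow> 'a set \<Rightarrow> bool" where
  "standard_smooth k A \<longleftrightarrow>
     (\<exists>n c x f. c \<le> n \<and> A = mpoly_eval x ` mpolys k n \<and> (\<forall>j<c. f j \<in> mpolys k n) \<and>
        {p \<in> mpolys k n. mpoly_eval x p = 0}
          = {\<Sum>j<c. g j * f j | g. \<forall>j<c. g j \<in> mpolys k n} \<and>
        (\<exists>B. (\<forall>i<c. \<forall>j<c. B i j \<in> A) \<and>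
           (\<forall>i<c. \<forall>l<c. (\<Sum>j<c. mpoly_eval x (mpoly_deriv i (f j)) * B j l) = (if i = l then 1 else 0))))"

definition smooth_variety :: "'a::field set \<Rightarrow> 'a set set \<Rightarrow> bool" where
  "smooth_variety k X \<longleftrightarrow>
     (\<forall>R\<in>X. \<exists>A. affine_open k X A \<and> R \<in> localizations A \<and> standard_smooth k A)"


section \<open>Splittings of the birational abelianized fundamental sequence\<close>

text \<open>From here on, \<open>K\<close> stands for the function field \<open>k(X)\<close>.\<close>

text \<open>
  \<open>kbar(X)\<close>: the image of the multiplication map from \<open>K \<otimes>\<^sub>k kbar\<close> to the ambient field.  For
  geometrically irreducible \<open>X\<close> that map is injective and the image is a field.
\<close>
definition kbarX :: "'a::field set \<Rightarrow> 'a set \<Rightarrow> 'a set" where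
  "kbarX k K = subring_gen (K \<union> sep_closure k)"

definition kbarX_ab :: "'a::field set \<Rightarrow> 'a set \<Rightarrow> 'a set" where
  "kbarX_ab k K = max_abelian_ext (kbarX k K)"

abbreviation G_base :: "'a::field set \<Rightarrow> ('a \<Rightarrow> 'a) monoid" where
  "G_base k \<equiv> Gal (sep_closure k) k"

abbreviation G_ab :: "'a::field set \<Rightarrow> 'a set \<Rightarrow> ('a \<Rightarrow> 'a) monoid" where
  "G_ab k K \<equiv> Gal (kbarX_ab k K) (kbarX k K)"

abbreviation G_brab :: "'a::field set \<Rightarrow> 'a set \<Rightarrow> ('a \<Rightarrow> 'a) monoid" where
  "G_brab k K \<equiv> Gal (kbarX_ab k K) K"

text \<open>Being extensional makes a splitting a function on \<open>G\<^sub>k\<close> alone.\<close>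
definition splittings :: "'a::field set \<Rightarrow> 'a set \<Rightarrow> (('a \<Rightarrow> 'a) \<Rightarrow> ('a \<Rightarrow> 'a)) set" where
  "splittings k K =
     {s \<in> extensional (carrier (G_base k)).
        s \<in> hom (G_base k) (G_brab k K) \<and>
        continuous_map (krull_topology (sep_closure k) k) (krull_topology (kbarX_ab k K) K) s \<and>
        (\<forall>\<sigma> \<in> carrier (G_base k). restrict (s \<sigma>) (sep_closure k) = \<sigma>)}"

definition conj_rel ::
    "'a::field set \<Rightarrow> 'a set \<Rightarrow> ((('a \<Rightarrow> 'a) \<Rightarrow> ('a \<Rightarrow> 'a)) \<times> (('a \<Rightarrow> 'a) \<Rightarrow> ('a \<Rightarrow> 'a))) set" where
  "conj_rel k K =
     {(s, s'). s \<in> splittings k K \<and> s' \<in> splittings k K \<and>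
        (\<exists>g \<in> carrier (G_ab k K). \<forall>\<sigma> \<in> carrier (G_base k).
           s' \<sigma> = g \<otimes>\<^bsub>G_brab k K\<^esub> s \<sigma> \<otimes>\<^bsub>G_brab k K\<^esub> inv\<^bsub>G_brab k K\<^esub> g)}"


section \<open>Extensions of \<open>(kbar(X)*/kbar*) \<otimes> \<rat>\<close> by \<open>kbar*\<close>\<close>

text \<open>The action of \<open>G\<^sub>k\<close> on \<open>kbar(X) = K \<otimes>\<^sub>k kbar\<close> through the second factor.\<close>
definition act_kbarX :: "'a::field set \<Rightarrow> 'a set \<Rightarrow> ('a \<Rightarrow> 'a) \<Rightarrow> ('a \<Rightarrow> 'a)" where
  "act_kbarX k K \<sigma> =
     (THE \<tau>. \<tau> \<in> carrier (Gal (kbarX k K) K) \<and> restrict \<tau> (sep_closure k) = \<sigma>)"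

definition quot_units :: "'a::field set \<Rightarrow> 'a set \<Rightarrow> 'a set monoid" where
  "quot_units k K = units_group (kbarX k K) Mod (sep_closure k - {0})"

definition quot_class :: "'a::field set \<Rightarrow> 'a set \<Rightarrow> 'a \<Rightarrow> 'a set" where
  "quot_class k K x = (sep_closure k - {0}) #>\<^bsub>units_group (kbarX k K)\<^esub> x"

abbreviation rat_group :: "rat monoid" where
  "rat_group \<equiv> add_monoid (ring_on UNIV)"

type_synonym 'b rat_divisors = "(('b set \<times> rat) \<Rightarrow>\<^sub>0 int) set"

definition quot_units_rat :: "'a::field set \<Rightarrow> 'a set \<Rightarrow> 'a rat_divisors monoid" where
  "quot_units_rat k K = tensor_group (quot_units k K) rat_group"

definition tensor_rat :: "'a::field set \<Rightarrow> 'a set \<Rightarrow> 'a \<Rightarrow> rat \<Rightarrow> 'a rat_divisors" where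
  "tensor_rat k K x q = pure_tensor (quot_units k K) rat_group (quot_class k K x) q"

text \<open>
  \<open>\<sigma> (x \<otimes> q) = \<sigma> x \<otimes> q\<close>.  Elements of a quotient are cosets, so the induced maps on both
  quotients are direct images.
\<close>
definition act_quot_units_rat ::
    "'a::field set \<Rightarrow> 'a set \<Rightarrow> ('a \<Rightarrow> 'a) \<Rightarrow> 'a rat_divisors \<Rightarrow> 'a rat_divisors" where
  "act_quot_units_rat k K \<sigma> v = frag_extend (\<lambda>(c, q). frag_of (act_kbarX k K \<sigma> ` c, q)) ` v"

definition discrete_module ::
    "'a::field set \<Rightarrow> 'e monoid \<Rightarrow> (('a \<Rightarrow> 'a) \<Rightarrow> 'e \<Rightarrow> 'e) \<Rightarrow> bool" where
  "discrete_module k E act \<longleftrightarrow>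
     comm_group E \<and> group_action (G_base k) (carrier E) act \<and>
     (\<forall>\<sigma> \<in> carrier (G_base k). act \<sigma> \<in> hom E E) \<and>
     (\<forall>e \<in> carrier E.
        openin (krull_topology (sep_closure k) k) {\<sigma> \<in> carrier (G_base k). act \<sigma> e = e})"

record ('a, 'e) ext_triple =
  emodule :: "'e monoid"
  eaction :: "('a \<Rightarrow> 'a) \<Rightarrow> 'e \<Rightarrow> 'e"
  eincl :: "'a \<Rightarrow> 'e"
  eproj :: "'e \<Rightarrow> 'a rat_divisors"

text \<open>
  By commutativity of the left square, the map \<open>kbar* \<rightarrow> E\<close> of the bottom row is the restriction of
  \<open>i\<^sub>E\<close>; the last four conjuncts are the right square and the exactness of the bottom row.
\<close>
definition is_ext_triple :: "'a::field set \<Rightarrow> 'a set \<Rightarrow> ('a, 'e) ext_triple \<Rightarrow> bool" where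
  "is_ext_triple k K T \<longleftrightarrow>
     discrete_module k (emodule T) (eaction T) \<and>
     eincl T \<in> hom (units_group (kbarX k K)) (emodule T) \<and>
     (\<forall>\<sigma> \<in> carrier (G_base k). \<forall>x \<in> kbarX k K - {0}.
        eincl T (act_kbarX k K \<sigma> x) = eaction T \<sigma> (eincl T x)) \<and>
     eproj T \<in> hom (emodule T) (quot_units_rat k K) \<and>
     (\<forall>\<sigma> \<in> carrier (G_base k). \<forall>e \<in> carrier (emodule T).
        eproj T (eaction T \<sigma> e) = act_quot_units_rat k K \<sigma> (eproj T e)) \<and>
     (\<forall>x \<in> kbarX k K - {0}. eproj T (eincl T x) = tensor_rat k K x 1) \<and>
     inj_on (eincl T) (sep_closure k - {0}) \<and>
     eincl T ` (sep_closure k - {0}) = kernel (emodule T) (quot_units_rat k K) (eproj T) \<and>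
     eproj T ` carrier (emodule T) = carrier (quot_units_rat k K)"

definition triple_iso ::
    "'a::field set \<Rightarrow> 'a set \<Rightarrow> ('a, 'e) ext_triple \<Rightarrow> ('a, 'f) ext_triple \<Rightarrow> bool" where
  "triple_iso k K T T' \<longleftrightarrow>
     (\<exists>h \<in> iso (emodule T) (emodule T').
        (\<forall>\<sigma> \<in> carrier (G_base k). \<forall>e \<in> carrier (emodule T).
           h (eaction T \<sigma> e) = eaction T' \<sigma> (h e)) \<and>
        (\<forall>x \<in> kbarX k K - {0}. h (eincl T x) = eincl T' x) \<and>
        (\<forall>e \<in> carrier (emodule T). eproj T' (h e) = eproj T e))"

definition triple_iso_rel ::
    "'a::field set \<Rightarrow> 'a set \<Rightarrow> (('a, 'e) ext_triple \<times> ('a, 'e) ext_triple) set" where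
  "triple_iso_rel k K = {(T, T'). is_ext_triple k K T \<and> is_ext_triple k K T' \<and> triple_iso k K T T'}"

definition radical_group :: "'a::field set \<Rightarrow> 'a set \<Rightarrow> 'a monoid" where
  "radical_group k K =
     \<lparr>carrier = {f \<in> kbarX_ab k K. f \<noteq> 0 \<and> (\<exists>n\<ge>1. f ^ n \<in> kbarX k K)},
      monoid.mult = (*), monoid.one = 1\<rparr>"

text \<open>The value \<open>f\<^sup>n \<otimes> 1/n\<close> does not depend on the choice of \<open>n\<close>.\<close>
definition radical_proj :: "'a::field set \<Rightarrow> 'a set \<Rightarrow> 'a \<Rightarrow> 'a rat_divisors" where
  "radical_proj k K f =
     (let n = (SOME n. n \<ge> 1 \<and> f ^ n \<in> kbarX k K) in tensor_rat k K (f ^ n) (1 / of_nat n))"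

definition radical_triple ::
    "'a::field set \<Rightarrow> 'a set \<Rightarrow> (('a \<Rightarrow> 'a) \<Rightarrow> ('a \<Rightarrow> 'a)) \<Rightarrow> ('a, 'a) ext_triple" where
  "radical_triple k K s =
     \<lparr>emodule = radical_group k K,
      eaction = (\<lambda>\<sigma>. restrict (s \<sigma>) (carrier (radical_group k K))),
      eincl = (\<lambda>x. x),
      eproj = radical_proj k K\<rparr>"

end

theory Submission
  imports Defs "HOL-Algebra.Finite_Extensions"
begin

text \<open>
  Write \<open>C = kbar\<close>, \<open>F = kbar(X)\<close>, \<open>V = (F\<^sup>*/C\<^sup>*) \<otimes> \<rat>\<close>, and let \<open>M\<close> be the group of all radicals of \<open>F\<close>,
  that is, of all \<open>f \<noteq> 0\<close> with a power in \<open>F\<close>.  The theorem rests on two facts: the group \<open>M\<close> knows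
  the field \<open>F\<^sup>a\<^sup>b\<close>, and as an abelian group it is the only extension of \<open>V\<close> by \<open>C\<^sup>*\<close> containing \<open>F\<^sup>*\<close>.

  The first fact is Kummer theory, which applies because \<open>C\<close> contains all roots of unity.  Every abelian
  extension of \<open>F\<close> is generated by radicals (\<open>abelian_subset_N\<close>, by Lagrange resolvents), so \<open>F\<^sup>a\<^sup>b\<close> is
  the field \<open>N = F(M)\<close>.  Radicals from different classes modulo \<open>F\<^sup>*\<close> are linearly independent over \<open>F\<close>
  (\<open>kummer_class_sum\<close>).  Therefore an automorphism of the group \<open>M\<close> that restricts to a field
  automorphism of \<open>F\<close> extends uniquely to an automorphism of the field \<open>F\<^sup>a\<^sup>b\<close> (\<open>kummer_extension\<close>).

  For the second fact, \<open>p: M \<rightarrow> V\<close> is onto with kernel \<open>C\<^sup>*\<close>, since elements of \<open>V\<close> have the form \<open>x \<otimes> 1/n\<close>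
  and such a tensor vanishes only if the \<open>n\<close>-th roots of \<open>x\<close> are constants (\<open>tensor_rat_trivial\<close>).  Given
  a triple \<open>(E, i\<^sub>E, p\<^sub>E)\<close>, the map \<open>i\<^sub>E\<close> extends to a homomorphism \<open>M \<rightarrow> E\<close> over \<open>V\<close>, because \<open>M/F\<^sup>*\<close> is a
  torsion group and the group \<open>C\<^sup>*\<close> is divisible; by the five lemma it is an isomorphism
  (\<open>comparison_iso\<close>).

  Transporting the Galois action from \<open>E\<close> to \<open>M\<close> and extending it to \<open>F\<^sup>a\<^sup>b\<close> gives a splitting with
  triple \<open>E\<close> (\<open>ext_triple_from_splitting\<close>).  An isomorphism between the triples of two splittings is an
  automorphism of \<open>M\<close> that fixes \<open>F\<^sup>*\<close>.  It extends to an element of the Galois group of \<open>F\<^sup>a\<^sup>b\<close> over \<open>F\<close>,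
  and equivariance says that this element conjugates one splitting to the other
  (\<open>triple_iso_imp_conjugate\<close>).

  Underneath lies the action of the Galois group of \<open>k\<close> on \<open>F\<close>.  It exists because \<open>K \<inter> C = k\<close>
  (\<open>extend_base_automorphism\<close>).  If \<open>K\<close> contained an element of \<open>C\<close> outside \<open>k\<close>, the factorisation of
  its minimal polynomial would produce zero divisors in the rings \<open>A \<otimes>\<^sub>k C\<close> that make their
  spectra reducible, contrary to geometric irreducibility (\<open>irreducible_tensor_algebra_imp_disjoint\<close>).
\<close>

hide_const (open) Polynomials.degree Polynomials.lead_coeff
\<comment> \<open>\<open>X\<close> is the variety in the theorem, so it must not denote an indeterminate.\<close>
no_notation var (\<open>X\<index>\<close>)


section \<open>Subrings and subfields of the ambient field\<close>

lemma is_subring_iff: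
  "is_subring A \<longleftrightarrow> 0 \<in> A \<and> 1 \<in> A \<and> (\<forall>x\<in>A. \<forall>y\<in>A. x + y \<in> A \<and> x * y \<in> A) \<and> (\<forall>x\<in>A. - x \<in> A)"
proof
  assume "is_subring A"
  then interpret cring "ring_on A" .
  have c [simp]: "carrier (ring_on A) = A" "\<zero>\<^bsub>ring_on A\<^esub> = 0" "\<one>\<^bsub>ring_on A\<^esub> = 1"
    "x \<oplus>\<^bsub>ring_on A\<^esub> y = x + y" "x \<otimes>\<^bsub>ring_on A\<^esub> y = x * y" for x y
    by (simp_all add: ring_on_def)
  have "- x \<in> A" if "x \<in> A" for x
  proof -
    have "x + (\<ominus>\<^bsub>ring_on A\<^esub> x) = 0" using r_neg[of x] that by simp
    then have "- x = \<ominus>\<^bsub>ring_on A\<^esub> x" by (metis neg_eq_iff_add_eq_0)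
    then show ?thesis using a_inv_closed[of x] that by simp
  qed
  then show "0 \<in> A \<and> 1 \<in> A \<and> (\<forall>x\<in>A. \<forall>y\<in>A. x + y \<in> A \<and> x * y \<in> A) \<and> (\<forall>x\<in>A. - x \<in> A)"
    using zero_closed one_closed a_closed m_closed by simp
next
  assume A: "0 \<in> A \<and> 1 \<in> A \<and> (\<forall>x\<in>A. \<forall>y\<in>A. x + y \<in> A \<and> x * y \<in> A) \<and> (\<forall>x\<in>A. - x \<in> A)"
  show "is_subring A"
  proof (rule cringI)
    show "abelian_group (ring_on A)"
      by (rule abelian_groupI) (use A in \<open>auto simp: ring_on_def algebra_simps intro: bexI[of _ "- _"]\<close>)
    show "comm_monoid (ring_on A)"
      by (rule comm_monoidI) (use A in \<open>auto simp: ring_on_def algebra_simps\<close>)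
  qed (auto simp: ring_on_def algebra_simps)
qed

lemma is_subfield_iff:
  "is_subfield F \<longleftrightarrow> is_subring F \<and> (\<forall>x\<in>F. inverse x \<in> F)"
proof
  assume "is_subfield F"
  then interpret field "ring_on F" .
  have c: "carrier (ring_on F) = F" "\<zero>\<^bsub>ring_on F\<^esub> = 0" "\<one>\<^bsub>ring_on F\<^esub> = 1"
    "x \<otimes>\<^bsub>ring_on F\<^esub> y = x * y" for x y
    by (simp_all add: ring_on_def)
  have "inverse x \<in> F" if x: "x \<in> F" for x
  proof (cases "x = 0")
    case False
    then have "x \<in> Units (ring_on F)" using x by (simp add: field_Units c)
    then obtain y where "y \<in> F" "x * y = 1" by (auto simp: Units_def c)
    then show ?thesis using inverse_unique by metis
  qed (use x in simp)
  then show "is_subring F \<and> (\<forall>x\<in>F. inverse x \<in> F)" using is_cring by blast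
next
  assume A: "is_subring F \<and> (\<forall>x\<in>F. inverse x \<in> F)"
  then interpret cring "ring_on F" by blast
  show "is_subfield F"
  proof (rule cring_fieldI)
    show "Units (ring_on F) = carrier (ring_on F) - {\<zero>\<^bsub>ring_on F\<^esub>}"
      unfolding Units_def using A by (auto simp: ring_on_def intro!: bexI[of _ "inverse _"])
  qed
qed

locale set_field =
  fixes F :: "'a::field_char_0 set"
  assumes F: "is_subfield F"
begin

lemma zero [simp, intro]: "0 \<in> F" and one [simp, intro]: "1 \<in> F"
  and add [intro]: "x \<in> F \<Longrightarrow> y \<in> F \<Longrightarrow> x + y \<in> F"
  and mult [intro]: "x \<in> F \<Longrightarrow> y \<in> F \<Longrightarrow> x * y \<in> F"
  and uminus [intro]: "x \<in> F \<Longrightarrow> - x \<in> F"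
  and inverse [intro]: "x \<in> F \<Longrightarrow> inverse x \<in> F"
  using F by (auto simp: is_subfield_iff is_subring_iff)

lemma diff [intro]: "x \<in> F \<Longrightarrow> y \<in> F \<Longrightarrow> x - y \<in> F"
  using add[OF _ uminus] by fastforce

lemma divide [intro]: "x \<in> F \<Longrightarrow> y \<in> F \<Longrightarrow> x / y \<in> F"
  using mult[OF _ inverse] by (simp add: divide_inverse)

lemma power [intro]: "x \<in> F \<Longrightarrow> x ^ n \<in> F"
  by (induction n) auto

lemma power_int [intro]: "x \<in> F \<Longrightarrow> x powi n \<in> F"
  by (auto simp: power_int_def)

lemma sum [intro]: "(\<And>i. i \<in> I \<Longrightarrow> f i \<in> F) \<Longrightarrow> (\<Sum>i\<in>I. f i) \<in> F"
  by (induction I rule: infinite_finite_induct) auto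

lemma prod [intro]: "(\<And>i. i \<in> I \<Longrightarrow> f i \<in> F) \<Longrightarrow> (\<Prod>i\<in>I. f i) \<in> F"
  by (induction I rule: infinite_finite_induct) auto

lemma of_nat [simp, intro]: "of_nat n \<in> F"
  by (induction n) auto

lemma of_int [simp, intro]: "of_int n \<in> F"
  by (cases n) auto

lemma mult_cancel: "x \<in> F \<Longrightarrow> x \<noteq> 0 \<Longrightarrow> x * y \<in> F \<longleftrightarrow> y \<in> F"
  by (metis divide mult nonzero_mult_div_cancel_left)

end

lemma is_subring_UNIV: "is_subring (UNIV :: 'a::field set)"
  by (auto simp: is_subring_iff)

lemma is_subfield_UNIV: "is_subfield (UNIV :: 'a::field set)"
  by (auto simp: is_subfield_iff is_subring_UNIV)

lemma subring_gen_props: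
  shows subring_gen_superset: "S \<subseteq> subring_gen S"
    and subring_gen_is_subring: "is_subring (subring_gen S)"
    and subring_gen_least: "is_subring R \<Longrightarrow> S \<subseteq> R \<Longrightarrow> subring_gen S \<subseteq> R"
  unfolding subring_gen_def is_subring_iff by blast+


section \<open>Algebraic elements\<close>

lemma poly_over_iff: "0 \<in> F \<Longrightarrow> p \<in> poly_over F \<longleftrightarrow> (\<forall>i. Polynomial.coeff p i \<in> F)"
  unfolding poly_over_def
  by (cases "p = 0") (auto simp: coeffs_def subset_iff image_iff, metis coeff_eq_0 le_less_Suc_eq less_Suc_eq_le not_le_imp_less atLeastLessThan_iff bot_nat_0.extremum)

definition alg_over :: "'a::field set \<Rightarrow> 'a \<Rightarrow> bool" where
  "alg_over F x \<longleftrightarrow> (\<exists>p \<in> poly_over F. p \<noteq> 0 \<and> poly p x = 0)"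

lemma (in set_field) poly_over_iff': "p \<in> poly_over F \<longleftrightarrow> (\<forall>i. Polynomial.coeff p i \<in> F)"
  by (rule poly_over_iff) simp

lemma alg_over_mono: "F \<subseteq> L \<Longrightarrow> alg_over F x \<Longrightarrow> alg_over L x"
  unfolding alg_over_def poly_over_def by blast

lemma ring_on_simps [simp]:
  "carrier (ring_on A) = A" "\<zero>\<^bsub>ring_on A\<^esub> = 0" "\<one>\<^bsub>ring_on A\<^esub> = 1"
  "x \<oplus>\<^bsub>ring_on A\<^esub> y = x + y" "x \<otimes>\<^bsub>ring_on A\<^esub> y = x * y"
  by (simp_all add: ring_on_def)

lemma ring_on_pow [simp]: "x [^]\<^bsub>ring_on A\<^esub> (n::nat) = x ^ n"
  by (induction n) (simp_all add: nat_pow_def mult.commute)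

lemma subfield_UNIV: "is_subfield F \<Longrightarrow> subfield F (ring_on (UNIV :: 'a::field set))"
  by (rule ring.subfield_iff(1)[OF field.is_ring])
    (simp_all add: ring_on_def is_subfield_UNIV[unfolded ring_on_def])

lemma eval_ring_on: "ring.eval (ring_on (UNIV :: 'a::field set)) xs z = poly (Poly (rev xs)) z"
proof -
  interpret field "ring_on (UNIV :: 'a set)" by (rule is_subfield_UNIV)
  show ?thesis
    by (induction xs) (simp_all add: Poly_append poly_monom algebra_simps)
qed

text \<open>
  The link to the dimension theory of finite extensions, which represents polynomials by lists
  with the leading coefficient first.
\<close>
lemma algebraic_ring_on:
  assumes "is_subfield F"
  shows "alg_over F x \<longleftrightarrow> (ring.algebraic (ring_on (UNIV :: 'a::field set)) over F) x"
proof -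
  interpret R: field "ring_on (UNIV :: 'a set)" by (rule is_subfield_UNIV)
  have sr: "subring F (ring_on UNIV)" using subfield_UNIV[OF assms] by (rule subfieldE)
  show ?thesis
  proof
    assume "alg_over F x"
    then obtain p where p: "set (coeffs p) \<subseteq> F" "p \<noteq> 0" "poly p x = 0"
      by (auto simp: alg_over_def poly_over_def)
    show "(R.algebraic over F) x"
    proof (rule R.algebraicI[of "rev (coeffs p)"])
      show "rev (coeffs p) \<in> carrier (F[X]\<^bsub>ring_on UNIV\<^esub>)"
        using p by (auto simp: univ_poly_def polynomial_def hd_rev last_coeffs_eq_coeff_degree)
    qed (use p in \<open>simp_all add: eval_ring_on\<close>)
  next
    assume "(R.algebraic over F) x"
    then obtain p where p: "p \<in> carrier (F[X]\<^bsub>ring_on UNIV\<^esub>)" "p \<noteq> []"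
        "ring.eval (ring_on UNIV) p x = 0"
      using R.algebraicE[OF sr] by auto
    then have hd: "hd p \<noteq> 0" "set p \<subseteq> F" by (auto simp: univ_poly_def polynomial_def)
    have c: "coeffs (Poly (rev p)) = rev p"
      using hd p(2) by (cases p) auto
    show "alg_over F x"
      unfolding alg_over_def poly_over_def
      by (rule bexI[of _ "Poly (rev p)"])
        (use p hd c eval_ring_on[of p x] in \<open>auto simp: coeffs_eq_Nil[symmetric] simp del: coeffs_eq_Nil coeffs_Poly\<close>)
  qed
qed

lemma algebraic_elements_subfield:
  assumes "is_subfield F"
  shows "is_subfield {x. alg_over F x}"
proof -
  interpret R: field "ring_on (UNIV :: 'a set)" by (rule is_subfield_UNIV)
  have "subfield {x \<in> carrier (ring_on UNIV). (R.algebraic over F) x} (ring_on UNIV)"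
    by (rule R.subfield_of_algebraics) (rule subfield_UNIV[OF assms])
  from R.subfield_iff(2)[OF this] show ?thesis
    by (simp add: algebraic_ring_on[OF assms] ring_on_def)
qed

text \<open>
  The coefficients of \<open>p\<close> generate an extension of finite dimension, over which \<open>x\<close> generates
  another one, and dimensions multiply in towers.
\<close>
lemma alg_over_trans:
  assumes F: "is_subfield F" and p: "p \<noteq> 0" "\<And>i. alg_over F (Polynomial.coeff p i)" "poly p x = 0"
  shows "alg_over F x"
proof -
  interpret R: field "ring_on (UNIV :: 'a set)" by (rule is_subfield_UNIV)
  let ?alg = "\<lambda>F x. (R.algebraic over F) x"
  define E where "E = R.finite_extension F (coeffs p)"
  note sF = subfield_UNIV[OF F]
  have alg: "?alg F y" if "y \<in> set (coeffs p)" for y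
    using that p(2) by (auto simp: coeffs_def algebraic_ring_on[OF F] split: if_splits)
  have E: "subfield E (ring_on UNIV)"
    unfolding E_def by (rule R.finite_extension_is_subfield[OF sF]) (use alg in auto)
  have E': "is_subfield E" using R.subfield_iff(2)[OF E] by (simp add: ring_on_def)
  have "set (coeffs p) \<subseteq> E"
    unfolding E_def by (rule R.finite_extension_mem[OF subfieldE(1)[OF sF]]) simp
  then have "alg_over E x" using p unfolding alg_over_def poly_over_def by blast
  then have x: "?alg E x" by (simp add: algebraic_ring_on[OF E'])
  have d1: "R.finite_dimension F E"
    unfolding E_def by (rule R.finite_extension_finite_dimension(1)[OF sF]) (use alg in auto)
  have d2: "R.finite_dimension E (R.simple_extension E x)"
    using R.finite_dimension_simple_extension[OF E] x by simp
  have "R.finite_dimension F (R.simple_extension E x)"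
    using R.telescopic_base_dim(1)[OF sF E d1 d2] .
  moreover have "subring (R.simple_extension E x) (ring_on UNIV)"
    by (rule R.simple_extension_is_subring) (use subfieldE(1)[OF E] in auto)
  moreover have "x \<in> R.simple_extension E x"
    by (rule R.simple_extension_mem) (use subfieldE(1)[OF E] in auto)
  ultimately have "?alg F x"
    by (intro R.finite_dimension_imp_algebraic[OF sF])
  then show ?thesis by (simp add: algebraic_ring_on[OF F])
qed


section \<open>Polynomials over a subfield\<close>

lemma degree_cancel_lead_coeff:
  fixes p m :: "'a::field poly"
  assumes "p \<noteq> 0" "lead_coeff m = 1" "degree m \<le> degree p"
  defines "p' \<equiv> p - m * Polynomial.monom (lead_coeff p) (degree p - degree m)"
  shows "p' = 0 \<or> degree p' < degree p"
proof -
  define t where "t = Polynomial.monom (lead_coeff p) (degree p - degree m)"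
  have m0: "m \<noteq> 0" using assms(2) by auto
  have "t \<noteq> 0" "degree t = degree p - degree m" "lead_coeff t = lead_coeff p"
    using assms(1) by (auto simp: t_def degree_monom_eq)
  then have "degree (m * t) = degree p" "lead_coeff (m * t) = lead_coeff p"
    using m0 assms lead_coeff_mult[of m t] by (simp_all add: degree_mult_eq)
  then show ?thesis
    unfolding p'_def t_def by (metis degree_diff_less right_minus_eq coeff_diff leading_coeff_0_iff degree_diff_le_max max.idem nat_less_le diff_self)
qed

context set_field begin

lemma poly_over_0 [intro, simp]: "0 \<in> poly_over F"
  and poly_over_add [intro]: "p \<in> poly_over F \<Longrightarrow> q \<in> poly_over F \<Longrightarrow> p + q \<in> poly_over F"
  and poly_over_diff [intro]: "p \<in> poly_over F \<Longrightarrow> q \<in> poly_over F \<Longrightarrow> p - q \<in> poly_over F"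
  and poly_over_smult [intro]: "c \<in> F \<Longrightarrow> p \<in> poly_over F \<Longrightarrow> Polynomial.smult c p \<in> poly_over F"
  and poly_over_monom [intro]: "c \<in> F \<Longrightarrow> Polynomial.monom c n \<in> poly_over F"
  and poly_over_const [intro]: "c \<in> F \<Longrightarrow> [:c:] \<in> poly_over F"
  by (auto simp: poly_over_iff' coeff_pCons split: nat.split)

lemma poly_over_mult [intro]: "p \<in> poly_over F \<Longrightarrow> q \<in> poly_over F \<Longrightarrow> p * q \<in> poly_over F"
  by (auto simp: poly_over_iff' coeff_mult)

lemma poly_over_prod [intro]: "(\<And>i. i \<in> I \<Longrightarrow> p i \<in> poly_over F) \<Longrightarrow> (\<Prod>i\<in>I. p i) \<in> poly_over F"
  by (induction I rule: infinite_finite_induct) (auto simp: one_pCons)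

lemma poly_over_pderiv [intro]: "p \<in> poly_over F \<Longrightarrow> pderiv p \<in> poly_over F"
  unfolding poly_over_iff' coeff_pderiv using of_nat mult by blast

lemma poly_over_pConsD: "pCons a p \<in> poly_over F \<Longrightarrow> a \<in> F \<and> p \<in> poly_over F"
  unfolding poly_over_iff' by (metis coeff_pCons_0 coeff_pCons_Suc)

lemma poly_in: "p \<in> poly_over F \<Longrightarrow> x \<in> F \<Longrightarrow> poly p x \<in> F"
  by (auto simp: poly_altdef poly_over_iff')

lemma poly_over_division:
  assumes m: "m \<in> poly_over F" "lead_coeff m = 1" and p: "p \<in> poly_over F"
  shows "\<exists>q\<in>poly_over F. \<exists>r\<in>poly_over F. p = m * q + r \<and> (r = 0 \<or> degree r < degree m)"
  using p
proof (induction "degree p" arbitrary: p rule: less_induct)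
  case less
  show ?case
  proof (cases "p = 0 \<or> degree p < degree m")
    case True
    then show ?thesis using less.prems by (intro bexI[of _ 0] bexI[of _ p]) auto
  next
    case False
    then have p0: "p \<noteq> 0" and le: "degree m \<le> degree p" by auto
    have m0: "m \<noteq> 0" using m(2) by auto
    define t where "t = Polynomial.monom (lead_coeff p) (degree p - degree m)"
    have t: "t \<in> poly_over F" unfolding t_def using less.prems by (auto simp: poly_over_iff')
    define p' where "p' = p - m * t"
    have p': "p' \<in> poly_over F" unfolding p'_def using less.prems m t by blast
    have d: "p' = 0 \<or> degree p' < degree p"
      unfolding p'_def t_def by (rule degree_cancel_lead_coeff) (use p0 le m in auto)
    show ?thesis
    proof (cases "p' = 0")
      case True
      then show ?thesis using t by (intro bexI[of _ t] bexI[of _ 0]) (auto simp: p'_def)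
    next
      case False
      with d less.hyps[of p'] p' obtain q r where "q\<in>poly_over F" "r\<in>poly_over F"
        "p' = m * q + r" "r = 0 \<or> degree r < degree m" by blast
      then show ?thesis using t
        by (intro bexI[of _ "q + t"] bexI[of _ r]) (auto simp: p'_def algebra_simps)
    qed
  qed
qed

definition minpoly :: "'a \<Rightarrow> 'a poly \<Rightarrow> bool" where
  "minpoly x m \<longleftrightarrow> m \<in> poly_over F \<and> lead_coeff m = 1 \<and> degree m > 0 \<and> poly m x = 0 \<and>
     (\<forall>p\<in>poly_over F. poly p x = 0 \<and> p \<noteq> 0 \<longrightarrow> degree m \<le> degree p)"

lemma minpoly_ex:
  assumes "alg_over F x" obtains m where "minpoly x m"
proof -
  let ?P = "\<lambda>p. p \<in> poly_over F \<and> p \<noteq> 0 \<and> poly p x = 0"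
  obtain p where "?P p" using assms by (auto simp: alg_over_def)
  then obtain m where m: "?P m" "\<And>p. ?P p \<Longrightarrow> degree m \<le> degree p"
    using ex_has_least_nat[of ?P p degree] by blast
  define m' where "m' = Polynomial.smult (inverse (lead_coeff m)) m"
  have "lead_coeff m \<in> F" using m(1) by (auto simp: poly_over_iff')
  then have "m' \<in> poly_over F" "lead_coeff m' = 1" "poly m' x = 0" and deg: "degree m' = degree m"
    using m(1) by (auto simp: m'_def)
  moreover have "degree m > 0"
  proof (rule ccontr)
    assume "\<not> degree m > 0"
    then obtain c where "m = [:c:]" by (auto elim: degree_eq_zeroE)
    then show False using m(1) by auto
  qed
  moreover have "degree m \<le> degree p" if "p \<in> poly_over F" "poly p x = 0" "p \<noteq> 0" for p
    using m(2) that by blast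
  ultimately show ?thesis using that[of m'] unfolding minpoly_def deg by blast
qed

lemma minpoly_dvd:
  assumes m: "minpoly x m" and p: "p \<in> poly_over F" "poly p x = 0"
  obtains q where "q \<in> poly_over F" "p = m * q"
proof -
  obtain q r where qr: "q\<in>poly_over F" "r\<in>poly_over F" "p = m * q + r" "r = 0 \<or> degree r < degree m"
    using poly_over_division[of m p] m p(1) unfolding minpoly_def by blast
  have "poly r x = 0" using qr(3) p(2) m by (simp add: minpoly_def)
  then have "r = 0" using qr(2,4) m unfolding minpoly_def by (metis not_le)
  then show ?thesis using that qr by auto
qed

end

lemma degree_pderiv_less:
  fixes p :: "'a::field_char_0 poly"
  assumes "degree p > 0"
  shows "pderiv p \<noteq> 0" "degree (pderiv p) < degree p"
  using assms by (auto simp: pderiv_eq_0_iff degree_pderiv)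

lemma (in set_field) poly_over_root_factor:
  assumes "p \<in> poly_over F" "x \<in> F" "poly p x = 0"
  obtains q where "q \<in> poly_over F" "p = [:- x, 1:] * q"
proof -
  have "[:- x, 1:] \<in> poly_over F" using assms(2) by (auto simp: poly_over_iff' coeff_pCons split: nat.split)
  then obtain q r where qr: "q \<in> poly_over F" "p = [:- x, 1:] * q + r" "r = 0 \<or> degree r < 1"
    using poly_over_division[of "[:- x, 1:]" p] assms(1) by auto
  then have "poly r x = 0" using assms(3) by simp
  then have "r = 0" using qr(3) by (auto elim: degree_eq_zeroE)
  then show ?thesis using that qr by auto
qed

text \<open>
  Otherwise \<open>x\<close> is a root of the derivative of \<open>m\<close>, which is nonzero in characteristic 0
  and has smaller degree.
\<close>
lemma (in set_field) minpoly_simple_root: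
  assumes "minpoly x m" "m = [:- x, 1:] * q"
  shows "poly q x \<noteq> 0"
proof
  assume "poly q x = 0"
  moreover have "pderiv m = [:- x, 1:] * pderiv q + q * pderiv [:- x, 1:]"
    by (simp only: assms(2) pderiv_mult)
  ultimately have "poly (pderiv m) x = 0" by (simp add: pderiv_pCons)
  then show False using assms(1) degree_pderiv_less[of m] poly_over_pderiv[of m]
    unfolding minpoly_def by (meson not_less)
qed


section \<open>Separable closures in characteristic 0\<close>

definition root_closed :: "'a::field set \<Rightarrow> bool" where
  "root_closed L \<longleftrightarrow> (\<forall>p\<in>poly_over L. degree p > 0 \<longrightarrow> (\<exists>x\<in>L. poly p x = 0))"

lemma root_closedD: "root_closed (UNIV :: 'a::field set) \<Longrightarrow> degree p > 0 \<Longrightarrow> \<exists>x::'a. poly p x = 0"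
  by (simp add: root_closed_def poly_over_def)

text \<open>
  A divisor of \<open>p\<close> of least positive degree has no common factor with its derivative, so it is
  separable.
\<close>
lemma separably_closed_imp_root_closed:
  fixes F :: "'a::field_char_0 set"
  assumes "is_separable_closure F UNIV"
  shows "root_closed (UNIV :: 'a set)"
  unfolding root_closed_def
proof (intro ballI impI)
  fix p :: "'a poly" assume "degree p > 0"
  then obtain q where q: "degree q > 0" "q dvd p"
      and min: "\<And>r. degree r > 0 \<Longrightarrow> r dvd p \<Longrightarrow> degree q \<le> degree r"
    using ex_has_least_nat[of "\<lambda>q. degree q > 0 \<and> q dvd p" p degree] by auto
  have "coprime q (pderiv q)"
  proof (rule coprimeI)
    fix d assume d: "d dvd q" "d dvd pderiv q"
    have "degree d < degree q"
      using degree_pderiv_less[OF q(1)] d(2) dvd_imp_degree_le le_less_trans by blast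
    then have "degree d = 0" using min[of d] d(1) q(2) dvd_trans by fastforce
    moreover have "d \<noteq> 0" using d(1) q(1) by auto
    ultimately show "is_unit d" by (simp add: is_unit_iff_degree)
  qed
  then have "separable_poly q" using q by (auto simp: separable_poly_def)
  then obtain x where "poly q x = 0" using assms q by (auto simp: is_separable_closure_def poly_over_def)
  then show "\<exists>x\<in>UNIV. poly p x = 0" using q(2) by (auto elim!: dvdE)
qed

text \<open>
  Minimal polynomials are separable: a common root \<open>y\<close> of \<open>m\<close> and its derivative would have
  a minimal polynomial that divides \<open>m\<close> properly.
\<close>
lemma (in set_field) separable_over_iff:
  assumes rc: "root_closed (UNIV :: 'a set)"
  shows "separable_over F x \<longleftrightarrow> alg_over F x"
proof
  assume "alg_over F x"
  then obtain m where m: "minpoly x m" by (rule minpoly_ex)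
  then have deg: "degree m > 0" and mF: "m \<in> poly_over F" and m0: "m \<noteq> 0" by (auto simp: minpoly_def)
  have "coprime m (pderiv m)"
  proof (rule coprimeI, rule ccontr)
    fix d assume d: "d dvd m" "d dvd pderiv m" "\<not> is_unit d"
    then have "degree d > 0" using m0 by (auto simp: is_unit_iff_degree)
    then obtain y where y: "poly d y = 0" using root_closedD[OF rc] by blast
    then have my: "poly m y = 0" "poly (pderiv m) y = 0" using d by (auto elim!: dvdE)
    then have "alg_over F y" using mF m0 by (auto simp: alg_over_def)
    then obtain n where n: "minpoly y n" by (rule minpoly_ex)
    from n mF my(1) obtain e where e: "e \<in> poly_over F" "m = n * e" by (rule minpoly_dvd)
    have "degree n \<le> degree (pderiv m)"
      using n my(2) degree_pderiv_less[OF deg] poly_over_pderiv[OF mF] by (auto simp: minpoly_def)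
    then have nm: "degree n < degree m" using degree_pderiv_less[OF deg] by linarith
    have "e \<noteq> 0" "n \<noteq> 0" using e m0 by auto
    moreover have "degree n + degree e = degree m" using e(2) \<open>e \<noteq> 0\<close> \<open>n \<noteq> 0\<close> by (simp add: degree_mult_eq)
    moreover have "poly n x = 0 \<or> poly e x = 0" using m e(2) by (auto simp: minpoly_def)
    moreover have "degree n > 0" using n by (simp add: minpoly_def)
    ultimately have "degree e < degree m" "poly n x = 0 \<or> poly e x = 0" by linarith+
    moreover have "n \<in> poly_over F" using n by (simp add: minpoly_def)
    ultimately show False
      using m e(1) nm \<open>e \<noteq> 0\<close> \<open>n \<noteq> 0\<close> unfolding minpoly_def by (meson not_less)
  qed
  then show "separable_over F x" using m m0 by (auto simp: separable_over_def separable_poly_def minpoly_def)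
qed (auto simp: separable_over_def separable_poly_def alg_over_def)

context set_field
begin

lemma sep_closure_eq: "root_closed (UNIV :: 'a set) \<Longrightarrow> sep_closure F = {x. alg_over F x}"
  by (simp add: sep_closure_def separable_over_iff)

lemma sep_closure_subfield: "root_closed (UNIV :: 'a set) \<Longrightarrow> is_subfield (sep_closure F)"
  using algebraic_elements_subfield[OF F] by (simp add: sep_closure_eq)

lemma sep_closure_root:
  assumes "root_closed (UNIV :: 'a set)" "p \<in> poly_over (sep_closure F)" "p \<noteq> 0" "poly p x = 0"
  shows "x \<in> sep_closure F"
proof -
  interpret C: set_field "sep_closure F" by (rule set_field.intro) (rule sep_closure_subfield[OF assms(1)])
  have "alg_over F (Polynomial.coeff p i)" for i
    using assms(2) unfolding C.poly_over_iff' by (simp add: sep_closure_eq[OF assms(1)])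
  then show ?thesis using alg_over_trans[OF F assms(3) _ assms(4)]
    by (simp add: sep_closure_eq[OF assms(1)])
qed

lemma sep_closure_root_closed:
  assumes "root_closed (UNIV :: 'a set)" shows "root_closed (sep_closure F)"
  unfolding root_closed_def
proof (intro ballI impI)
  fix p assume p: "p \<in> poly_over (sep_closure F)" "degree p > 0"
  obtain x where "poly p x = 0" using root_closedD[OF assms p(2)] by blast
  moreover have "p \<noteq> 0" using p(2) by auto
  ultimately show "\<exists>x\<in>sep_closure F. poly p x = 0" using sep_closure_root[OF assms p(1)] by blast
qed

lemma sep_closure_superset: "F \<subseteq> sep_closure F"
proof
  fix x assume "x \<in> F"
  then show "x \<in> sep_closure F"
    unfolding sep_closure_def separable_over_def separable_poly_def
    by (auto intro!: bexI[of _ "[:- x, 1:]"] simp: pderiv_pCons poly_over_iff' coeff_pCons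
        simp flip: one_pCons split: nat.split)
qed

end

text \<open>
  The minimal polynomial of \<open>x \<noteq> 0\<close> has a nonzero constant term, and dividing it by \<open>x\<close> expresses
  \<open>1/x\<close> as a polynomial in \<open>x\<close>.
\<close>
lemma algebraic_subring_is_subfield:
  assumes "set_field F" "is_subring R" "F \<subseteq> R" "\<And>x. x \<in> R \<Longrightarrow> alg_over F x"
  shows "is_subfield R"
proof -
  interpret set_field F by fact
  have R: "x + y \<in> R" "x * y \<in> R" "- x \<in> R" "1 \<in> R" "0 \<in> R" if "x \<in> R" "y \<in> R" for x y
    using assms(2) that by (auto simp: is_subring_iff)
  have "inverse x \<in> R" if x: "x \<in> R" for x
  proof (cases "x = 0")
    case False
    have p: "poly p x \<in> R" if "p \<in> poly_over F" for p
      using that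
    proof (induction p)
      case (pCons a p)
      then have "p \<in> poly_over F" "a \<in> F" by (auto dest: poly_over_pConsD)
      then show ?case using pCons R x assms(3) by auto
    qed (use R x in auto)
    obtain m where m: "minpoly x m" using assms(4)[OF x] by (rule minpoly_ex)
    obtain a q where aq: "m = pCons a q" by (cases m)
    have aF: "a \<in> F" "q \<in> poly_over F" using m unfolding aq minpoly_def by (auto dest: poly_over_pConsD)
    have q0: "q \<noteq> 0" using m by (auto simp: aq minpoly_def split: if_splits)
    have "a \<noteq> 0"
    proof
      assume "a = 0"
      then have "poly q x = 0" using m False by (auto simp: aq minpoly_def)
      then show False using m aF(2) q0 unfolding minpoly_def aq by (metis Suc_n_not_le_n degree_pCons_eq)
    qed
    have "x * poly q x = - a" using m by (simp add: aq minpoly_def eq_neg_iff_add_eq_0 add.commute)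
    then have "x * (- inverse a * poly q x) = 1" using \<open>a \<noteq> 0\<close>
      by (simp add: field_simps)
    then have "inverse x = - inverse a * poly q x" by (rule inverse_unique)
    also have "\<dots> \<in> R"
      using R(2) p[OF aF(2)] subsetD[OF assms(3) uminus[OF inverse[OF aF(1)]]] by blast
    finally show ?thesis .
  next
    case True
    then show ?thesis using x by simp
  qed
  then show ?thesis using assms(2) by (simp add: is_subfield_iff)
qed


section \<open>Galois groups\<close>

lemma Gal_iff:
  "\<sigma> \<in> carrier (Gal L F) \<longleftrightarrow> \<sigma> \<in> extensional L \<and> bij_betw \<sigma> L L \<and>
     (\<forall>x\<in>L. \<forall>y\<in>L. \<sigma> (x + y) = \<sigma> x + \<sigma> y \<and> \<sigma> (x * y) = \<sigma> x * \<sigma> y) \<and> (\<forall>x\<in>F. \<sigma> x = x)"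
  by (auto simp: Gal_def Bij_def)

locale field_aut =
  fixes L :: "'a::field_char_0 set" and \<sigma>
  assumes L: "is_subfield L" and bij: "bij_betw \<sigma> L L"
    and hom_add: "x \<in> L \<Longrightarrow> y \<in> L \<Longrightarrow> \<sigma> (x + y) = \<sigma> x + \<sigma> y"
    and hom_mult: "x \<in> L \<Longrightarrow> y \<in> L \<Longrightarrow> \<sigma> (x * y) = \<sigma> x * \<sigma> y"

lemma Gal_field_aut: "is_subfield L \<Longrightarrow> \<sigma> \<in> carrier (Gal L F) \<Longrightarrow> field_aut L \<sigma>"
  by (simp add: Gal_iff field_aut_def)

sublocale field_aut \<subseteq> L: set_field L
  by (rule set_field.intro) (rule L)

context field_aut
begin

lemma closed [intro, simp]: "x \<in> L \<Longrightarrow> \<sigma> x \<in> L"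
  using bij by (auto simp: bij_betw_def)

lemma inj: "x \<in> L \<Longrightarrow> y \<in> L \<Longrightarrow> \<sigma> x = \<sigma> y \<longleftrightarrow> x = y"
  using bij by (auto simp: bij_betw_def inj_on_def)

lemma surj: "y \<in> L \<Longrightarrow> \<exists>x\<in>L. \<sigma> x = y"
  using bij unfolding bij_betw_def by (metis imageE)

lemma hom_0 [simp]: "\<sigma> 0 = 0"
  using hom_add[of 0 0] by simp

lemma hom_eq_0 [simp]: "x \<in> L \<Longrightarrow> \<sigma> x = 0 \<longleftrightarrow> x = 0"
  using inj[of x 0] by simp

lemma hom_1 [simp]: "\<sigma> 1 = 1"
  using hom_mult[of 1 1] hom_eq_0[of 1] by simp

lemma hom_uminus: "x \<in> L \<Longrightarrow> \<sigma> (- x) = - \<sigma> x"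
  using hom_add[of x "- x"] by (simp add: L.uminus eq_neg_iff_add_eq_0 add.commute)

lemma hom_diff: "x \<in> L \<Longrightarrow> y \<in> L \<Longrightarrow> \<sigma> (x - y) = \<sigma> x - \<sigma> y"
  using hom_add[of x "- y"] hom_uminus[of y] by (simp add: L.uminus)

lemma hom_divide: "x \<in> L \<Longrightarrow> y \<in> L \<Longrightarrow> \<sigma> (x / y) = \<sigma> x / \<sigma> y"
  using hom_mult[of "x / y" y] by (cases "y = 0") (simp_all add: L.divide field_simps)

lemma hom_power: "x \<in> L \<Longrightarrow> \<sigma> (x ^ n) = \<sigma> x ^ n"
  by (induction n) (simp_all add: hom_mult L.power)

lemma hom_sum: "(\<And>i. i \<in> I \<Longrightarrow> f i \<in> L) \<Longrightarrow> \<sigma> (\<Sum>i\<in>I. f i) = (\<Sum>i\<in>I. \<sigma> (f i))"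
  by (induction I rule: infinite_finite_induct) (simp_all add: hom_add L.sum)

lemma hom_sum_list: "set xs \<subseteq> L \<Longrightarrow> sum_list xs \<in> L \<and> \<sigma> (sum_list xs) = sum_list (map \<sigma> xs)"
  by (induction xs) (auto simp add: hom_add L.add)

lemma hom_of_nat [simp]: "\<sigma> (of_nat n) = of_nat n"
  by (induction n) (simp_all add: hom_add)

lemma hom_poly:
  assumes "x \<in> L" "\<And>i. Polynomial.coeff p i \<in> L" "\<And>i. \<sigma> (Polynomial.coeff p i) = Polynomial.coeff p i"
  shows "\<sigma> (poly p x) = poly p (\<sigma> x)"
  using assms by (simp add: poly_altdef hom_sum hom_mult L.mult L.power hom_power)

end

lemma subgroup_Gal:
  fixes L :: "'a::field_char_0 set"
  assumes L: "is_subfield L" and FL: "F \<subseteq> L"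
  shows "subgroup (carrier (Gal L F)) (BijGroup L)"
proof (rule group.subgroupI[OF group_BijGroup])
  show "carrier (Gal L F) \<subseteq> carrier (BijGroup L)" by (auto simp: Gal_def BijGroup_def)
  have "(\<lambda>x\<in>L. x) \<in> carrier (Gal L F)"
    using FL L by (auto simp: Gal_iff is_subfield_iff is_subring_iff bij_betw_def inj_on_def)
  then show "carrier (Gal L F) \<noteq> {}" by blast
next
  fix \<sigma> assume s: "\<sigma> \<in> carrier (Gal L F)"
  interpret field_aut L \<sigma> using Gal_field_aut[OF L s] .
  have B: "\<sigma> \<in> Bij L" using s by (auto simp: Gal_iff Bij_def)
  define t where "t = restrict (inv_into L \<sigma>) L"
  have t1: "t x \<in> L" "\<sigma> (t x) = x" if "x \<in> L" for x
    using that bij by (auto simp: t_def bij_betw_def inv_into_into f_inv_into_f)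
  have "bij_betw t L L"
    unfolding t_def using bij_betw_inv_into[OF bij] by (simp cong: bij_betw_cong)
  moreover have "t (x + y) = t x + t y \<and> t (x * y) = t x * t y" if "x \<in> L" "y \<in> L" for x y
    using inj[of "t (x + y)" "t x + t y"] inj[of "t (x * y)" "t x * t y"] t1 that
    by (simp add: hom_add hom_mult L.add L.mult)
  moreover have "t x = x" if "x \<in> F" for x
    using inj[of "t x" x] t1[of x] s that FL by (auto simp: Gal_iff)
  ultimately have "t \<in> carrier (Gal L F)" by (auto simp: Gal_iff t_def)
  then show "inv\<^bsub>BijGroup L\<^esub> \<sigma> \<in> carrier (Gal L F)"
    using inv_BijGroup[OF B] by (simp add: t_def)
next
  fix \<sigma> \<tau> assume s: "\<sigma> \<in> carrier (Gal L F)" "\<tau> \<in> carrier (Gal L F)"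
  interpret s: field_aut L \<sigma> using Gal_field_aut[OF L s(1)] .
  interpret t: field_aut L \<tau> using Gal_field_aut[OF L s(2)] .
  have B: "\<sigma> \<in> Bij L" "\<tau> \<in> Bij L" using s by (auto simp: Gal_iff Bij_def)
  moreover have "compose L \<sigma> \<tau> \<in> carrier (Gal L F)"
    using compose_Bij[OF B] s FL
    by (auto simp: Gal_def compose_def s.hom_add t.hom_add s.hom_mult t.hom_mult s.L.add s.L.mult subset_iff)
  ultimately show "\<sigma> \<otimes>\<^bsub>BijGroup L\<^esub> \<tau> \<in> carrier (Gal L F)" by (simp add: BijGroup_def)
qed

context
  fixes L F :: "'a::field_char_0 set"
  assumes L: "is_subfield L" and FL: "F \<subseteq> L"
begin

lemma Gal_group: "group (Gal L F)"
proof -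
  have "Gal L F = BijGroup L\<lparr>carrier := carrier (Gal L F)\<rparr>" by (simp add: Gal_def)
  then show ?thesis using subgroup.subgroup_is_group[OF subgroup_Gal[OF L FL] group_BijGroup] by metis
qed

lemma Gal_mult:
  assumes "\<sigma> \<in> carrier (Gal L F)" "\<tau> \<in> carrier (Gal L F)"
  shows "\<sigma> \<otimes>\<^bsub>Gal L F\<^esub> \<tau> = compose L \<sigma> \<tau>"
  using assms by (auto simp: Gal_def BijGroup_def)

lemma Gal_one: "\<one>\<^bsub>Gal L F\<^esub> = (\<lambda>x\<in>L. x)"
  by (simp add: Gal_def BijGroup_def)

lemma Gal_mult_apply:
  assumes "\<sigma> \<in> carrier (Gal L F)" "\<tau> \<in> carrier (Gal L F)" "x \<in> L"
  shows "(\<sigma> \<otimes>\<^bsub>Gal L F\<^esub> \<tau>) x = \<sigma> (\<tau> x)"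
  using Gal_mult[OF assms(1,2)] assms(3) by (simp add: compose_def)

lemma Gal_inv_apply:
  assumes s: "\<sigma> \<in> carrier (Gal L F)" and x: "x \<in> L"
  shows "(inv\<^bsub>Gal L F\<^esub> \<sigma>) (\<sigma> x) = x" "\<sigma> ((inv\<^bsub>Gal L F\<^esub> \<sigma>) x) = x" "(inv\<^bsub>Gal L F\<^esub> \<sigma>) x \<in> L"
proof -
  interpret group "Gal L F" by (rule Gal_group)
  interpret s: field_aut L \<sigma> using Gal_field_aut[OF L s] .
  interpret t: field_aut L "inv\<^bsub>Gal L F\<^esub> \<sigma>" using Gal_field_aut[OF L inv_closed[OF s]] .
  show "(inv\<^bsub>Gal L F\<^esub> \<sigma>) (\<sigma> x) = x" "\<sigma> ((inv\<^bsub>Gal L F\<^esub> \<sigma>) x) = x"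
    using Gal_mult_apply[OF inv_closed[OF s] s x] Gal_mult_apply[OF s inv_closed[OF s] x] s x
    by (auto simp: Gal_one)
  show "(inv\<^bsub>Gal L F\<^esub> \<sigma>) x \<in> L" using x by simp
qed

end

lemma Gal_eqI:
  assumes "\<sigma> \<in> carrier (Gal L F)" "\<tau> \<in> carrier (Gal L F')" "\<And>x. x \<in> L \<Longrightarrow> \<sigma> x = \<tau> x"
  shows "\<sigma> = \<tau>"
  using assms by (auto simp: Gal_iff intro: extensionalityI)


section \<open>Extension of embeddings\<close>

text \<open>
  Embeddings of intermediate rings into \<open>L\<close> are represented by their graphs, so that extension is
  inclusion and Zorn's lemma applies directly.  Since graphs are closed under subtraction, the
  last condition says that they are single-valued.
\<close>
definition partial_emb :: "'a::field set \<Rightarrow> 'a set \<Rightarrow> ('a \<times> 'a) set \<Rightarrow> bool" where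
  "partial_emb F L G \<longleftrightarrow> G \<subseteq> L \<times> L \<and> (\<forall>x\<in>F. (x, x) \<in> G) \<and>
     (\<forall>x x' y y'. (x, x') \<in> G \<longrightarrow> (y, y') \<in> G \<longrightarrow> (x + y, x' + y') \<in> G \<and> (x * y, x' * y') \<in> G) \<and>
     (\<forall>y. (0, y) \<in> G \<longrightarrow> y = 0)"

locale alg_ext = set_field F for F :: "'a::field_char_0 set" +
  fixes L :: "'a set"
  assumes L: "is_subfield L" and FL: "F \<subseteq> L" and alg: "\<And>x. x \<in> L \<Longrightarrow> alg_over F x"
    and rc: "root_closed L"
begin

sublocale L: set_field L
  by (rule set_field.intro) (rule L)

context
  fixes G assumes G: "partial_emb F L G"
begin

lemma
  shows G_L: "(x, y) \<in> G \<Longrightarrow> x \<in> L \<and> y \<in> L"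
    and G_F: "x \<in> F \<Longrightarrow> (x, x) \<in> G"
    and G_add: "(x, x') \<in> G \<Longrightarrow> (y, y') \<in> G \<Longrightarrow> (x + y, x' + y') \<in> G"
    and G_mult: "(x, x') \<in> G \<Longrightarrow> (y, y') \<in> G \<Longrightarrow> (x * y, x' * y') \<in> G"
    and G_0D: "(0, y) \<in> G \<Longrightarrow> y = 0"
  using G by (auto simp: partial_emb_def)

lemma G_uminus: "(x, x') \<in> G \<Longrightarrow> (- x, - x') \<in> G"
  using G_mult[OF G_F[of "- 1"], of x x'] by auto

lemma G_diff: "(x, x') \<in> G \<Longrightarrow> (y, y') \<in> G \<Longrightarrow> (x - y, x' - y') \<in> G"
  using G_add[OF _ G_uminus, of x x' y y'] by simp

lemma G_sum: "(\<And>i. i \<in> I \<Longrightarrow> (f i, g i) \<in> G) \<Longrightarrow> (\<Sum>i\<in>I. f i, \<Sum>i\<in>I. g i) \<in> G"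
  by (induction I rule: infinite_finite_induct) (auto intro: G_add G_F)

lemma G_fun: "(x, y) \<in> G \<Longrightarrow> (x, y') \<in> G \<Longrightarrow> y = y'"
  using G_diff[of x y x y'] G_0D by fastforce

text \<open>
  The polynomials over the domain, each paired with its image under the embedding.
\<close>
definition poly_graph :: "('a poly \<times> 'a poly) set" where
  "poly_graph = {(p, p'). \<forall>i. (Polynomial.coeff p i, Polynomial.coeff p' i) \<in> G}"

lemma PG_add: "(p, p') \<in> poly_graph \<Longrightarrow> (q, q') \<in> poly_graph \<Longrightarrow> (p + q, p' + q') \<in> poly_graph"
  by (auto simp: poly_graph_def intro: G_add)

lemma PG_diff: "(p, p') \<in> poly_graph \<Longrightarrow> (q, q') \<in> poly_graph \<Longrightarrow> (p - q, p' - q') \<in> poly_graph"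
  by (auto simp: poly_graph_def intro: G_diff)

lemma PG_mult: "(p, p') \<in> poly_graph \<Longrightarrow> (q, q') \<in> poly_graph \<Longrightarrow> (p * q, p' * q') \<in> poly_graph"
  by (auto simp: poly_graph_def coeff_mult intro!: G_sum G_mult)

lemma PG_smult:
  "(c, c') \<in> G \<Longrightarrow> (p, p') \<in> poly_graph \<Longrightarrow> (Polynomial.smult c p, Polynomial.smult c' p') \<in> poly_graph"
  by (auto simp: poly_graph_def intro: G_mult)

lemma PG_monom: "(c, c') \<in> G \<Longrightarrow> (Polynomial.monom c n, Polynomial.monom c' n) \<in> poly_graph"
  using G_F[of 0] by (auto simp: poly_graph_def)

lemma PG_F: "p \<in> poly_over F \<Longrightarrow> (p, p) \<in> poly_graph"
  by (simp add: poly_graph_def poly_over_iff' G_F)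

lemma PG_0: "(0, p) \<in> poly_graph \<Longrightarrow> p = 0"
  by (simp add: poly_graph_def poly_eq_iff) (meson G_0D)

lemma PG_L: "(p, p') \<in> poly_graph \<Longrightarrow> p \<in> poly_over L \<and> p' \<in> poly_over L"
  using G_L by (auto simp: poly_graph_def L.poly_over_iff')

text \<open>
  If \<open>m\<close> is the minimal polynomial of \<open>a\<close> over the domain of \<open>G\<close>, then sending \<open>a\<close> to a root \<open>b\<close>
  of the image of \<open>m\<close> respects every polynomial relation of \<open>a\<close>, by division by \<open>m\<close>.
\<close>
lemma partial_emb_step:
  assumes m: "(m, m') \<in> poly_graph" "lead_coeff m = 1" "poly m a = 0"
    and min: "\<And>p p'. (p, p') \<in> poly_graph \<Longrightarrow> poly p a = 0 \<Longrightarrow> p \<noteq> 0 \<Longrightarrow> degree m \<le> degree p"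
    and ab: "a \<in> L" "b \<in> L" "poly m' b = 0"
  obtains G' where "partial_emb F L G'" "G \<subseteq> G'" "(a, b) \<in> G'"
proof -
  have rel: "poly p' b = 0" if "(p, p') \<in> poly_graph" "poly p a = 0" for p p'
    using that
  proof (induction "degree p" arbitrary: p p' rule: less_induct)
    case less
    show ?case
    proof (cases "p = 0")
      case True
      then have "p' = 0" using PG_0 less.prems(1) by blast
      then show ?thesis by simp
    next
      case False
      define d where "d = degree p - degree m"
      define q q' where "q = p - m * Polynomial.monom (lead_coeff p) d"
        and "q' = p' - m' * Polynomial.monom (Polynomial.coeff p' (degree p)) d"
      have "(lead_coeff p, Polynomial.coeff p' (degree p)) \<in> G"
        using less.prems by (auto simp: poly_graph_def)
      then have q: "(q, q') \<in> poly_graph"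
        unfolding q_def q'_def by (intro PG_diff PG_mult PG_monom less.prems m)
      have qa: "poly q a = 0" using less.prems m by (simp add: q_def)
      have "q = 0 \<or> degree q < degree p"
        unfolding q_def d_def
        by (rule degree_cancel_lead_coeff) (use False m min less.prems in auto)
      moreover have "q' = 0" if "q = 0" using q PG_0 that by blast
      ultimately have "poly q' b = 0" using less.hyps[OF _ q qa] by force
      then show ?thesis using ab by (simp add: q'_def)
    qed
  qed
  define G' where "G' = {(poly p a, poly p' b) | p p'. (p, p') \<in> poly_graph}"
  have const: "([:x:], [:y:]) \<in> poly_graph" if "(x, y) \<in> G" for x y
    using that G_F[of 0] by (auto simp: poly_graph_def coeff_pCons split: nat.split)
  have "partial_emb F L G'"
    unfolding partial_emb_def
  proof (intro conjI allI ballI impI)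
    show "G' \<subseteq> L \<times> L" using PG_L L.poly_in ab unfolding G'_def by blast
    show "(x, x) \<in> G'" if "x \<in> F" for x
      using const[OF G_F[OF that]] unfolding G'_def by (auto intro!: exI[of _ "[:x:]"])
    show "y = 0" if "(0, y) \<in> G'" for y
      using that rel by (auto simp: G'_def)
    fix x x' y y' assume "(x, x') \<in> G'" "(y, y') \<in> G'"
    then obtain p p' q q' where *: "(p, p') \<in> poly_graph" "(q, q') \<in> poly_graph"
      "x = poly p a" "x' = poly p' b" "y = poly q a" "y' = poly q' b" by (auto simp: G'_def)
    show "(x + y, x' + y') \<in> G'" "(x * y, x' * y') \<in> G'"
      unfolding G'_def using PG_add[OF *(1,2)] PG_mult[OF *(1,2)] *(3-) by (auto, metis poly_add, metis poly_mult)
  qed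
  moreover have "G \<subseteq> G'"
    using const unfolding G'_def by (force intro!: exI[of _ "[:_:]"])
  moreover have "([:0, 1:], [:0, 1:]) \<in> poly_graph"
    by (rule PG_F) (auto simp: poly_over_iff' coeff_pCons split: nat.split)
  then have "(a, b) \<in> G'" unfolding G'_def by force
  ultimately show ?thesis using that by blast
qed

lemma partial_emb_extend:
  assumes a: "a \<in> L"
  obtains G' b where "partial_emb F L G'" "G \<subseteq> G'" "(a, b) \<in> G'"
proof -
  let ?P = "\<lambda>(p, p'). (p, p') \<in> poly_graph \<and> p \<noteq> 0 \<and> poly p a = 0"
  obtain p where "p \<in> poly_over F" "p \<noteq> 0" "poly p a = 0" using alg[OF a] by (auto simp: alg_over_def)
  then have "?P (p, p)" using PG_F by auto
  then obtain m m' where m: "?P (m, m')" and min: "\<And>p p'. ?P (p, p') \<Longrightarrow> degree m \<le> degree p"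
    using ex_has_least_nat[of ?P "(p, p)" "\<lambda>(p, p'). degree p"] by auto
  define D where "D = fst ` G"
  have D: "x \<in> D \<longleftrightarrow> (\<exists>y. (x, y) \<in> G)" for x by (force simp: D_def)
  have "is_subring D"
    unfolding is_subring_iff D
  proof (intro conjI ballI)
    show "\<exists>y. (0, y) \<in> G" "\<exists>y. (1, y) \<in> G" using G_F by blast+
    fix x assume x: "x \<in> D"
    then show "\<exists>y. (- x, y) \<in> G" unfolding D using G_uminus by blast
    fix y assume "y \<in> D"
    then show "\<exists>z. (x + y, z) \<in> G" "\<exists>z. (x * y, z) \<in> G"
      using x unfolding D using G_add G_mult by blast+
  qed
  moreover have "F \<subseteq> D" using G_F by (force simp: D_def)
  ultimately have "is_subfield D"
    using G_L alg by (intro algebraic_subring_is_subfield[OF set_field_axioms]) (auto simp: D_def)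
  moreover have "lead_coeff m \<in> D" using m by (force simp: poly_graph_def D_def image_iff)
  ultimately have "inverse (lead_coeff m) \<in> D" by (auto simp: is_subfield_iff)
  then obtain c where c: "(inverse (lead_coeff m), c) \<in> G" by (auto simp: D_def)
  define n n' where "n = Polynomial.smult (inverse (lead_coeff m)) m" and "n' = Polynomial.smult c m'"
  have n: "(n, n') \<in> poly_graph" unfolding n_def n'_def using PG_smult c m by auto
  have ln: "lead_coeff n = 1" "poly n a = 0" "degree n = degree m" using m by (auto simp: n_def)
  have "degree n > 0"
  proof (rule ccontr)
    assume "\<not> degree n > 0"
    then obtain c where "n = [:c:]" by (auto elim: degree_eq_zeroE)
    then show False using ln by auto
  qed
  moreover have "(1, Polynomial.coeff n' (degree n)) \<in> G" using n ln by (auto simp: poly_graph_def) metis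
  then have "Polynomial.coeff n' (degree n) = 1" using G_fun G_F by blast
  then have "degree n \<le> degree n'" by (intro le_degree) auto
  ultimately have "degree n' > 0" "n' \<in> poly_over L" using PG_L[OF n] by auto
  then obtain b where b: "b \<in> L" "poly n' b = 0"
    using rc unfolding root_closed_def by blast
  have min': "degree n \<le> degree p" if "(p, p') \<in> poly_graph" "poly p a = 0" "p \<noteq> 0" for p p'
    using min[of p p'] that ln(3) by simp
  show ?thesis
    by (rule partial_emb_step[OF n ln(1,2) min' a b]) (use that in auto)
qed

end

text \<open>
  A maximal graph is total by the previous lemma.  The embedding is onto because it permutes the
  roots in \<open>L\<close> of any polynomial over \<open>F\<close>.
\<close>
lemma partial_emb_total:
  assumes G: "partial_emb F L G"
  obtains \<sigma> where "\<sigma> \<in> carrier (Gal L F)" "\<And>x y. (x, y) \<in> G \<Longrightarrow> \<sigma> x = y"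
proof -
  define A where "A = {G'. partial_emb F L G' \<and> G \<subseteq> G'}"
  have "\<exists>M\<in>A. \<forall>X\<in>A. M \<subseteq> X \<longrightarrow> X = M"
  proof (rule subset_Zorn_nonempty)
    show "A \<noteq> {}" using G by (auto simp: A_def)
    fix Ch assume C: "Ch \<noteq> {}" "subset.chain A Ch"
    have emb: "partial_emb F L X" "G \<subseteq> X" if "X \<in> Ch" for X using C that by (auto simp: subset.chain_def A_def)
    have two: "\<exists>X\<in>Ch. u \<in> X \<and> v \<in> X" if uv: "u \<in> \<Union>Ch" "v \<in> \<Union>Ch" for u v
    proof -
      obtain X Y where XY: "X \<in> Ch" "u \<in> X" "Y \<in> Ch" "v \<in> Y" using uv by blast
      then have "X \<subseteq> Y \<or> Y \<subseteq> X" using C(2) by (auto simp: subset.chain_def)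
      then show ?thesis using XY by blast
    qed
    have "partial_emb F L (\<Union>Ch)"
      unfolding partial_emb_def
    proof (intro conjI allI impI ballI)
      show "\<Union>Ch \<subseteq> L \<times> L" using emb unfolding partial_emb_def by blast
      show "(x, x) \<in> \<Union>Ch" if "x \<in> F" for x using emb C(1) that unfolding partial_emb_def by blast
      show "y = 0" if "(0, y) \<in> \<Union>Ch" for y using emb that unfolding partial_emb_def by blast
      fix x x' y y' assume "(x, x') \<in> \<Union>Ch" "(y, y') \<in> \<Union>Ch"
      then obtain X where "X \<in> Ch" "(x, x') \<in> X" "(y, y') \<in> X" using two by blast
      then show "(x + y, x' + y') \<in> \<Union>Ch" "(x * y, x' * y') \<in> \<Union>Ch"
        using emb unfolding partial_emb_def by blast+
    qed
    then show "\<Union>Ch \<in> A" using emb C(1) by (auto simp: A_def)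
  qed
  then obtain M where M: "partial_emb F L M" "G \<subseteq> M"
    and max: "\<And>X. partial_emb F L X \<Longrightarrow> M \<subseteq> X \<Longrightarrow> X = M" by (auto simp: A_def)
  have "\<exists>y. (x, y) \<in> M" if "x \<in> L" for x
    using partial_emb_extend[OF M(1) that] max by metis
  then have ex1: "\<exists>!y. (x, y) \<in> M" if "x \<in> L" for x using that G_fun[OF M(1)] by blast
  define \<sigma> where "\<sigma> = (\<lambda>x\<in>L. THE y. (x, y) \<in> M)"
  have s: "(x, \<sigma> x) \<in> M" if "x \<in> L" for x using theI'[OF ex1[OF that]] that by (simp add: \<sigma>_def)
  have sM: "\<sigma> x = y" if "(x, y) \<in> M" for x y
    using that s[of x] G_L[OF M(1) that] G_fun[OF M(1)] by blast
  have hom: "\<sigma> (x + y) = \<sigma> x + \<sigma> y" "\<sigma> (x * y) = \<sigma> x * \<sigma> y" if "x \<in> L" "y \<in> L" for x y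
    using sM[OF G_add[OF M(1) s[OF that(1)] s[OF that(2)]]] sM[OF G_mult[OF M(1) s[OF that(1)] s[OF that(2)]]]
    by auto
  have fix1: "\<sigma> x = x" if "x \<in> F" for x using sM G_F[OF M(1) that] by blast
  have sL: "\<sigma> x \<in> L" if "x \<in> L" for x using G_L[OF M(1) s[OF that]] by blast
  have inj: "inj_on \<sigma> L"
  proof (rule inj_onI)
    fix x y assume xy: "x \<in> L" "y \<in> L" "\<sigma> x = \<sigma> y"
    have "\<sigma> (x - y) + \<sigma> y = \<sigma> x" using hom(1)[of "x - y" y] xy by (simp add: L.diff)
    then have "\<sigma> (x - y) = 0" using xy by simp
    moreover have "\<sigma> (x - y) * \<sigma> (inverse (x - y)) = 1" if "x \<noteq> y"
      using hom(2)[of "x - y" "inverse (x - y)"] xy that fix1[of 1] by (simp add: L.diff L.inverse)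
    ultimately show "x = y" by auto
  qed
  have "\<exists>x\<in>L. \<sigma> x = y" if y: "y \<in> L" for y
  proof -
    obtain p where p: "p \<in> poly_over F" "p \<noteq> 0" "poly p y = 0" using alg[OF y] by (auto simp: alg_over_def)
    define R where "R = {x \<in> L. poly p x = 0}"
    have finR: "finite R" unfolding R_def using poly_roots_finite[OF p(2)] by simp
    have pw: "\<sigma> (x ^ n) = \<sigma> x ^ n" if "x \<in> L" for x n
      using that by (induction n) (auto simp: fix1 hom L.power)
    have "\<sigma> (poly p x) = poly p (\<sigma> x)" if "x \<in> L" for x
    proof -
      have "\<sigma> (\<Sum>i\<in>I. Polynomial.coeff p i * x ^ i) = (\<Sum>i\<in>I. Polynomial.coeff p i * \<sigma> x ^ i)" if "finite I" for I
        using that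
      proof induction
        case (insert i I)
        have c: "Polynomial.coeff p i \<in> F" "Polynomial.coeff p i \<in> L" for i using p(1) FL by (auto simp: poly_over_iff')
        then show ?case using insert \<open>x \<in> L\<close> hom fix1 pw by (simp add: L.sum L.mult L.power)
      qed (simp add: fix1)
      then show ?thesis by (simp add: poly_altdef)
    qed
    then have "poly p (\<sigma> x) = 0" if "x \<in> R" for x
      using that fix1[OF zero] unfolding R_def by (metis (mono_tags, lifting) mem_Collect_eq)
    then have "\<sigma> ` R \<subseteq> R" using sL by (auto simp: R_def)
    then have "\<sigma> ` R = R" using finR inj by (intro card_subset_eq) (auto simp: R_def inj_on_def card_image)
    then show ?thesis using y p(3) by (force simp: R_def)
  qed
  then have "bij_betw \<sigma> L L" using inj sL by (auto simp: bij_betw_def)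
  then have "\<sigma> \<in> carrier (Gal L F)" using hom fix1 by (auto simp: Gal_iff \<sigma>_def)
  then show ?thesis using that sM M(2) by blast
qed

text \<open>
  If \<open>x\<close> is not in \<open>F\<close>, its minimal polynomial has a root other than \<open>x\<close>, since \<open>x\<close> is not a double root, and the
  embedding that sends \<open>x\<close> there extends to \<open>L\<close>.
\<close>
lemma fixed_field:
  assumes x: "x \<in> L" and fixed: "\<And>\<sigma>. \<sigma> \<in> carrier (Gal L F) \<Longrightarrow> \<sigma> x = x"
  shows "x \<in> F"
proof (rule ccontr)
  assume xF: "x \<notin> F"
  obtain m where m: "minpoly x m" using alg[OF x] by (rule minpoly_ex)
  then have mF: "m \<in> poly_over F" and lm: "lead_coeff m = 1" and mx: "poly m x = 0"
    and min: "\<And>p. p \<in> poly_over F \<Longrightarrow> poly p x = 0 \<Longrightarrow> p \<noteq> 0 \<Longrightarrow> degree m \<le> degree p"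
    and dm: "degree m > 0" by (auto simp: minpoly_def)
  have mL: "m \<in> poly_over L" using mF FL by (auto simp: poly_over_def)
  obtain q where qL: "q \<in> poly_over L" and q: "m = [:- x, 1:] * q"
    by (rule L.poly_over_root_factor[OF mL x mx])
  have q0: "q \<noteq> 0" using q dm by auto
  have "degree q > 0"
  proof (rule ccontr)
    assume "\<not> degree q > 0"
    then obtain c where c: "q = [:c:]" by (auto elim: degree_eq_zeroE)
    then have "Polynomial.coeff m 1 = c" "Polynomial.coeff m 0 = - x * c" by (simp_all add: q)
    moreover have "c \<noteq> 0" using q0 c by auto
    moreover have "Polynomial.coeff m 1 \<in> F" "Polynomial.coeff m 0 \<in> F" using mF by (auto simp: poly_over_iff')
    ultimately have "- (Polynomial.coeff m 0 / Polynomial.coeff m 1) = x"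
      "- (Polynomial.coeff m 0 / Polynomial.coeff m 1) \<in> F" by (simp, blast)
    then show False using xF by simp
  qed
  then obtain b where b: "b \<in> L" "poly q b = 0" using rc qL by (auto simp: root_closed_def)
  then have "b \<noteq> x" using minpoly_simple_root[OF m q] by auto
  define G where "G = {(y, y) | y. y \<in> F}"
  have G: "partial_emb F L G" using FL by (auto simp: partial_emb_def G_def)
  have PG: "(p, p') \<in> poly_graph G \<longleftrightarrow> p = p' \<and> p \<in> poly_over F" for p p'
    unfolding poly_graph_def[OF G] by (auto simp: G_def poly_over_iff' poly_eq_iff)
  obtain G' where "partial_emb F L G'" "(x, b) \<in> G'"
    by (rule partial_emb_step[OF G, of m m x b]) (use PG mF lm mx min x b in \<open>auto simp: q\<close>)
  then obtain \<sigma> where "\<sigma> \<in> carrier (Gal L F)" "\<sigma> x = b" using partial_emb_total by metis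
  then show False using fixed \<open>b \<noteq> x\<close> by auto
qed

end

lemma (in set_field) alg_ext_sep_closure:
  assumes "root_closed (UNIV :: 'a set)"
  shows "alg_ext F (sep_closure F)"
proof (rule alg_ext.intro[OF set_field_axioms alg_ext_axioms.intro])
  show "alg_over F x" if "x \<in> sep_closure F" for x using that by (simp add: sep_closure_eq[OF assms])
qed (simp_all add: assms sep_closure_subfield sep_closure_superset sep_closure_root_closed)


section \<open>Geometric irreducibility\<close>

text \<open>
  The multiplication of the monoid ring on pairs, without reference to carriers, so that its laws
  can be proved by induction over the free abelian group.
\<close>
definition pair_mult :: "(('a::field \<times> 'a) \<Rightarrow>\<^sub>0 int) \<Rightarrow> (('a \<times> 'a) \<Rightarrow>\<^sub>0 int) \<Rightarrow> (('a \<times> 'a) \<Rightarrow>\<^sub>0 int)" where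
  "pair_mult x y = frag_extend (\<lambda>(a, b). frag_extend (\<lambda>(a', b'). frag_of (a * a', b * b')) y) x"

lemma pair_ring_simps [simp]:
  "carrier (pair_ring A B) = {c. Poly_Mapping.keys c \<subseteq> A \<times> B}" "\<zero>\<^bsub>pair_ring A B\<^esub> = 0"
  "\<one>\<^bsub>pair_ring A B\<^esub> = frag_of (1, 1)" "x \<oplus>\<^bsub>pair_ring A B\<^esub> y = x + y"
  "x \<otimes>\<^bsub>pair_ring A B\<^esub> y = pair_mult x y"
  by (simp_all add: pair_ring_def pair_mult_def)

lemma pair_mult_simps [simp]:
  "pair_mult 0 y = 0" "pair_mult x 0 = 0"
  "pair_mult (x - x') y = pair_mult x y - pair_mult x' y"
  "pair_mult x (y - y') = pair_mult x y - pair_mult x y'"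
  "pair_mult (x + x') y = pair_mult x y + pair_mult x' y"
  "pair_mult x (y + y') = pair_mult x y + pair_mult x y'"
  "pair_mult (frag_of (a, b)) (frag_of (a', b')) = frag_of (a * a', b * b')"
proof -
  show "pair_mult x 0 = 0" unfolding pair_mult_def by (rule frag_extend_eq_0) (simp add: case_prod_beta)
  have D: "pair_mult x (y - y') = pair_mult x y - pair_mult x y'" for y y'
  proof (rule frag_induction[of x UNIV "\<lambda>x. pair_mult x (y - y') = pair_mult x y - pair_mult x y'"])
    show "pair_mult (frag_of p) (y - y') = pair_mult (frag_of p) y - pair_mult (frag_of p) y'" for p
      by (cases p) (simp add: pair_mult_def frag_extend_diff)
  qed (simp_all add: pair_mult_def frag_extend_diff)
  then show "pair_mult x (y - y') = pair_mult x y - pair_mult x y'" .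
  show "pair_mult x (y + y') = pair_mult x y + pair_mult x y'"
    using D[of "y + y'" y'] by (simp add: algebra_simps)
qed (simp_all add: pair_mult_def frag_extend_diff frag_extend_add)

lemma pair_mult_sum: "finite I \<Longrightarrow> pair_mult x (\<Sum>i\<in>I. f i) = (\<Sum>i\<in>I. pair_mult x (f i))"
  by (induction I rule: finite_induct) simp_all

lemma pair_mult_commute: "pair_mult x y = pair_mult y x"
proof (rule frag_induction[of x UNIV "\<lambda>x. pair_mult x y = pair_mult y x"])
  show "pair_mult (frag_of p) y = pair_mult y (frag_of p)" for p
  proof (rule frag_induction[of y UNIV "\<lambda>y. pair_mult (frag_of p) y = pair_mult y (frag_of p)"])
    show "pair_mult (frag_of p) (frag_of q) = pair_mult (frag_of q) (frag_of p)" for q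
      by (cases p; cases q) (simp add: mult.commute)
  qed simp_all
qed simp_all

lemma pair_mult_assoc: "pair_mult (pair_mult x y) z = pair_mult x (pair_mult y z)"
proof (rule frag_induction[of x UNIV "\<lambda>x. pair_mult (pair_mult x y) z = pair_mult x (pair_mult y z)"])
  show "pair_mult (pair_mult (frag_of p) y) z = pair_mult (frag_of p) (pair_mult y z)" for p
  proof (rule frag_induction[of y UNIV "\<lambda>y. pair_mult (pair_mult (frag_of p) y) z = pair_mult (frag_of p) (pair_mult y z)"])
    show "pair_mult (pair_mult (frag_of p) (frag_of q)) z = pair_mult (frag_of p) (pair_mult (frag_of q) z)" for q
    proof (rule frag_induction[of z UNIV "\<lambda>z. pair_mult (pair_mult (frag_of p) (frag_of q)) z = pair_mult (frag_of p) (pair_mult (frag_of q) z)"])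
      show "pair_mult (pair_mult (frag_of p) (frag_of q)) (frag_of r) = pair_mult (frag_of p) (pair_mult (frag_of q) (frag_of r))" for r
        by (cases p; cases q; cases r) (simp add: mult.assoc)
    qed simp_all
  qed simp_all
qed simp_all

lemma pair_mult_one: "pair_mult (frag_of (1, 1)) x = x"
proof (rule frag_induction[of x UNIV "\<lambda>x. pair_mult (frag_of (1, 1)) x = x"])
  show "pair_mult (frag_of (1, 1)) (frag_of p) = frag_of p" for p by (cases p) simp
qed simp_all

lemma keys_pair_mult:
  assumes "is_subring A" "is_subring B" "Poly_Mapping.keys x \<subseteq> A \<times> B" "Poly_Mapping.keys y \<subseteq> A \<times> B"
  shows "Poly_Mapping.keys (pair_mult x y) \<subseteq> A \<times> B"
proof (rule frag_induction[of x "A \<times> B" "\<lambda>x. Poly_Mapping.keys (pair_mult x y) \<subseteq> A \<times> B"])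
  fix p assume p: "p \<in> A \<times> B"
  show "Poly_Mapping.keys (pair_mult (frag_of p) y) \<subseteq> A \<times> B"
  proof (rule frag_induction[of y "A \<times> B" "\<lambda>y. Poly_Mapping.keys (pair_mult (frag_of p) y) \<subseteq> A \<times> B"])
    fix q assume "q \<in> A \<times> B"
    then show "Poly_Mapping.keys (pair_mult (frag_of p) (frag_of q)) \<subseteq> A \<times> B"
      using p assms(1,2) by (cases p; cases q) (simp add: is_subring_iff)
  qed (use assms(4) in \<open>auto dest: subsetD[OF keys_diff]\<close>)
qed (use assms(3) in \<open>auto dest: subsetD[OF keys_diff]\<close>)

lemma pair_ring_cring:
  assumes "is_subring A" "is_subring B"
  shows "cring (pair_ring A B)"
proof (rule cringI)
  show "abelian_group (pair_ring A B)"
  proof (rule abelian_groupI)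
    fix x assume "x \<in> carrier (pair_ring A B)"
    then show "\<exists>y\<in>carrier (pair_ring A B). y \<oplus>\<^bsub>pair_ring A B\<^esub> x = \<zero>\<^bsub>pair_ring A B\<^esub>"
      by (intro bexI[of _ "- x"]) auto
  qed (auto simp: algebra_simps dest: subsetD[OF keys_add])
  show "comm_monoid (pair_ring A B)"
    using keys_pair_mult[OF assms] assms
    by (intro comm_monoidI) (auto simp: pair_mult_assoc pair_mult_one is_subring_iff intro: pair_mult_commute)
qed simp

definition frag_eval :: "('b \<Rightarrow> 'a::field) \<Rightarrow> ('b \<Rightarrow>\<^sub>0 int) \<Rightarrow> 'a" where
  "frag_eval w c = (\<Sum>p\<in>Poly_Mapping.keys c. of_int (Poly_Mapping.lookup c p) * w p)"

lemma frag_eval_superset: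
  "finite S \<Longrightarrow> Poly_Mapping.keys c \<subseteq> S \<Longrightarrow>
     frag_eval w c = (\<Sum>p\<in>S. of_int (Poly_Mapping.lookup c p) * w p)"
  unfolding frag_eval_def by (rule sum.mono_neutral_left) (auto simp: in_keys_iff)

lemma frag_eval_simps [simp]:
  "frag_eval w 0 = 0" "frag_eval w (frag_of p) = w p"
  "frag_eval w (x - y) = frag_eval w x - frag_eval w y"
  "frag_eval w (x + y) = frag_eval w x + frag_eval w y"
proof -
  let ?S = "Poly_Mapping.keys x \<union> Poly_Mapping.keys y"
  have fin: "finite ?S" by simp
  note e = frag_eval_superset[OF fin, of _ w]
  have "Poly_Mapping.keys (x - y) \<subseteq> ?S" "Poly_Mapping.keys (x + y) \<subseteq> ?S"
    using keys_diff[of x y] keys_add[of x y] by auto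
  then show "frag_eval w (x - y) = frag_eval w x - frag_eval w y"
    "frag_eval w (x + y) = frag_eval w x + frag_eval w y"
    using e[of x] e[of y] e[of "x - y"] e[of "x + y"]
    by (simp_all add: lookup_minus lookup_add sum_subtractf sum.distrib algebra_simps)
qed (simp_all add: frag_eval_def)

lemma frag_eval_sum: "finite I \<Longrightarrow> frag_eval w (\<Sum>i\<in>I. f i) = (\<Sum>i\<in>I. frag_eval w (f i))"
  by (induction I rule: finite_induct) simp_all

lemma frag_eval_pair_mult:
  assumes w: "\<And>a b a' b'. a \<in> A \<Longrightarrow> b \<in> B \<Longrightarrow> a' \<in> A \<Longrightarrow> b' \<in> B \<Longrightarrow> w (a * a', b * b') = w (a, b) * w (a', b')"
    and x: "Poly_Mapping.keys x \<subseteq> A \<times> B" and y: "Poly_Mapping.keys y \<subseteq> A \<times> B"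
  shows "frag_eval w (pair_mult x y) = frag_eval w x * frag_eval w y"
proof (rule frag_induction[OF x, of "\<lambda>x. frag_eval w (pair_mult x y) = frag_eval w x * frag_eval w y"])
  fix p assume p: "p \<in> A \<times> B"
  show "frag_eval w (pair_mult (frag_of p) y) = frag_eval w (frag_of p) * frag_eval w y"
  proof (rule frag_induction[OF y, of "\<lambda>y. frag_eval w (pair_mult (frag_of p) y) = frag_eval w (frag_of p) * frag_eval w y"])
    fix q assume "q \<in> A \<times> B"
    then show "frag_eval w (pair_mult (frag_of p) (frag_of q)) = frag_eval w (frag_of p) * frag_eval w (frag_of q)"
      using p w by (cases p; cases q) simp
  qed (simp_all add: algebra_simps)
qed (simp_all add: algebra_simps)

text \<open>
  The prime is the kernel of the map that \<open>h\<close> induces on the quotient.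
\<close>
lemma prime_of_quotient_from_hom:
  assumes P: "cring P" and I: "ideal I P" and T: "domain T"
    and h: "h \<in> ring_hom P T" and hI: "\<And>x. x \<in> I \<Longrightarrow> h x = \<zero>\<^bsub>T\<^esub>"
  obtains Q where "Q \<in> Spec (P Quot I)" "\<And>x. x \<in> carrier P \<Longrightarrow> I +>\<^bsub>P\<^esub> x \<in> Q \<longleftrightarrow> h x = \<zero>\<^bsub>T\<^esub>"
proof -
  interpret P: cring P by fact
  interpret I: ideal I P by fact
  interpret T: domain T by fact
  interpret R: cring "P Quot I" by (rule I.quotient_is_cring[OF P])
  interpret h: ring_hom_ring P T h
    by (rule ring_hom_ringI2) (simp_all add: P.ring_axioms T.ring_axioms h)
  define H where "H X = h (SOME x. x \<in> X)" for X
  have H: "H (I +>\<^bsub>P\<^esub> x) = h x" if x: "x \<in> carrier P" for x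
  proof -
    define y where "y = (SOME y. y \<in> I +>\<^bsub>P\<^esub> x)"
    have "x \<in> I +>\<^bsub>P\<^esub> x" using I.a_rcos_self[OF x] .
    then have y: "y \<in> I +>\<^bsub>P\<^esub> x" unfolding y_def by (rule someI)
    then obtain i where i: "i \<in> I" "y = i \<oplus>\<^bsub>P\<^esub> x" by (auto simp: a_r_coset_def' )
    then have "h y = h i \<oplus>\<^bsub>T\<^esub> h x" using x I.Icarr by simp
    then show ?thesis using hI[OF i(1)] x by (simp add: H_def y_def)
  qed
  have car: "\<exists>x\<in>carrier P. X = I +>\<^bsub>P\<^esub> x" if "X \<in> carrier (P Quot I)" for X
    using that by (auto simp: FactRing_def A_RCOSETS_def')
  have c: "I +>\<^bsub>P\<^esub> x \<in> carrier (P Quot I)" if "x \<in> carrier P" for x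
    using that by (auto simp: FactRing_def A_RCOSETS_def')
  note rc = I.rcos_ring_hom
  have "H \<in> ring_hom (P Quot I) T"
  proof (rule ring_hom_memI)
    fix X assume "X \<in> carrier (P Quot I)"
    then obtain x where x: "x \<in> carrier P" "X = I +>\<^bsub>P\<^esub> x" using car by blast
    then show "H X \<in> carrier T" by (simp add: H)
    fix Y assume "Y \<in> carrier (P Quot I)"
    then obtain y where y: "y \<in> carrier P" "Y = I +>\<^bsub>P\<^esub> y" using car by blast
    show "H (X \<otimes>\<^bsub>P Quot I\<^esub> Y) = H X \<otimes>\<^bsub>T\<^esub> H Y"
      using ring_hom_mult[OF rc x(1) y(1)] x y H by (metis P.m_closed h.hom_mult)
    show "H (X \<oplus>\<^bsub>P Quot I\<^esub> Y) = H X \<oplus>\<^bsub>T\<^esub> H Y"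
      using ring_hom_add[OF rc x(1) y(1)] x y H by (metis P.a_closed h.hom_add)
  next
    show "H \<one>\<^bsub>P Quot I\<^esub> = \<one>\<^bsub>T\<^esub>" using ring_hom_one[OF rc] H by (metis P.one_closed h.hom_one)
  qed
  then interpret H: ring_hom_ring "P Quot I" T H
    by (intro ring_hom_ringI2) (simp_all add: R.ring_axioms T.ring_axioms)
  have "primeideal {X \<in> carrier (P Quot I). H X \<in> {\<zero>\<^bsub>T\<^esub>}} (P Quot I)"
    by (rule H.primeideal_vimage[OF R.cring_axioms T.zeroprimeideal])
  then show ?thesis
    using that[of "{X \<in> carrier (P Quot I). H X \<in> {\<zero>\<^bsub>T\<^esub>}}"] H c by (auto simp: Spec_def)
qed

text \<open>
  For \<open>x = a / b\<close> in \<open>C\<close> with minimal polynomial \<open>(T - x) q\<close> over \<open>k\<close>, the elements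
  \<open>a \<otimes> 1 - b \<otimes> x\<close> and the homogenisation of \<open>q\<close> at \<open>(a \<otimes> 1, b \<otimes> 1)\<close> have product \<open>0\<close> in \<open>A \<otimes>\<^sub>k C\<close>.
  Neither vanishes at all primes: the second one not at the kernel of \<open>a \<otimes> c \<mapsto> a c\<close>, the
  first one not at the kernel of \<open>a \<otimes> c \<mapsto> a \<sigma>(c)\<close> when \<open>\<sigma>\<close> moves \<open>x\<close>.
\<close>
lemma irreducible_tensor_algebra_imp_disjoint:
  fixes A k :: "'a::field_char_0 set"
  assumes kf: "is_subfield k" and A: "is_subring A" "k \<subseteq> A"
    and rc: "root_closed (UNIV :: 'a set)"
    and irr: "irreducible_Spec (tensor_algebra k A (sep_closure k))"
    and a: "a \<in> A" and b: "b \<in> A" "b \<noteq> 0" and xC: "a / b \<in> sep_closure k"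
  shows "a / b \<in> k"
proof (rule ccontr)
  define x C where "x = a / b" and "C = sep_closure k"
  assume "a / b \<notin> k"
  then have xk: "x \<notin> k" and xC: "x \<in> C" using xC by (auto simp: x_def C_def)
  interpret k: set_field k by (rule set_field.intro[OF kf])
  have Cf: "is_subfield C" unfolding C_def by (rule k.sep_closure_subfield[OF rc])
  then interpret C: set_field C by (rule set_field.intro)
  interpret E: alg_ext k C unfolding C_def by (rule k.alg_ext_sep_closure[OF rc])
  have kC: "k \<subseteq> C" by (rule E.FL)
  have Cr: "is_subring C" using Cf by (simp add: is_subfield_iff)
  note Ar = A(1)[unfolded is_subring_iff]
  have Apow: "y ^ n \<in> A" if "y \<in> A" for y n using that Ar by (induction n) auto
  obtain \<sigma> where s: "\<sigma> \<in> carrier (Gal C k)" "\<sigma> x \<noteq> x" using E.fixed_field xC xk by blast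
  interpret s: field_aut C \<sigma> using Gal_field_aut[OF Cf s(1)] .
  obtain m where m: "k.minpoly x m" using E.alg[OF xC] by (rule k.minpoly_ex)
  then have mk: "m \<in> poly_over k" and mx: "poly m x = 0" and dm: "degree m > 0" by (auto simp: k.minpoly_def)
  have mC: "m \<in> poly_over C" using mk kC by (auto simp: poly_over_def)
  obtain q where qC: "q \<in> poly_over C" and q: "m = [:- x, 1:] * q"
    by (rule C.poly_over_root_factor[OF mC xC mx])
  have qx: "poly q x \<noteq> 0" by (rule k.minpoly_simple_root[OF m q])
  then have q0: "q \<noteq> 0" by auto
  define n where "n = degree m"
  have dq: "n = Suc (degree q)" unfolding n_def q using q0 by (subst degree_mult_eq) auto

  define P where "P = pair_ring A C"
  define S where "S = bilinear_relations (add_monoid (ring_on A)) (add_monoid (ring_on C)) \<union>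
       {frag_of (c * a, b) - frag_of (a, c * b) | a b c. a \<in> A \<and> b \<in> C \<and> c \<in> k}"
  define I where "I = Idl\<^bsub>P\<^esub> S"
  define R where "R = P Quot I"
  have R: "R = tensor_algebra k A C" by (simp add: R_def I_def S_def P_def tensor_algebra_def)
  interpret P: cring P unfolding P_def by (rule pair_ring_cring[OF A(1) Cr])
  have fo: "frag_of (y, c) \<in> carrier P" if "y \<in> A" "c \<in> C" for y c using that by (simp add: P_def)
  have dif: "u - v \<in> carrier P" if "u \<in> carrier P" "v \<in> carrier P" for u v
    using that keys_diff[of u v] by (auto simp: P_def)
  have S_eq: "S = {frag_of (y + y', c) - frag_of (y, c) - frag_of (y', c) | y y' c. y \<in> A \<and> y' \<in> A \<and> c \<in> C} \<union>
     {frag_of (y, c + c') - frag_of (y, c) - frag_of (y, c') | y c c'. y \<in> A \<and> c \<in> C \<and> c' \<in> C} \<union>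
     {frag_of (d * y, c) - frag_of (y, d * c) | y c d. y \<in> A \<and> c \<in> C \<and> d \<in> k}"
    unfolding S_def bilinear_relations_def by simp
  have S_cases: thesis if "w \<in> S"
    and "\<And>y y' c. y \<in> A \<Longrightarrow> y' \<in> A \<Longrightarrow> c \<in> C \<Longrightarrow> w = frag_of (y + y', c) - frag_of (y, c) - frag_of (y', c) \<Longrightarrow> thesis"
    and "\<And>y c c'. y \<in> A \<Longrightarrow> c \<in> C \<Longrightarrow> c' \<in> C \<Longrightarrow> w = frag_of (y, c + c') - frag_of (y, c) - frag_of (y, c') \<Longrightarrow> thesis"
    and "\<And>y c d. y \<in> A \<Longrightarrow> c \<in> C \<Longrightarrow> d \<in> k \<Longrightarrow> w = frag_of (d * y, c) - frag_of (y, d * c) \<Longrightarrow> thesis"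
    for w thesis
    using that(1) unfolding S_eq
    apply (elim UnE CollectE exE conjE)
    subgoal by (rule that(2))
    subgoal by (rule that(3))
    subgoal by (rule that(4))
    done
  have SP: "S \<subseteq> carrier P"
  proof
    fix w assume "w \<in> S"
    then show "w \<in> carrier P"
      by (rule S_cases) (use fo dif Ar A(2) kC in \<open>auto intro!: dif fo\<close>)
  qed
  interpret I: ideal I P unfolding I_def by (rule P.genideal_ideal[OF SP])
  have SI: "w \<in> I" if "w \<in> S" for w using P.genideal_self[OF SP] that by (auto simp: I_def)
  have Iadd: "u + v \<in> I" if "u \<in> I" "v \<in> I" for u v
    using I.a_closed[OF that] by (simp add: P_def)
  have Iminus: "- u \<in> I" if "u \<in> I" for u
  proof -
    have "u \<in> carrier P" using that I.Icarr by blast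
    moreover have "- u \<in> carrier P" using calculation by (simp add: P_def)
    ultimately have "\<ominus>\<^bsub>P\<^esub> u = - u" by (intro P.minus_equality) (auto simp: P_def)
    then show ?thesis using I.a_inv_closed[OF that] by simp
  qed
  have I0: "0 \<in> I" using I.zero_closed by (simp add: P_def)
  define eqI (infix "\<asymp>" 50) where "u \<asymp> v \<longleftrightarrow> u - v \<in> I" for u v
  have eq_refl: "u \<asymp> u" for u using I0 by (simp add: eqI_def)
  have eq_sym: "v \<asymp> u" if "u \<asymp> v" for u v using Iminus[of "u - v"] that by (simp add: eqI_def)
  have eq_trans [trans]: "u \<asymp> w" if "u \<asymp> v" "v \<asymp> w" for u v w
    using Iadd[of "u - v" "v - w"] that by (simp add: eqI_def)
  have eq_add: "u + u' \<asymp> v + v'" if "u \<asymp> v" "u' \<asymp> v'" for u v u' v'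
    using Iadd[of "u - v" "u' - v'"] that by (simp add: eqI_def algebra_simps)
  have eq_diff: "u - u' \<asymp> v - v'" if "u \<asymp> v" "u' \<asymp> v'" for u v u' v'
    using Iadd[of "u - v" "- (u' - v')"] Iminus[of "u' - v'"] that by (simp add: eqI_def algebra_simps)
  have eq_sum: "(\<Sum>j\<in>J. f j) \<asymp> (\<Sum>j\<in>J. g j)" if "\<And>j. j \<in> J \<Longrightarrow> f j \<asymp> g j" for f g and J :: "nat set"
    using that by (induction J rule: infinite_finite_induct) (auto intro: eq_refl eq_add)
  have add1: "frag_of (y + y', c) \<asymp> frag_of (y, c) + frag_of (y', c)" if "y \<in> A" "y' \<in> A" "c \<in> C" for y y' c
  proof -
    have "frag_of (y + y', c) - frag_of (y, c) - frag_of (y', c) \<in> S"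
      using that unfolding S_def bilinear_relations_def by fastforce
    then show ?thesis using SI unfolding eqI_def by (simp add: diff_diff_eq)
  qed
  have add2: "frag_of (y, c + c') \<asymp> frag_of (y, c) + frag_of (y, c')" if "y \<in> A" "c \<in> C" "c' \<in> C" for y c c'
  proof -
    have "frag_of (y, c + c') - frag_of (y, c) - frag_of (y, c') \<in> S"
      using that unfolding S_def bilinear_relations_def by fastforce
    then show ?thesis using SI unfolding eqI_def by (simp add: diff_diff_eq)
  qed
  have bal: "frag_of (d * y, c) \<asymp> frag_of (y, d * c)" if "y \<in> A" "c \<in> C" "d \<in> k" for y c d
    using SI[of "frag_of (d * y, c) - frag_of (y, d * c)"] that unfolding eqI_def S_def by blast
  have z1: "frag_of (0, c) \<asymp> 0" if "c \<in> C" for c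
    using add1[of 0 0 c] that Ar by (simp add: eqI_def Iminus) (metis Iminus add.inverse_inverse)
  have z2: "frag_of (y, 0) \<asymp> 0" if "y \<in> A" for y
    using add2[of y 0 0] that by (simp add: eqI_def Iminus) (metis Iminus add.inverse_inverse)

  \<comment> \<open>\<open>t j c = (a \<otimes> 1)\<^sup>j (b \<otimes> 1)\<^sup>n\<^sup>-\<^sup>j (1 \<otimes> c)\<close>, where \<open>n\<close> is the degree of \<open>m\<close>, and \<open>v\<close> is homogenised in degree \<open>n - 1\<close>.\<close>
  define t :: "nat \<Rightarrow> 'a \<Rightarrow> ('a \<times> 'a) \<Rightarrow>\<^sub>0 int" where "t j c = frag_of (a ^ j * b ^ (n - j), c)" for j c
  define u where "u = frag_of (a, 1) - frag_of (b, x)"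
  define v where "v = (\<Sum>j<n. frag_of (a ^ j * b ^ (n - Suc j), Polynomial.coeff q j))"
  have tA: "a ^ j * b ^ l \<in> A" for j l using Apow a b Ar by blast
  have qjC: "Polynomial.coeff q j \<in> C" "Polynomial.coeff (pCons 0 q) j \<in> C" for j
    using qC by (auto simp: C.poly_over_iff' coeff_pCons split: nat.split)
  have mjk: "Polynomial.coeff m j \<in> k" for j using mk by (auto simp: k.poly_over_iff')
  have mjC: "Polynomial.coeff m j \<in> C" for j using mjk kC by blast
  have uP: "u \<in> carrier P" unfolding u_def using a b xC by (intro dif fo) auto
  have keys_sum: "Poly_Mapping.keys (\<Sum>j\<in>J. f j) \<subseteq> A \<times> C" if "\<And>j. j \<in> J \<Longrightarrow> Poly_Mapping.keys (f j) \<subseteq> A \<times> C"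
    for f :: "nat \<Rightarrow> ('a \<times> 'a) \<Rightarrow>\<^sub>0 int" and J
    using that by (induction J rule: infinite_finite_induct) (auto dest: subsetD[OF keys_add])
  have vP: "v \<in> carrier P" unfolding v_def P_def using tA qjC by (simp add: keys_sum)

  have "pair_mult u v = (\<Sum>j<n. t (Suc j) (Polynomial.coeff q j) - t j (x * Polynomial.coeff q j))"
    unfolding v_def u_def
  proof (simp add: pair_mult_sum, unfold sum_subtractf[symmetric], rule sum.cong)
    fix j assume "j \<in> {..<n}"
    then have "n - j = Suc (n - Suc j)" by auto
    then have e: "b * (a ^ j * b ^ (n - Suc j)) = a ^ j * b ^ (n - j)" by (simp add: mult.left_commute)
    show "frag_of (a * (a ^ j * b ^ (n - Suc j)), Polynomial.coeff q j)
        - frag_of (b * (a ^ j * b ^ (n - Suc j)), x * Polynomial.coeff q j)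
      = t (Suc j) (Polynomial.coeff q j) - t j (x * Polynomial.coeff q j)"
      unfolding e by (simp add: t_def mult.assoc)
  qed simp
  also have "\<dots> = (\<Sum>j<n. t (Suc j) (Polynomial.coeff q j)) - (\<Sum>j<n. t j (x * Polynomial.coeff q j))"
    by (rule sum_subtractf)
  \<comment> \<open>With the trivial terms \<open>t 0 0\<close> and \<open>t n 0\<close>, both sums run over \<open>j \<le> n\<close> and combine to the
    coefficients of \<open>(T - x) q = m\<close>, which lie in \<open>k\<close> and can be moved to the left factor.\<close>
  also have "\<dots> \<asymp> (t 0 0 + (\<Sum>j<n. t (Suc j) (Polynomial.coeff q j))) - ((\<Sum>j<n. t j (x * Polynomial.coeff q j)) + t n 0)"
  proof (rule eq_diff)
    have z: "0 \<asymp> t j 0" for j unfolding t_def by (rule eq_sym[OF z2[OF tA]])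
    from eq_add[OF z[of 0] eq_refl] eq_add[OF eq_refl z[of n]]
    show "(\<Sum>j<n. t (Suc j) (Polynomial.coeff q j)) \<asymp> t 0 0 + (\<Sum>j<n. t (Suc j) (Polynomial.coeff q j))"
      "(\<Sum>j<n. t j (x * Polynomial.coeff q j)) \<asymp> (\<Sum>j<n. t j (x * Polynomial.coeff q j)) + t n 0"
      by simp_all
  qed
  also have "t 0 0 + (\<Sum>j<n. t (Suc j) (Polynomial.coeff q j)) = (\<Sum>j<Suc n. t j (Polynomial.coeff (pCons 0 q) j))"
    by (subst sum.lessThan_Suc_shift) simp
  also have "(\<Sum>j<n. t j (x * Polynomial.coeff q j)) + t n 0 = (\<Sum>j<Suc n. t j (x * Polynomial.coeff q j))"
    using dq by (simp add: coeff_eq_0)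
  also have "(\<Sum>j<Suc n. t j (Polynomial.coeff (pCons 0 q) j)) - (\<Sum>j<Suc n. t j (x * Polynomial.coeff q j))
      \<asymp> (\<Sum>j<Suc n. t j (Polynomial.coeff m j) + t j (x * Polynomial.coeff q j)) - (\<Sum>j<Suc n. t j (x * Polynomial.coeff q j))"
  proof (intro eq_diff eq_sum eq_refl)
    fix j
    have "Polynomial.coeff (pCons 0 q) j = Polynomial.coeff m j + x * Polynomial.coeff q j"
      unfolding q by (simp add: coeff_pCons split: nat.split)
    then show "t j (Polynomial.coeff (pCons 0 q) j) \<asymp> t j (Polynomial.coeff m j) + t j (x * Polynomial.coeff q j)"
      unfolding t_def using add2[OF tA mjC C.mult[OF xC qjC(1)]] by simp
  qed
  also have "\<dots> = (\<Sum>j<Suc n. t j (Polynomial.coeff m j))" by (simp add: sum.distrib)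
  also have "\<dots> \<asymp> (\<Sum>j<Suc n. frag_of (Polynomial.coeff m j * (a ^ j * b ^ (n - j)), 1))"
    unfolding t_def
    by (rule eq_sum, rule eq_sym) (use bal[OF tA C.one mjk] in simp)
  also have "\<dots> \<asymp> frag_of (\<Sum>j<Suc n. Polynomial.coeff m j * (a ^ j * b ^ (n - j)), 1)"
  proof -
    have mA: "Polynomial.coeff m j * (a ^ j * b ^ (n - j)) \<in> A" for j using mjk tA A(2) Ar by blast
    have "(\<Sum>j<N. frag_of (Polynomial.coeff m j * (a ^ j * b ^ (n - j)), 1)) \<asymp> frag_of (\<Sum>j<N. Polynomial.coeff m j * (a ^ j * b ^ (n - j)), 1)
      \<and> (\<Sum>j<N. Polynomial.coeff m j * (a ^ j * b ^ (n - j))) \<in> A" for N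
    proof (induction N)
      case 0
      then show ?case using eq_sym[OF z1[OF C.one]] Ar by simp
    next
      case (Suc N)
      then show ?case using eq_trans[OF eq_add[OF conjunct1[OF Suc] eq_refl] eq_sym[OF add1]] mA[of N] Ar by simp
    qed
    then show ?thesis by blast
  qed
  also have "(\<Sum>j<Suc n. Polynomial.coeff m j * (a ^ j * b ^ (n - j))) = b ^ n * poly m x"
    unfolding poly_altdef sum_distrib_left n_def[symmetric] lessThan_Suc_atMost
    by (intro sum.cong) (use b(2) in \<open>auto simp: x_def power_divide power_diff field_simps\<close>)
  also have "\<dots> = 0" using mx by simp
  also have "frag_of (0, 1) \<asymp> 0" by (rule z1) simp
  finally have uvI: "pair_mult u v \<in> I" by (simp add: eqI_def)

  interpret R: cring R unfolding R_def by (rule I.quotient_is_cring[OF P.cring_axioms])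
  have "I +>\<^bsub>P\<^esub> (u \<otimes>\<^bsub>P\<^esub> v) = (I +>\<^bsub>P\<^esub> u) \<otimes>\<^bsub>R\<^esub> (I +>\<^bsub>P\<^esub> v)"
    unfolding R_def by (rule ring_hom_mult[OF I.rcos_ring_hom uP vP])
  moreover have "I +>\<^bsub>P\<^esub> (u \<otimes>\<^bsub>P\<^esub> v) = I"
    using uvI by (intro I.a_rcos_const) (simp add: P_def)
  moreover have zR: "\<zero>\<^bsub>R\<^esub> = I" by (simp add: R_def FactRing_def)
  ultimately have uv: "(I +>\<^bsub>P\<^esub> u) \<otimes>\<^bsub>R\<^esub> (I +>\<^bsub>P\<^esub> v) = \<zero>\<^bsub>R\<^esub>" by simp
  have cuv: "I +>\<^bsub>P\<^esub> u \<in> carrier R" "I +>\<^bsub>P\<^esub> v \<in> carrier R"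
    using uP vP ring_hom_closed[OF I.rcos_ring_hom] by (auto simp: R_def)
  have "zariski_closed R {I +>\<^bsub>P\<^esub> u} \<union> zariski_closed R {I +>\<^bsub>P\<^esub> v} = Spec R"
  proof -
    have "I +>\<^bsub>P\<^esub> u \<in> Q \<or> I +>\<^bsub>P\<^esub> v \<in> Q" if "primeideal Q R" for Q
    proof -
      interpret Q: primeideal Q R by fact
      show ?thesis using Q.I_prime[OF cuv] uv Q.zero_closed by simp
    qed
    then show ?thesis by (auto simp: zariski_closed_def Spec_def)
  qed
  then have alt: "zariski_closed R {I +>\<^bsub>P\<^esub> u} = Spec R \<or> zariski_closed R {I +>\<^bsub>P\<^esub> v} = Spec R"
    using irr cuv unfolding C_def[symmetric] R[symmetric] irreducible_Spec_def by simp
  \<comment> \<open>Every \<open>\<rho>\<close> over \<open>k\<close> gives the point \<open>y \<otimes> c \<mapsto> y \<rho>(c)\<close> of the spectrum.\<close>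
  have ev: "\<exists>Q\<in>Spec R. \<forall>y\<in>carrier P. I +>\<^bsub>P\<^esub> y \<in> Q \<longleftrightarrow> frag_eval (\<lambda>(y, c). y * \<rho> c) y = 0"
    if rho: "\<rho> \<in> carrier (Gal C k)" for \<rho>
  proof -
    interpret r: field_aut C \<rho> using Gal_field_aut[OF Cf rho] .
    have rk: "\<rho> c = c" if "c \<in> k" for c using rho that by (simp add: Gal_iff)
    let ?w = "\<lambda>(y, c). y * \<rho> c"
    let ?T = "ring_on (UNIV :: 'a set)"
    have T: "domain ?T" by (rule field.axioms(1)[OF is_subfield_UNIV])
    have h: "frag_eval ?w \<in> ring_hom P ?T"
      by (rule ring_hom_memI) (auto simp: P_def frag_eval_pair_mult[of A C] r.hom_mult)
    have hr: "ring_hom_ring P ?T (frag_eval ?w)"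
      using is_subring_UNIV P.ring_axioms h by (intro ring_hom_ringI2) (auto intro: cring.axioms)
    have "S \<subseteq> a_kernel P ?T (frag_eval ?w)"
    proof
      fix y assume y: "y \<in> S"
      have kmult: "\<rho> (d * c) = d * \<rho> c" if "d \<in> k" "c \<in> C" for c d
        using r.hom_mult[of d c] rk[of d] that kC by auto
      from y have "frag_eval ?w y = 0"
      proof (rule S_cases)
        fix y1 y2 c assume "c \<in> C" "y = frag_of (y1 + y2, c) - frag_of (y1, c) - frag_of (y2, c)"
        then show ?thesis by (simp add: distrib_right)
      next
        fix y1 c c' assume "c \<in> C" "c' \<in> C" "y = frag_of (y1, c + c') - frag_of (y1, c) - frag_of (y1, c')"
        then show ?thesis by (simp add: r.hom_add distrib_left)
      next
        fix y1 c d assume "c \<in> C" "d \<in> k" "y = frag_of (d * y1, c) - frag_of (y1, d * c)"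
        then show ?thesis by (simp add: kmult)
      qed
      then show "y \<in> a_kernel P ?T (frag_eval ?w)" using subsetD[OF SP y] unfolding a_kernel_def' ring_on_simps by blast
    qed
    then have "I \<subseteq> a_kernel P ?T (frag_eval ?w)"
      unfolding I_def by (rule P.genideal_minimal[OF ring_hom_ring.kernel_is_ideal[OF hr]])
    then have "frag_eval ?w y = \<zero>\<^bsub>?T\<^esub>" if "y \<in> I" for y using that unfolding a_kernel_def' by blast
    from this obtain Q where "Q \<in> Spec (P Quot I)"
      "\<And>y. y \<in> carrier P \<Longrightarrow> I +>\<^bsub>P\<^esub> y \<in> Q \<longleftrightarrow> frag_eval ?w y = \<zero>\<^bsub>?T\<^esub>"
      using prime_of_quotient_from_hom[OF P.cring_axioms I.ideal_axioms T h] by blast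
    then show ?thesis unfolding R_def by (simp add: Bex_def) blast
  qed
  have "(\<lambda>c\<in>C. c) \<in> carrier (Gal C k)" using Gal_one[OF Cf kC] group.is_monoid[OF Gal_group[OF Cf kC]]
    by (metis monoid.one_closed)
  from ev[OF this] obtain Q where Q: "Q \<in> Spec R"
    "I +>\<^bsub>P\<^esub> v \<in> Q \<longleftrightarrow> frag_eval (\<lambda>(y, c). y * (\<lambda>c\<in>C. c) c) v = 0" using vP by blast
  have "frag_eval (\<lambda>(y, c). y * (\<lambda>c\<in>C. c) c) v = (\<Sum>j<n. (a ^ j * b ^ (n - Suc j)) * Polynomial.coeff q j)"
    unfolding v_def using qjC(1) by (simp add: frag_eval_sum)
  also have "\<dots> = b ^ degree q * poly q x"
    unfolding poly_altdef sum_distrib_left dq lessThan_Suc_atMost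
    by (intro sum.cong) (use b(2) in \<open>auto simp: x_def power_divide power_diff field_simps\<close>)
  finally have "zariski_closed R {I +>\<^bsub>P\<^esub> v} \<noteq> Spec R" using Q qx b(2) by (auto simp: zariski_closed_def)
  moreover from ev[OF s(1)] obtain Q where Q: "Q \<in> Spec R"
    "I +>\<^bsub>P\<^esub> u \<in> Q \<longleftrightarrow> frag_eval (\<lambda>(y, c). y * \<sigma> c) u = 0" using uP by blast
  have "frag_eval (\<lambda>(y, c). y * \<sigma> c) u = b * (x - \<sigma> x)" using b(2) by (simp add: u_def x_def algebra_simps)
  then have "zariski_closed R {I +>\<^bsub>P\<^esub> u} \<noteq> Spec R" using Q s(2) b(2) by (auto simp: zariski_closed_def)
  ultimately show False using alt by blast
qed


section \<open>Orbits\<close>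

lemma (in field_aut) coeff_prod_linear:
  assumes "finite R" "R \<subseteq> L"
  shows "\<sigma> (Polynomial.coeff (\<Prod>r\<in>R. [:- r, 1:]) i) = Polynomial.coeff (\<Prod>r\<in>R. [:- \<sigma> r, 1:]) i"
  using assms
proof (induction R arbitrary: i rule: finite_induct)
  case (insert r R)
  have lin: "[:- s, 1:] \<in> poly_over L" if "s \<in> L" for s
    using that by (auto simp: L.poly_over_iff' coeff_pCons split: nat.split)
  have "Polynomial.coeff (\<Prod>r\<in>R. [:- r, 1:]) j \<in> L" for j
    using L.poly_over_prod[of R "\<lambda>r. [:- r, 1:]"] lin insert.prems by (auto simp: L.poly_over_iff')
  then show ?case using insert
    by (auto simp: coeff_pCons hom_diff hom_mult hom_uminus L.mult L.uminus L.diff hom_add L.add split: nat.split)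
qed (simp add: coeff_pCons one_pCons split: nat.split)

context alg_ext
begin

definition orbit :: "'a \<Rightarrow> 'a set" where
  "orbit x = {\<sigma> x | \<sigma>. \<sigma> \<in> carrier (Gal L F)}"

lemma Gal_fixes: "\<sigma> \<in> carrier (Gal L F) \<Longrightarrow> x \<in> F \<Longrightarrow> \<sigma> x = x"
  by (simp add: Gal_iff)

lemma Gal_root:
  assumes s: "\<sigma> \<in> carrier (Gal L F)" and p: "p \<in> poly_over F" "poly p x = 0" and x: "x \<in> L"
  shows "poly p (\<sigma> x) = 0"
proof -
  interpret s: field_aut L \<sigma> using Gal_field_aut[OF L s] .
  show ?thesis using s.hom_poly[OF x, of p] p Gal_fixes[OF s] FL by (auto simp: poly_over_iff')
qed

lemma orbit_finite: assumes "x \<in> L" shows "finite (orbit x)"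
proof -
  obtain p where p: "p \<in> poly_over F" "p \<noteq> 0" "poly p x = 0" using alg[OF assms] by (auto simp: alg_over_def)
  have "orbit x \<subseteq> {y. poly p y = 0}" using Gal_root[OF _ p(1,3) assms] by (auto simp: orbit_def)
  then show ?thesis using poly_roots_finite[OF p(2)] finite_subset by blast
qed

lemma orbit_L: "x \<in> L \<Longrightarrow> orbit x \<subseteq> L"
  using Gal_field_aut[OF L] field_aut.closed by (fastforce simp: orbit_def)

lemma orbit_self: "x \<in> L \<Longrightarrow> x \<in> orbit x"
  using group.is_monoid[OF Gal_group[OF L FL]] monoid.one_closed Gal_one[OF L FL]
  unfolding orbit_def by (metis (mono_tags, lifting) mem_Collect_eq restrict_apply')

lemma orbit_image:
  assumes s: "\<sigma> \<in> carrier (Gal L F)" and x: "x \<in> L"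
  shows "\<sigma> ` orbit x = orbit x"
proof -
  interpret G: group "Gal L F" by (rule Gal_group[OF L FL])
  interpret s: field_aut L \<sigma> using Gal_field_aut[OF L s] .
  have "\<sigma> (\<tau> x) = (\<sigma> \<otimes>\<^bsub>Gal L F\<^esub> \<tau>) x" if "\<tau> \<in> carrier (Gal L F)" for \<tau>
    using Gal_mult_apply[OF L FL s that x] by simp
  then have "\<sigma> ` orbit x \<subseteq> orbit x" using G.m_closed[OF s] unfolding orbit_def by blast
  moreover have "inj_on \<sigma> (orbit x)" using orbit_L[OF x] s.inj by (auto simp: inj_on_def)
  ultimately show ?thesis using orbit_finite[OF x] by (intro card_subset_eq) (auto simp: card_image)
qed

text \<open>
  Automorphisms over \<open>F\<close> permute the linear factors, so they fix the coefficients.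
\<close>
lemma orbit_poly:
  assumes x: "x \<in> L" shows "(\<Prod>r\<in>orbit x. [:- r, 1:]) \<in> poly_over F"
  unfolding poly_over_iff'
proof
  fix i
  have lin: "[:- s, 1:] \<in> poly_over L" if "s \<in> L" for s
    using that by (auto simp: L.poly_over_iff' coeff_pCons split: nat.split)
  show "Polynomial.coeff (\<Prod>r\<in>orbit x. [:- r, 1:]) i \<in> F"
  proof (rule fixed_field)
    show "Polynomial.coeff (\<Prod>r\<in>orbit x. [:- r, 1:]) i \<in> L"
      using L.poly_over_prod[of "orbit x" "\<lambda>r. [:- r, 1:]"] lin orbit_L[OF x] by (auto simp: L.poly_over_iff')
    fix \<sigma> assume s: "\<sigma> \<in> carrier (Gal L F)"
    interpret s: field_aut L \<sigma> using Gal_field_aut[OF L s] .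
    have "inj_on \<sigma> (orbit x)" using orbit_L[OF x] s.inj by (auto simp: inj_on_def)
    then have "(\<Prod>r\<in>orbit x. [:- \<sigma> r, 1:]) = (\<Prod>r\<in>\<sigma> ` orbit x. [:- r, 1:])"
      by (simp add: prod.reindex)
    then show "\<sigma> (Polynomial.coeff (\<Prod>r\<in>orbit x. [:- r, 1:]) i) = Polynomial.coeff (\<Prod>r\<in>orbit x. [:- r, 1:]) i"
      using s.coeff_prod_linear[OF orbit_finite[OF x] orbit_L[OF x]] orbit_image[OF s x] by simp
  qed
qed

lemma restrict_Gal:
  assumes E: "is_subfield E" "E \<subseteq> L" "F' \<subseteq> E"
    and stable: "\<And>\<sigma> x. \<sigma> \<in> carrier (Gal L F) \<Longrightarrow> x \<in> E \<Longrightarrow> \<sigma> x \<in> E"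
    and s: "\<sigma> \<in> carrier (Gal L F)" and fixed: "\<And>x. x \<in> F' \<Longrightarrow> \<sigma> x = x"
  shows "restrict \<sigma> E \<in> carrier (Gal E F')"
proof -
  interpret G: group "Gal L F" by (rule Gal_group[OF L FL])
  interpret s: field_aut L \<sigma> using Gal_field_aut[OF L s] .
  interpret E: set_field E by (rule set_field.intro[OF E(1)])
  have "y \<in> \<sigma> ` E" if "y \<in> E" for y
    using Gal_inv_apply(2)[OF L FL s, of y] stable[OF G.inv_closed[OF s] that] E(2) that
    by (metis image_eqI subsetD)
  then have "bij_betw \<sigma> E E"
    using stable[OF s] s.inj E(2) by (auto simp: bij_betw_def inj_on_def subset_iff)
  then show ?thesis using E fixed
    by (auto simp: Gal_iff s.hom_add s.hom_mult subset_iff E.add E.mult cong: bij_betw_cong)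
qed

end


section \<open>The action of the Galois group of the base field\<close>

text \<open>
  Two distinct tuples, read as coefficients, give polynomials that agree at finitely many points
  only.  This replaces the theorem of the primitive element.
\<close>
lemma separating_evaluation:
  fixes T :: "'a::field_char_0 list set"
  assumes "finite T" "\<And>xs. xs \<in> T \<Longrightarrow> length xs = n"
  obtains l :: nat where "inj_on (\<lambda>xs. poly (Poly xs) (of_nat l)) T"
proof -
  define B where "B = (\<Union>(xs, ys)\<in>{(xs, ys) \<in> T \<times> T. xs \<noteq> ys}. {z. poly (Poly xs - Poly ys) z = 0})"
  have ne: "Poly xs - Poly ys \<noteq> 0" if "xs \<in> T" "ys \<in> T" "xs \<noteq> ys" for xs ys
  proof
    assume "Poly xs - Poly ys = 0"
    then have "nth_default 0 xs i = nth_default 0 ys i" for i by (metis coeff_Poly_eq eq_iff_diff_eq_0)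
    then have "xs = ys" using assms(2)[OF that(1)] assms(2)[OF that(2)]
      by (intro nth_equalityI) (auto simp: nth_default_def, metis)
    then show False using that(3) by blast
  qed
  have "finite {(xs, ys) \<in> T \<times> T. xs \<noteq> ys}"
    by (rule finite_subset[of _ "T \<times> T"]) (use assms(1) in auto)
  then have "finite B" unfolding B_def
    by (rule finite_UN_I) (auto intro: poly_roots_finite[OF ne] simp del: poly_diff)
  moreover have "infinite (range (of_nat :: nat \<Rightarrow> 'a))" by (intro range_inj_infinite inj_of_nat)
  ultimately obtain l where "(of_nat l :: 'a) \<notin> B" by (meson finite_subset image_subset_iff)
  then have "inj_on (\<lambda>xs. poly (Poly xs) (of_nat l)) T" unfolding inj_on_def B_def by fastforce
  then show ?thesis by (rule that)
qed

text \<open>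
  The condition \<open>K \<inter> kbar = k\<close> is the field-theoretic content of geometric irreducibility.  Below,
  \<open>C\<close> is \<open>kbar\<close>, \<open>F\<close> is \<open>kbar(X)\<close>, and \<open>S\<close>, an extension of \<open>F\<close>, is a separable closure of \<open>K\<close>.
\<close>
locale geometric_setting =
  fixes k K :: "'a::field_char_0 set"
  assumes kf: "is_subfield k" and Kf: "is_subfield K" and kK: "k \<subseteq> K"
    and disjoint: "\<And>x. x \<in> K \<Longrightarrow> x \<in> sep_closure k \<Longrightarrow> x \<in> k"
    and separable_closure: "is_separable_closure (kbarX k K) UNIV"
begin

abbreviation C where "C \<equiv> sep_closure k"
abbreviation F where "F \<equiv> kbarX k K"
abbreviation S where "S \<equiv> sep_closure K"

lemma rc: "root_closed (UNIV :: 'a set)"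
  using separable_closure by (rule separably_closed_imp_root_closed)

sublocale k: set_field k by (rule set_field.intro[OF kf])
sublocale K: set_field K by (rule set_field.intro[OF Kf])
sublocale C: set_field C by (rule set_field.intro[OF k.sep_closure_subfield[OF rc]])
sublocale Ck: alg_ext k C by (rule k.alg_ext_sep_closure[OF rc])
sublocale SK: alg_ext K S by (rule K.alg_ext_sep_closure[OF rc])

lemma C_S: "C \<subseteq> S"
  using alg_over_mono[OF kK] by (auto simp: k.sep_closure_eq[OF rc] K.sep_closure_eq[OF rc])

lemma KC_F: "K \<subseteq> F" "C \<subseteq> F"
  using subring_gen_superset[of "K \<union> C"] by (auto simp: kbarX_def)

lemma F_least: "is_subring R \<Longrightarrow> K \<subseteq> R \<Longrightarrow> C \<subseteq> R \<Longrightarrow> F \<subseteq> R"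
  unfolding kbarX_def by (rule subring_gen_least) auto

lemma F_S: "F \<subseteq> S"
  by (rule F_least) (use SK.L SK.FL C_S in \<open>auto simp: is_subfield_iff\<close>)

lemma F_subfield: "is_subfield F"
proof (rule algebraic_subring_is_subfield[OF K.set_field_axioms _ KC_F(1)])
  show "is_subring F" unfolding kbarX_def by (rule subring_gen_is_subring)
  show "alg_over K x" if "x \<in> F" for x using that F_S SK.alg by blast
qed

sublocale F: set_field F by (rule set_field.intro[OF F_subfield])

sublocale \<Omega>: alg_ext F UNIV
proof (rule alg_ext.intro[OF F.set_field_axioms alg_ext_axioms.intro])
  show "alg_over F x" for x
    using separable_closure by (auto simp: is_separable_closure_def F.separable_over_iff[OF rc])
qed (simp_all add: rc is_subfield_UNIV)

lemma SK_C: "\<sigma> x \<in> C" if s: "\<sigma> \<in> carrier (Gal S K)" and x: "x \<in> C"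
proof -
  obtain p where p: "p \<in> poly_over k" "p \<noteq> 0" "poly p x = 0" using Ck.alg[OF x] by (auto simp: alg_over_def)
  then have "poly p (\<sigma> x) = 0" using SK.Gal_root[OF s, of p x] kK C_S x by (auto simp: poly_over_def)
  then show ?thesis using p k.sep_closure_eq[OF rc] by (auto simp: alg_over_def)
qed

lemma SK_F: "\<sigma> x \<in> F" if s: "\<sigma> \<in> carrier (Gal S K)" and x: "x \<in> F"
proof -
  interpret s: field_aut S \<sigma> using Gal_field_aut[OF SK.L s] .
  have "is_subring {x \<in> S. \<sigma> x \<in> F}"
    unfolding is_subring_iff
    by (auto simp: s.hom_add s.hom_mult s.hom_uminus)
  moreover have "K \<subseteq> {x \<in> S. \<sigma> x \<in> F}" using SK.Gal_fixes[OF s] KC_F SK.FL by (auto simp: subset_iff)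
  moreover have "C \<subseteq> {x \<in> S. \<sigma> x \<in> F}" using SK_C[OF s] KC_F C_S by auto
  ultimately show ?thesis using F_least x by blast
qed

text \<open>
  The restrictions to \<open>C\<close> of the automorphisms over \<open>K\<close> have fixed field \<open>K \<inter> C = k\<close>, so they are
  dense in the Galois group of \<open>C\<close> over \<open>k\<close>.  Indeed, let \<open>\<theta>\<close> be a linear combination of the finite
  set \<open>D\<close> whose conjugates determine those of the elements of \<open>D\<close>.  The orbit polynomial of \<open>\<theta>\<close>
  over \<open>K\<close> has coefficients in \<open>k\<close>, so \<open>\<sigma>\<close> sends \<open>\<theta>\<close> to one of its roots.
\<close>
lemma restrictions_dense:
  assumes s: "\<sigma> \<in> carrier (Gal C k)" and D: "finite D" "D \<subseteq> C"
  obtains \<tau> where "\<tau> \<in> carrier (Gal S K)" "\<And>d. d \<in> D \<Longrightarrow> \<tau> d = \<sigma> d"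
proof -
  interpret s: field_aut C \<sigma> using Gal_field_aut[OF C.F s] .
  obtain cs where cs: "set cs = D" using D(1) finite_list by blast
  have "\<exists>p. p \<in> poly_over k \<and> p \<noteq> 0 \<and> poly p x = 0" if "x \<in> D" for x
    using Ck.alg[of x] that D(2) by (auto simp: alg_over_def)
  then obtain p where p: "\<And>x. x \<in> D \<Longrightarrow> p x \<in> poly_over k \<and> p x \<noteq> 0 \<and> poly (p x) x = 0" by metis
  \<comment> \<open>\<open>T\<close> is finite and contains the images of \<open>cs\<close> under all automorphisms over \<open>k\<close>.\<close>
  define R where "R = (\<Union>x\<in>D. {y. poly (p x) y = 0})"
  have finR: "finite R" unfolding R_def using D(1) p poly_roots_finite by blast
  define T where "T = {ds. set ds \<subseteq> R \<and> length ds = length cs}"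
  have "finite T" unfolding T_def by (rule finite_lists_length_eq[OF finR])
  then obtain l :: nat where l: "inj_on (\<lambda>xs. poly (Poly xs) (of_nat l)) T"
    by (rule separating_evaluation[of T "length cs"]) (auto simp: T_def)
  define \<theta> where "\<theta> = poly (Poly cs) (of_nat l)"
  have hom\<theta>: "poly (Poly (map \<rho> cs)) (of_nat l) = \<rho> \<theta>" if "field_aut L \<rho>" "C \<subseteq> L" for L \<rho>
  proof -
    interpret r: field_aut L \<rho> by fact
    have "poly (Poly ds) (of_nat l) \<in> L \<and> \<rho> (poly (Poly ds) (of_nat l)) = poly (Poly (map \<rho> ds)) (of_nat l)"
      if "set ds \<subseteq> L" for ds
      using that by (induction ds) (auto simp: r.hom_add r.hom_mult r.L.add r.L.mult)
    then show ?thesis using cs D(2) \<open>C \<subseteq> L\<close> by (simp add: \<theta>_def)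
  qed
  have \<theta>C: "\<theta> \<in> C"
  proof -
    have "poly (Poly ds) (of_nat l) \<in> C" if "set ds \<subseteq> C" for ds
      using that by (induction ds) (auto simp: C.add C.mult)
    then show ?thesis using cs D(2) by (simp add: \<theta>_def)
  qed
  then have \<theta>S: "\<theta> \<in> S" using C_S by blast
  define f where "f = (\<Prod>r\<in>SK.orbit \<theta>. [:- r, 1:])"
  have "SK.orbit \<theta> \<subseteq> C" using SK_C \<theta>C by (auto simp: SK.orbit_def)
  then have "f \<in> poly_over C"
    unfolding f_def by (intro C.poly_over_prod) (auto simp: C.poly_over_iff' coeff_pCons split: nat.split)
  moreover have "f \<in> poly_over K" unfolding f_def by (rule SK.orbit_poly[OF \<theta>S])
  ultimately have fk: "f \<in> poly_over k" using disjoint by (auto simp: poly_over_def)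
  have fin: "finite (SK.orbit \<theta>)" by (rule SK.orbit_finite[OF \<theta>S])
  have "poly f \<theta> = 0" using SK.orbit_self[OF \<theta>S] fin by (auto simp: f_def poly_prod prod_zero_iff)
  then have "poly f (\<sigma> \<theta>) = 0" by (rule Ck.Gal_root[OF s fk _ \<theta>C])
  then have "\<sigma> \<theta> \<in> SK.orbit \<theta>" using fin by (auto simp: f_def poly_prod prod_zero_iff)
  then obtain \<tau> where t: "\<tau> \<in> carrier (Gal S K)" "\<sigma> \<theta> = \<tau> \<theta>" by (auto simp: SK.orbit_def)
  interpret t: field_aut S \<tau> using Gal_field_aut[OF SK.L t(1)] .
  have "map \<sigma> cs \<in> T" "map \<tau> cs \<in> T"
    using p cs D(2) Ck.Gal_root[OF s] SK.Gal_root[OF t(1)] C_S kK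
    by (fastforce simp: T_def R_def poly_over_def)+
  moreover have "poly (Poly (map \<sigma> cs)) (of_nat l) = poly (Poly (map \<tau> cs)) (of_nat l)"
    using hom\<theta>[OF s.field_aut_axioms] hom\<theta>[OF t.field_aut_axioms C_S] t(2) by simp
  ultimately have "map \<sigma> cs = map \<tau> cs" using inj_onD[OF l] by blast
  then show ?thesis using that[OF t(1)] cs by (metis map_eq_conv)
qed

text \<open>
  On \<open>x \<in> S\<close> the value of the extension is forced as soon as all automorphisms that agree with \<open>\<sigma>\<close> on
  some finite part of \<open>C\<close> take the same value at \<open>x\<close>.  By density these forced values form the
  graph of an embedding, which then extends to \<open>S\<close>.
\<close>
lemma extend_base_automorphism:
  assumes s: "\<sigma> \<in> carrier (Gal C k)"
  obtains \<tau> where "\<tau> \<in> carrier (Gal S K)" "\<And>x. x \<in> C \<Longrightarrow> \<tau> x = \<sigma> x"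
proof -
  define agree where "agree D \<tau> \<longleftrightarrow> \<tau> \<in> carrier (Gal S K) \<and> (\<forall>d\<in>D. \<tau> d = \<sigma> d)" for D \<tau>
  define G where "G = {(x, y) \<in> S \<times> S. \<exists>D. finite D \<and> D \<subseteq> C \<and> (\<forall>\<tau>. agree D \<tau> \<longrightarrow> \<tau> x = y)}"
  have "partial_emb K S G"
    unfolding partial_emb_def
  proof (intro conjI allI ballI impI)
    show "G \<subseteq> S \<times> S" by (auto simp: G_def)
    show "(x, x) \<in> G" if "x \<in> K" for x
      using that SK.FL SK.Gal_fixes by (auto simp: G_def agree_def intro!: exI[of _ "{}"])
    show "y = 0" if zy: "(0, y) \<in> G" for y
    proof -
      obtain D where D: "finite D" "D \<subseteq> C" "\<And>\<tau>. agree D \<tau> \<Longrightarrow> \<tau> 0 = y" using zy by (auto simp: G_def)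
      obtain \<tau> where t: "agree D \<tau>" using restrictions_dense[OF s D(1,2)] unfolding agree_def by metis
      then interpret t: field_aut S \<tau> using Gal_field_aut[OF SK.L, of \<tau> K] by (simp add: agree_def)
      show ?thesis using D(3)[OF t] by simp
    qed
    fix x x' y y' assume "(x, x') \<in> G" "(y, y') \<in> G"
    then obtain D E where D: "finite D" "D \<subseteq> C" "\<And>\<tau>. agree D \<tau> \<Longrightarrow> \<tau> x = x'"
      and E: "finite E" "E \<subseteq> C" "\<And>\<tau>. agree E \<tau> \<Longrightarrow> \<tau> y = y'" and S: "x \<in> S" "x' \<in> S" "y \<in> S" "y' \<in> S"
      by (auto simp: G_def)
    have both: "\<tau> (x + y) = x' + y' \<and> \<tau> (x * y) = x' * y'" if "agree (D \<union> E) \<tau>" for \<tau>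
    proof -
      interpret t: field_aut S \<tau> using Gal_field_aut[OF SK.L, of \<tau> K] that by (simp add: agree_def)
      have "agree D \<tau>" "agree E \<tau>" using that by (auto simp: agree_def)
      then show ?thesis using D(3) E(3) S by (simp add: t.hom_add t.hom_mult)
    qed
    then show "(x + y, x' + y') \<in> G" "(x * y, x' * y') \<in> G"
      using D(1,2) E(1,2) S unfolding G_def by (auto intro!: exI[of _ "D \<union> E"])
  qed
  then obtain \<tau> where t: "\<tau> \<in> carrier (Gal S K)" "\<And>x y. (x, y) \<in> G \<Longrightarrow> \<tau> x = y"
    by (rule SK.partial_emb_total) blast
  have "\<sigma> x \<in> S" if "x \<in> C" for x
    using field_aut.closed[OF Gal_field_aut[OF C.F s] that] C_S by blast
  then have "(x, \<sigma> x) \<in> G" if "x \<in> C" for x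
    using that C_S by (auto simp: G_def agree_def intro!: exI[of _ "{x}"])
  then show ?thesis using that t by blast
qed

lemma Gal_F_unique:
  assumes "\<tau> \<in> carrier (Gal F K)" "\<tau>' \<in> carrier (Gal F K)" "\<And>x. x \<in> C \<Longrightarrow> \<tau> x = \<tau>' x"
  shows "\<tau> = \<tau>'"
proof (rule Gal_eqI[OF assms(1,2)])
  interpret t: field_aut F \<tau> using Gal_field_aut[OF F_subfield assms(1)] .
  interpret t': field_aut F \<tau>' using Gal_field_aut[OF F_subfield assms(2)] .
  have "is_subring {x \<in> F. \<tau> x = \<tau>' x}"
    unfolding is_subring_iff
    by (auto simp: t.hom_add t.hom_mult t.hom_uminus t'.hom_add t'.hom_mult t'.hom_uminus)
  moreover have "K \<subseteq> {x \<in> F. \<tau> x = \<tau>' x}" using assms KC_F by (auto simp: Gal_iff)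
  moreover have "C \<subseteq> {x \<in> F. \<tau> x = \<tau>' x}" using assms(3) KC_F by auto
  ultimately show "\<tau> x = \<tau>' x" if "x \<in> F" for x using F_least that by blast
qed

lemma act_kbarX_unique:
  assumes t: "\<tau> \<in> carrier (Gal F K)" and eq: "\<And>x. x \<in> C \<Longrightarrow> \<tau> x = \<sigma> x" and s: "\<sigma> \<in> carrier (Gal C k)"
  shows "act_kbarX k K \<sigma> = \<tau>"
  unfolding act_kbarX_def
proof (rule the_equality)
  have ext: "\<sigma> \<in> extensional C" using s by (simp add: Gal_iff)
  show "\<tau> \<in> carrier (Gal F K) \<and> restrict \<tau> C = \<sigma>"
    using t eq ext by (auto intro!: extensionalityI[of _ C])
  fix \<tau>' assume t': "\<tau>' \<in> carrier (Gal F K) \<and> restrict \<tau>' C = \<sigma>"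
  show "\<tau>' = \<tau>"
    by (rule Gal_F_unique) (use t t' eq in \<open>auto dest: fun_cong[of _ \<sigma>]\<close>)
qed

text \<open>
  The definite description is justified, since \<open>K\<close> and \<open>C\<close> generate \<open>F\<close>.
\<close>
lemma act_kbarX:
  assumes s: "\<sigma> \<in> carrier (Gal C k)"
  shows "act_kbarX k K \<sigma> \<in> carrier (Gal F K)" "\<And>x. x \<in> C \<Longrightarrow> act_kbarX k K \<sigma> x = \<sigma> x"
proof -
  obtain \<tau> where t: "\<tau> \<in> carrier (Gal S K)" "\<And>x. x \<in> C \<Longrightarrow> \<tau> x = \<sigma> x"
    by (rule extend_base_automorphism[OF s]) blast
  have r: "restrict \<tau> F \<in> carrier (Gal F K)"
    by (rule SK.restrict_Gal[OF F_subfield F_S KC_F(1)]) (use SK.Gal_fixes SK_F t in auto)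
  have "act_kbarX k K \<sigma> = restrict \<tau> F"
    by (rule act_kbarX_unique[OF r _ s]) (use t KC_F in auto)
  then show "act_kbarX k K \<sigma> \<in> carrier (Gal F K)" "\<And>x. x \<in> C \<Longrightarrow> act_kbarX k K \<sigma> x = \<sigma> x"
    using r t KC_F by auto
qed

end


section \<open>Roots of unity\<close>

lemma card_simple_roots:
  fixes p :: "'a::field_char_0 poly"
  assumes rc: "root_closed (UNIV :: 'a set)" and "p \<noteq> 0"
    and "\<And>x. poly p x = 0 \<Longrightarrow> poly (pderiv p) x \<noteq> 0"
  shows "card {x. poly p x = 0} = degree p"
  using assms(2,3)
proof (induction "degree p" arbitrary: p)
  case 0
  then show ?case by (auto elim!: degree_eq_zeroE)
next
  case (Suc n)
  then obtain r where r: "poly p r = 0" using root_closedD[OF rc, of p] by auto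
  then obtain q where q: "p = [:- r, 1:] * q" using poly_eq_0_iff_dvd by (metis dvdE)
  have q0: "q \<noteq> 0" using Suc.prems(1) q by auto
  have d: "pderiv p = [:- r, 1:] * pderiv q + q" unfolding q pderiv_mult by (simp add: pderiv_pCons)
  have qr: "poly q r \<noteq> 0" using Suc.prems(2)[OF r] by (auto simp: d)
  have "n = degree q" using Suc.hyps(2) q0 unfolding q by (subst (asm) degree_mult_eq) auto
  moreover have "poly (pderiv q) y \<noteq> 0" if "poly q y = 0" for y
  proof -
    have "poly p y = 0" using that by (simp add: q)
    then have "poly (pderiv p) y \<noteq> 0" by (rule Suc.prems(2))
    then show ?thesis unfolding d using that by simp
  qed
  ultimately have "card {x. poly q x = 0} = n" using Suc.hyps(1)[of q] q0 by auto
  moreover have "{x. poly p x = 0} = insert r {x. poly q x = 0}" by (auto simp: q)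
  ultimately show ?case using qr poly_roots_finite[OF q0] Suc.hyps(2) by simp
qed

text \<open>
  For \<open>i > 0\<close>, multiplication by a root of unity \<open>u\<close> with \<open>u\<^sup>i \<noteq> 1\<close> permutes the terms and multiplies the
  sum by a factor other than 1.  Such a \<open>u\<close> exists because \<open>T\<^sup>n - 1\<close> has \<open>n\<close> roots.
\<close>
lemma sum_roots_of_unity:
  fixes n :: nat
  assumes rc: "root_closed (UNIV :: 'a::field_char_0 set)" and n: "n > 0" and i: "i < n"
  shows "(\<Sum>w | w ^ n = (1::'a). inverse w ^ i) = (if i = 0 then of_nat n else 0)"
proof -
  define p :: "'a poly" where "p = Polynomial.monom 1 n - 1"
  define W :: "'a set" where "W = {w. w ^ n = 1}"
  have W: "W = {w. poly p w = 0}" by (auto simp: W_def p_def poly_monom)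
  have dp: "degree p = n" unfolding p_def diff_conv_add_uminus
    using n by (subst degree_add_eq_left) (simp_all add: degree_monom_eq)
  then have p0: "p \<noteq> 0" using n by auto
  have w0: "w \<noteq> 0" if "w \<in> W" for w using that n by (auto simp: W_def power_0_left)
  have "card {x. poly p x = 0} = degree p"
  proof (rule card_simple_roots[OF rc p0])
    fix x assume "poly p x = 0"
    then have "x \<in> W" by (simp add: W)
    then show "poly (pderiv p) x \<noteq> 0" using n w0 by (simp add: p_def pderiv_diff pderiv_monom poly_monom)
  qed
  then have card: "card W = n" using W dp by simp
  have finW: "finite W" using W poly_roots_finite[OF p0] by simp
  show ?thesis
  proof (cases "i = 0")
    case True
    then show ?thesis using card by (simp flip: W_def)
  next
    case False
    define q :: "'a poly" where "q = Polynomial.monom 1 i - 1"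
    have dq: "degree q = i" unfolding q_def diff_conv_add_uminus
      using False by (subst degree_add_eq_left) (simp_all add: degree_monom_eq)
    have "q \<noteq> 0" using False dq by auto
    then have "card {x. poly q x = 0} < card W"
      using card_poly_roots_bound[of q] dq card i by linarith
    then have "\<not> W \<subseteq> {x. poly q x = 0}"
      using card_mono[OF poly_roots_finite[OF \<open>q \<noteq> 0\<close>]] by (meson not_less)
    then obtain u where u: "u \<in> W" "u ^ i \<noteq> 1" by (auto simp: q_def poly_monom)
    have "(\<Sum>w\<in>W. inverse w ^ i) = (\<Sum>w\<in>W. inverse (u * w) ^ i)"
      by (rule sum.reindex_bij_witness[of _ "\<lambda>w. u * w" "\<lambda>w. inverse u * w"])
        (use u w0 in \<open>auto simp: W_def power_mult_distrib power_inverse\<close>)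
    also have "\<dots> = inverse u ^ i * (\<Sum>w\<in>W. inverse w ^ i)"
      by (simp add: sum_distrib_left power_mult_distrib)
    finally have "(1 - inverse u ^ i) * (\<Sum>w\<in>W. inverse w ^ i) = 0" by (simp add: algebra_simps)
    moreover have "inverse u ^ i \<noteq> 1" using u(2) by (simp add: power_inverse)
    ultimately show ?thesis using False by (simp add: W_def)
  qed
qed


section \<open>Kummer theory\<close>

context geometric_setting
begin

text \<open>
  \<open>M\<close> is the group of radicals and \<open>N\<close> is the field \<open>F(M)\<close>: since \<open>M\<close> is closed under multiplication
  and contains \<open>F\<^sup>*\<close>, the \<open>F\<close>-algebra that it generates consists of the sums of its elements.
\<close>
definition M :: "'a set" where
  "M = {f. f \<noteq> 0 \<and> (\<exists>n\<ge>1. f ^ n \<in> F)}"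

definition N :: "'a set" where
  "N = {sum_list ms | ms. set ms \<subseteq> M}"

lemma F_M: "x \<in> F \<Longrightarrow> x \<noteq> 0 \<Longrightarrow> x \<in> M"
  by (auto simp: M_def intro!: exI[of _ 1])

lemma M_nonzero: "m \<in> M \<Longrightarrow> m \<noteq> 0"
  by (simp add: M_def)

lemma M_power: assumes "m \<in> M" obtains n where "n \<ge> 1" "m ^ n \<in> F"
  using assms by (auto simp: M_def)

lemma common_exponent:
  assumes "f \<in> M" "g \<in> M" obtains n where "n \<ge> 1" "f ^ n \<in> F" "g ^ n \<in> F"
proof -
  obtain i j where ij: "i \<ge> 1" "j \<ge> 1" "f ^ i \<in> F" "g ^ j \<in> F" using assms by (auto simp: M_def)
  have "f ^ (i * j) \<in> F" "g ^ (i * j) \<in> F"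
    using F.power[OF ij(3), of j] F.power[OF ij(4), of i] by (simp_all add: power_mult mult.commute flip: power_mult)
  then show ?thesis using that[of "i * j"] ij by simp
qed

lemma M_mult: "f \<in> M \<Longrightarrow> g \<in> M \<Longrightarrow> f * g \<in> M"
  using common_exponent[of f g] F.mult unfolding M_def
  by (metis (mono_tags, lifting) mem_Collect_eq mult_eq_0_iff power_mult_distrib)

lemma M_inverse: "f \<in> M \<Longrightarrow> inverse f \<in> M"
  using F.inverse by (auto simp: M_def power_inverse)

lemma M_divide: "f \<in> M \<Longrightarrow> g \<in> M \<Longrightarrow> f / g \<in> M"
  using M_mult M_inverse by (simp add: divide_inverse)

lemma M_uminus: "f \<in> M \<Longrightarrow> - f \<in> M"
  using M_mult[OF F_M[of "- 1"], of f] by (simp add: F.uminus)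

lemma root_of_C: assumes "z ^ n \<in> C" "n \<ge> 1" shows "z \<in> C"
proof (rule k.sep_closure_root[OF rc])
  let ?p = "Polynomial.monom 1 n - [:z ^ n:]"
  show "?p \<in> poly_over C" using assms(1) by (intro C.poly_over_diff C.poly_over_monom C.poly_over_const) auto
  have "Polynomial.coeff ?p n = 1" using assms(2) by (cases n) (auto simp: coeff_pCons)
  then show "?p \<noteq> 0" by (metis coeff_0 zero_neq_one)
  show "poly ?p z = 0" by (simp add: poly_monom)
qed

lemma root_of_unity_C: "z ^ n = 1 \<Longrightarrow> n \<ge> 1 \<Longrightarrow> z \<in> C"
  using root_of_C[of z n] by simp

lemma nth_root_ex: assumes "n \<ge> 1" obtains y :: 'a where "y ^ n = x"
proof -
  let ?p = "Polynomial.monom 1 n - [:x:]"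
  have "Polynomial.coeff ?p n = 1" using assms by (cases n) (auto simp: coeff_pCons)
  then have "degree ?p > 0" using assms le_degree[of ?p n] by auto
  then obtain y where "poly ?p y = 0" using root_closedD[OF rc] by blast
  then show ?thesis using that by (simp add: poly_monom)
qed

text \<open>Automorphisms over \<open>F\<close> multiply a radical by a root of unity, which lies in \<open>C\<close>.\<close>
lemma aut_on_radical:
  assumes "field_aut L g" and fixed: "\<And>x. x \<in> F \<Longrightarrow> g x = x" and m: "m \<in> M" and L: "m \<in> L"
  shows "g m / m \<in> C" "g m \<in> M"
proof -
  interpret g: field_aut L g by fact
  obtain n where n: "n \<ge> 1" "m ^ n \<in> F" using M_power[OF m] .
  have gn: "g m ^ n = m ^ n" using g.hom_power[OF L, of n] fixed[OF n(2)] by simp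
  then show "g m / m \<in> C"
    using n M_nonzero[OF m] by (intro root_of_unity_C[of _ n]) (simp_all add: power_divide)
  show "g m \<in> M" using gn n M_nonzero[OF m] L by (auto simp: M_def intro!: exI[of _ n])
qed

lemma Gal_on_radical:
  assumes "g \<in> carrier (Gal UNIV F)" "m \<in> M"
  shows "g m / m \<in> C" "g m \<in> M"
  using aut_on_radical[OF Gal_field_aut[OF is_subfield_UNIV assms(1)] \<Omega>.Gal_fixes[OF assms(1)] assms(2)]
  by auto

text \<open>
  Radicals from different classes modulo \<open>F\<^sup>*\<close> are linearly independent over \<open>F\<close>.  As for Dedekind's
  independence of characters, applying an automorphism that separates \<open>m\<^sub>1\<close> from \<open>m\<^sub>0\<close>, rescaled
  to fix \<open>m\<^sub>0\<close>, and subtracting a multiple of the relation removes the term of \<open>m\<^sub>1\<close> without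
  affecting the class of \<open>m\<^sub>0\<close>, except for a nonzero factor.
\<close>
lemma kummer_class_sum:
  assumes "set ms \<subseteq> M" "sum_list ms = 0" and m0: "m0 \<in> M"
  shows "sum_list (filter (\<lambda>m. m / m0 \<in> F) ms) = 0"
  using assms(1,2)
proof (induction "length (filter (\<lambda>m. m / m0 \<notin> F) ms)" arbitrary: ms rule: less_induct)
  case less
  show ?case
  proof (cases "\<forall>m\<in>set ms. m / m0 \<in> F")
    case True
    then have "filter (\<lambda>m. m / m0 \<in> F) ms = ms" by (simp add: filter_id_conv)
    then show ?thesis using less.prems by simp
  next
    case False
    then obtain m1 where m1: "m1 \<in> set ms" "m1 / m0 \<notin> F" by blast
    then obtain g where g: "g \<in> carrier (Gal UNIV F)" "g (m1 / m0) \<noteq> m1 / m0"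
      using \<Omega>.fixed_field[of "m1 / m0"] by blast
    interpret g: field_aut UNIV g using Gal_field_aut[OF is_subfield_UNIV g(1)] .
    define z where "z m = g (m / m0) / (m / m0)" for m
    have zF: "z m \<in> F" if "m \<in> M" for m
      using Gal_on_radical(1)[OF g(1) M_divide[OF that m0]] KC_F by (auto simp: z_def)
    have z1: "z m = 1" if "m / m0 \<in> F" "m \<in> M" for m
      using \<Omega>.Gal_fixes[OF g(1) that(1)] M_nonzero[OF that(2)] M_nonzero[OF m0] by (simp add: z_def)
    have zm1: "z m1 \<noteq> 1"
      using g(2) m1(1) less.prems(1) M_nonzero m0 by (auto simp: z_def divide_simps split: if_splits)
    define ns where "ns = map (\<lambda>m. (z m - z m1) * m) (filter (\<lambda>m. z m \<noteq> z m1) ms)"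
    have m1M: "m1 \<in> M" using m1 less.prems by auto
    have "(z m - z m1) * m \<in> M" if "m \<in> M" "z m \<noteq> z m1" for m
      using M_mult[OF F_M[OF F.diff[OF zF[OF that(1)] zF[OF m1M]]] that(1)] that(2) by simp
    then have "set ns \<subseteq> M" unfolding ns_def using less.prems(1) by auto
    moreover have "sum_list ns = 0"
    proof -
      have "sum_list ns = sum_list (map (\<lambda>m. (z m - z m1) * m) ms)"
        unfolding ns_def by (rule sum_list_map_filter) auto
      also have "\<dots> = sum_list (map (\<lambda>m. m0 / g m0 * g m - z m1 * m) ms)"
        using less.prems(1) M_nonzero m0
        by (intro arg_cong[of _ _ sum_list] map_cong refl) (auto simp: z_def g.hom_divide field_simps)
      also have "\<dots> = m0 / g m0 * sum_list (map g ms) - z m1 * sum_list ms"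
        by (induction ms) (simp_all add: algebra_simps add_divide_distrib)
      also have "sum_list (map g ms) = g (sum_list ms)" using g.hom_sum_list[of ms] by simp
      finally show ?thesis using less.prems(2) by simp
    qed
    moreover have "length (filter (\<lambda>m. m / m0 \<notin> F) ns) < length (filter (\<lambda>m. m / m0 \<notin> F) ms)"
    proof -
      have "filter (\<lambda>m. m / m0 \<notin> F) ns = map (\<lambda>m. (z m - z m1) * m) (filter (\<lambda>m. m / m0 \<notin> F \<and> z m \<noteq> z m1) ms)"
        unfolding ns_def filter_map filter_filter
      proof (intro arg_cong[of _ _ "map _"] filter_cong refl)
        fix m assume "m \<in> set ms"
        then have "z m - z m1 \<in> F" using zF m1M less.prems(1) by blast
        then show "(z m \<noteq> z m1 \<and> ((\<lambda>m. m / m0 \<notin> F) \<circ> (\<lambda>m. (z m - z m1) * m)) m) = (m / m0 \<notin> F \<and> z m \<noteq> z m1)"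
          using F.mult_cancel[of "z m - z m1" "m / m0"] by auto
      qed
      moreover have "length (filter (\<lambda>m. m / m0 \<notin> F \<and> z m \<noteq> z m1) ms) < length (filter (\<lambda>m. m / m0 \<notin> F) ms)"
        using length_filter_less[of m1 "filter (\<lambda>m. m / m0 \<notin> F) ms" "\<lambda>m. z m \<noteq> z m1"] m1 by simp
      ultimately show ?thesis by simp
    qed
    ultimately have "sum_list (filter (\<lambda>m. m / m0 \<in> F) ns) = 0" using less.hyps by blast
    moreover have "filter (\<lambda>m. m / m0 \<in> F) ns = map (\<lambda>m. (1 - z m1) * m) (filter (\<lambda>m. m / m0 \<in> F) ms)"
    proof -
      have "filter (\<lambda>m. m / m0 \<in> F) ns = map (\<lambda>m. (z m - z m1) * m) (filter (\<lambda>m. m / m0 \<in> F) ms)"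
        unfolding ns_def filter_map filter_filter
      proof (intro arg_cong[of _ _ "map _"] filter_cong refl)
        fix m assume m: "m \<in> set ms"
        then have "z m - z m1 \<in> F" using zF m1M less.prems(1) by blast
        then show "(z m \<noteq> z m1 \<and> ((\<lambda>m. m / m0 \<in> F) \<circ> (\<lambda>m. (z m - z m1) * m)) m) = (m / m0 \<in> F)"
          using F.mult_cancel[of "z m - z m1" "m / m0"] z1[of m] zm1 m less.prems(1) by auto
      qed
      then show ?thesis using z1 less.prems(1) by (auto intro!: map_cong)
    qed
    ultimately have "(1 - z m1) * sum_list (filter (\<lambda>m. m / m0 \<in> F) ms) = 0"
      by (simp add: sum_list_const_mult)
    then show ?thesis using zm1 by simp
  qed
qed

text \<open>
  By the previous lemma a relation splits into relations within the classes modulo \<open>F\<^sup>*\<close>.  Within the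
  class of \<open>m\<^sub>0\<close>, division by \<open>m\<^sub>0\<close> gives a relation in \<open>F\<close>, and \<open>\<sigma>\<close> preserves it.
\<close>
lemma kummer_relation:
  assumes s: "field_aut F \<sigma>" and \<rho>: "\<And>f g. f \<in> M \<Longrightarrow> g \<in> M \<Longrightarrow> \<rho> (f * g) = \<rho> f * \<rho> g"
    and ext: "\<And>x. x \<in> F \<Longrightarrow> x \<noteq> 0 \<Longrightarrow> \<rho> x = \<sigma> x"
    and ms: "set ms \<subseteq> M" "sum_list ms = 0"
  shows "sum_list (map \<rho> ms) = 0"
  using ms
proof (induction "length ms" arbitrary: ms rule: less_induct)
  case less
  interpret s: field_aut F \<sigma> by fact
  show ?case
  proof (cases ms)
    case (Cons m0 rest)
    define P where "P m \<longleftrightarrow> m / m0 \<in> F" for m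
    have m0: "m0 \<in> M" and nz: "m0 \<noteq> 0" using Cons less.prems M_nonzero by auto
    have split: "sum_list (map f ms) = sum_list (map f (filter P ms)) + sum_list (map f (filter (\<lambda>m. \<not> P m) ms))" for f :: "'a \<Rightarrow> 'a"
      by (induction ms) simp_all
    have 1: "sum_list (filter P ms) = 0" unfolding P_def by (rule kummer_class_sum[OF less.prems m0])
    have "sum_list (map \<rho> (filter P ms)) = sum_list (map (\<lambda>m. \<rho> m0 * \<sigma> (m / m0)) (filter P ms))"
    proof (intro arg_cong[of _ _ sum_list] map_cong refl)
      fix m assume "m \<in> set (filter P ms)"
      then have m: "m \<in> M" "m / m0 \<in> F" using less.prems by (auto simp: P_def)
      have "\<rho> (m0 * (m / m0)) = \<rho> m0 * \<rho> (m / m0)" by (rule \<rho>[OF m0 M_divide[OF m(1) m0]])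
      then show "\<rho> m = \<rho> m0 * \<sigma> (m / m0)" using ext[OF m(2)] nz M_nonzero[OF m(1)] by simp
    qed
    also have "\<dots> = \<rho> m0 * sum_list (map \<sigma> (map (\<lambda>m. m / m0) (filter P ms)))"
      by (simp add: sum_list_const_mult o_def)
    also have "sum_list (map \<sigma> (map (\<lambda>m. m / m0) (filter P ms))) = \<sigma> (sum_list (map (\<lambda>m. m / m0) (filter P ms)))"
      using conjunct2[OF s.hom_sum_list[of "map (\<lambda>m. m / m0) (filter P ms)"], symmetric]
      unfolding P_def by fastforce
    also have "sum_list (map (\<lambda>m. m / m0) (filter P ms)) = sum_list (filter P ms) / m0"
      by (simp add: divide_inverse sum_list_mult_const)
    finally have 2: "sum_list (map \<rho> (filter P ms)) = 0" using 1 by simp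
    have "sum_list (filter (\<lambda>m. \<not> P m) ms) = 0" using split[of id] 1 less.prems(2) by simp
    moreover have "P m0" using nz by (simp add: P_def)
    then have "length (filter (\<lambda>m. \<not> P m) ms) < length ms"
      using Cons by (intro length_filter_less[of m0]) auto
    ultimately have "sum_list (map \<rho> (filter (\<lambda>m. \<not> P m) ms)) = 0"
      using less.hyps less.prems(1) by (metis (no_types, lifting) filter_is_subset order_trans)
    then show ?thesis using split[of \<rho>] 2 by simp
  qed simp
qed

lemma sum_list_map_uminus: "sum_list (map uminus xs) = - sum_list (xs :: 'a list)"
  by (induction xs) simp_all

lemma M_N: "m \<in> M \<Longrightarrow> m \<in> N"
  unfolding N_def by (auto intro!: exI[of _ "[m]"])

lemma F_N: "F \<subseteq> N"
proof
  fix x assume "x \<in> F"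
  then show "x \<in> N" using M_N F_M by (cases "x = 0") (auto simp: N_def intro!: exI[of _ "[]"])
qed

lemma N_add: "x \<in> N \<Longrightarrow> y \<in> N \<Longrightarrow> x + y \<in> N"
  unfolding N_def by (smt (verit) Un_subset_iff mem_Collect_eq set_append sum_list_append)

lemma N_sum: "(\<And>i. i \<in> I \<Longrightarrow> f i \<in> N) \<Longrightarrow> (\<Sum>i\<in>I. f i) \<in> N"
  using F_N by (induction I rule: infinite_finite_induct) (auto intro: N_add)

lemma sum_list_product:
  fixes xs ys :: "'a list"
  shows "sum_list [x * y. x \<leftarrow> xs, y \<leftarrow> ys] = sum_list xs * sum_list ys"
  by (induction xs) (simp_all add: sum_list_const_mult distrib_right)

lemma N_subfield: "is_subfield N"
proof (rule algebraic_subring_is_subfield[OF F.set_field_axioms _ F_N \<Omega>.alg])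
  show "is_subring N"
    unfolding is_subring_iff
  proof (intro conjI ballI)
    show "0 \<in> N" "1 \<in> N" using F_N by auto
    fix x assume "x \<in> N"
    then obtain xs where xs: "x = sum_list xs" "set xs \<subseteq> M" by (auto simp: N_def)
    have "- x = sum_list (map uminus xs)" by (simp add: xs sum_list_map_uminus)
    moreover have "set (map uminus xs) \<subseteq> M" using xs M_uminus by auto
    ultimately show "- x \<in> N" unfolding N_def by blast
    fix y assume y: "y \<in> N"
    show "x + y \<in> N" using \<open>x \<in> N\<close> y by (rule N_add)
    from y obtain ys where ys: "y = sum_list ys" "set ys \<subseteq> M" by (auto simp: N_def)
    have "x * y = sum_list [x * y. x \<leftarrow> xs, y \<leftarrow> ys]" by (simp only: sum_list_product xs ys)
    moreover have "set [x * y. x \<leftarrow> xs, y \<leftarrow> ys] \<subseteq> M" using xs ys M_mult by auto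
    ultimately show "x * y \<in> N" unfolding N_def by blast
  qed
qed simp

sublocale N: set_field N by (rule set_field.intro[OF N_subfield])

lemma hom_determined_by_M:
  assumes "field_aut N \<theta>" "field_aut N \<theta>'" "\<And>m. m \<in> M \<Longrightarrow> \<theta> m = \<theta>' m" "x \<in> N"
  shows "\<theta> x = \<theta>' x"
proof -
  interpret a: field_aut N \<theta> by fact
  interpret b: field_aut N \<theta>' by fact
  obtain xs where xs: "x = sum_list xs" "set xs \<subseteq> M" using assms(4) by (auto simp: N_def)
  then have "set xs \<subseteq> N" using M_N by auto
  then have "\<theta> x = sum_list (map \<theta> xs)" "\<theta>' x = sum_list (map \<theta>' xs)"
    using a.hom_sum_list b.hom_sum_list by (simp_all add: xs)
  moreover have "map \<theta> xs = map \<theta>' xs" using assms(3) xs by auto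
  ultimately show ?thesis by simp
qed

text \<open>
  This is Kummer theory in the form needed here: the automorphisms of the field \<open>N\<close> are recovered from
  their restrictions to the group \<open>M\<close>.  As \<open>\<rho>\<close> preserves additive relations, it extends to sums.
\<close>
lemma kummer_extension:
  assumes s: "field_aut F \<sigma>" and \<rho>: "\<And>f g. f \<in> M \<Longrightarrow> g \<in> M \<Longrightarrow> \<rho> (f * g) = \<rho> f * \<rho> g"
    and bij: "bij_betw \<rho> M M" and ext: "\<And>x. x \<in> F \<Longrightarrow> x \<noteq> 0 \<Longrightarrow> \<rho> x = \<sigma> x"
    and fixed: "\<And>x. x \<in> E \<Longrightarrow> \<sigma> x = x" and E: "E \<subseteq> F"
  obtains \<theta> where "\<theta> \<in> carrier (Gal N E)" "\<And>m. m \<in> M \<Longrightarrow> \<theta> m = \<rho> m"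
proof -
  interpret s: field_aut F \<sigma> by fact
  have \<rho>M: "\<rho> m \<in> M" if "m \<in> M" for m using bij that by (auto simp: bij_betw_def)
  have \<rho>neg: "\<rho> (- m) = - \<rho> m" if "m \<in> M" for m
    using \<rho>[OF F_M[of "- 1"] that] ext[of "- 1"] s.hom_uminus[of 1] by (simp add: F.uminus)
  have wd: "sum_list (map \<rho> xs) = sum_list (map \<rho> ys)"
    if "set xs \<subseteq> M" "set ys \<subseteq> M" "sum_list xs = sum_list ys" for xs ys
  proof -
    have "sum_list (map \<rho> (xs @ map uminus ys)) = 0"
      by (rule kummer_relation[OF s \<rho> ext]) (use that M_uminus in \<open>auto simp: sum_list_map_uminus\<close>)
    moreover have "map \<rho> (map uminus ys) = map uminus (map \<rho> ys)" using that \<rho>neg by auto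
    ultimately show ?thesis by (simp add: sum_list_map_uminus del: map_map)
  qed
  define \<theta> where "\<theta> = (\<lambda>x\<in>N. sum_list (map \<rho> (SOME xs. set xs \<subseteq> M \<and> sum_list xs = x)))"
  have \<theta>: "\<theta> (sum_list xs) = sum_list (map \<rho> xs)" if "set xs \<subseteq> M" for xs
  proof -
    let ?Q = "\<lambda>ys. set ys \<subseteq> M \<and> sum_list ys = sum_list xs"
    have "?Q (SOME ys. ?Q ys)" by (rule someI[of ?Q xs]) (use that in auto)
    then have "sum_list (map \<rho> (SOME ys. ?Q ys)) = sum_list (map \<rho> xs)" using wd that by blast
    moreover have "sum_list xs \<in> N" using that by (auto simp: N_def)
    ultimately show ?thesis by (simp add: \<theta>_def)
  qed
  have \<theta>M: "\<theta> m = \<rho> m" if "m \<in> M" for m using \<theta>[of "[m]"] that by simp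
  have hom: "\<theta> (x + y) = \<theta> x + \<theta> y \<and> \<theta> (x * y) = \<theta> x * \<theta> y" if "x \<in> N" "y \<in> N" for x y
  proof -
    obtain xs ys where xs: "x = sum_list xs" "set xs \<subseteq> M" and ys: "y = sum_list ys" "set ys \<subseteq> M"
      using \<open>x \<in> N\<close> \<open>y \<in> N\<close> by (auto simp: N_def)
    have "\<theta> (sum_list (xs @ ys)) = \<theta> (sum_list xs) + \<theta> (sum_list ys)" using xs ys by (simp only: \<theta>[of "xs @ ys"] \<theta> set_append Un_subset_iff) simp
    moreover have "\<theta> (sum_list [x * y. x \<leftarrow> xs, y \<leftarrow> ys]) = sum_list (map \<rho> xs) * sum_list (map \<rho> ys)"
    proof -
      have "set [x * y. x \<leftarrow> xs, y \<leftarrow> ys] \<subseteq> M" using xs ys M_mult by auto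
      then have "\<theta> (sum_list [x * y. x \<leftarrow> xs, y \<leftarrow> ys]) = sum_list (map \<rho> [x * y. x \<leftarrow> xs, y \<leftarrow> ys])" by (rule \<theta>)
      also have "map \<rho> [x * y. x \<leftarrow> xs, y \<leftarrow> ys] = [x * y. x \<leftarrow> map \<rho> xs, y \<leftarrow> map \<rho> ys]"
        using xs(2) ys(2)
      proof (induction xs)
        case (Cons a xs)
        moreover have "map \<rho> (map ((*) a) ys) = map ((*) (\<rho> a)) (map \<rho> ys)"
          using Cons.prems \<rho> by (auto simp: subset_iff)
        ultimately show ?case by simp
      qed simp
      also have "sum_list \<dots> = sum_list (map \<rho> xs) * sum_list (map \<rho> ys)" by (rule sum_list_product)
      finally show ?thesis .
    qed
    ultimately show ?thesis using \<theta>[OF xs(2)] \<theta>[OF ys(2)] by (simp add: sum_list_product xs(1) ys(1))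
  qed
  have \<theta>N: "\<theta> x \<in> N" if x: "x \<in> N" for x
  proof -
    obtain xs where xs: "x = sum_list xs" "set xs \<subseteq> M" using x by (auto simp: N_def)
    have "set (map \<rho> xs) \<subseteq> M" using xs(2) \<rho>M by auto
    then show ?thesis using \<theta>[OF xs(2)] xs(1) unfolding N_def by blast
  qed
  have surj: "\<exists>x\<in>N. \<theta> x = y" if y: "y \<in> N" for y
  proof -
    obtain ys where ys: "y = sum_list ys" "set ys \<subseteq> M" using y by (auto simp: N_def)
    define xs where "xs = map (inv_into M \<rho>) ys"
    have *: "inv_into M \<rho> m \<in> M" "\<rho> (inv_into M \<rho> m) = m" if "m \<in> M" for m
      using bij that by (auto simp: bij_betw_def inv_into_into f_inv_into_f)
    have "set xs \<subseteq> M" "map \<rho> xs = ys" using ys(2) * by (auto simp: xs_def subset_iff map_idI)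
    then have "sum_list xs \<in> N" "\<theta> (sum_list xs) = y" using \<theta> ys(1) by (auto simp: N_def)
    then show ?thesis by blast
  qed
  have \<theta>1: "\<theta> 1 = 1" using \<theta>M[OF F_M[of 1]] ext[of 1] by simp
  have "inj_on \<theta> N"
  proof (rule inj_onI)
    fix x y assume xy: "x \<in> N" "y \<in> N" "\<theta> x = \<theta> y"
    have "\<theta> (x - y) + \<theta> y = \<theta> x" using hom[of "x - y" y] xy by (simp add: N.diff)
    then have "\<theta> (x - y) = 0" using xy(3) by simp
    moreover have "\<theta> (x - y) * \<theta> (inverse (x - y)) = 1" if "x \<noteq> y"
      using hom[of "x - y" "inverse (x - y)"] xy(1,2) that \<theta>1 by (simp add: N.diff N.inverse)
    ultimately show "x = y" by auto
  qed
  then have "bij_betw \<theta> N N" using \<theta>N surj by (auto simp: bij_betw_def)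
  moreover have "\<theta> x = x" if x: "x \<in> E" for x
  proof (cases "x = 0")
    case True
    then show ?thesis using \<theta>[of "[]"] by simp
  next
    case False
    then show ?thesis using x E fixed ext \<theta>M F_M by (metis subsetD)
  qed
  ultimately have "\<theta> \<in> carrier (Gal N E)" using hom by (auto simp: Gal_iff \<theta>_def)
  then show ?thesis using that \<theta>M by blast
qed

end


section \<open>The maximal abelian extension is generated by radicals\<close>

context geometric_setting
begin

lemma N_stable:
  assumes g: "g \<in> carrier (Gal UNIV F)" and x: "x \<in> N" shows "g x \<in> N"
proof -
  interpret g: field_aut UNIV g using Gal_field_aut[OF is_subfield_UNIV g] .
  obtain xs where xs: "x = sum_list xs" "set xs \<subseteq> M" using x by (auto simp: N_def)
  have "set (map g xs) \<subseteq> M" using xs(2) Gal_on_radical(2)[OF g] by auto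
  moreover have "g x = sum_list (map g xs)" using g.hom_sum_list[of xs] xs(1) by simp
  ultimately show ?thesis unfolding N_def by blast
qed

text \<open>
  Automorphisms over \<open>F\<close> multiply each radical by an element of \<open>F\<close>, so they commute on \<open>M\<close>.
\<close>
lemma N_abelian: "abelian_ext N F"
  unfolding abelian_ext_def
proof
  show "galois_ext N F"
    unfolding galois_ext_def
  proof (intro conjI ballI)
    fix x assume x: "x \<in> N"
    have "\<Omega>.orbit x \<subseteq> N" using N_stable x by (auto simp: \<Omega>.orbit_def)
    then show "\<exists>R. finite R \<and> R \<subseteq> N \<and> x \<in> R \<and> (\<Prod>r\<in>R. [:- r, 1:]) \<in> poly_over F"
      using \<Omega>.orbit_finite \<Omega>.orbit_self \<Omega>.orbit_poly by (intro exI[of _ "\<Omega>.orbit x"]) auto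
  qed (rule N_subfield F_subfield F_N)+
  interpret G: group "Gal N F" by (rule Gal_group[OF N_subfield F_N])
  show "comm_group (Gal N F)"
  proof (rule G.group_comm_groupI)
    fix s t assume st: "s \<in> carrier (Gal N F)" "t \<in> carrier (Gal N F)"
    note a = Gal_field_aut[OF N_subfield st(1)] Gal_field_aut[OF N_subfield st(2)]
    interpret s: field_aut N s by (rule a)
    interpret t: field_aut N t by (rule a)
    have fx: "s x = x" "t x = x" if "x \<in> F" for x using st that by (auto simp: Gal_iff)
    have ap: "(s \<otimes>\<^bsub>Gal N F\<^esub> t) x = s (t x)" "(t \<otimes>\<^bsub>Gal N F\<^esub> s) x = t (s x)" if "x \<in> N" for x
      using Gal_mult_apply[OF N_subfield F_N] st that by auto
    show "s \<otimes>\<^bsub>Gal N F\<^esub> t = t \<otimes>\<^bsub>Gal N F\<^esub> s"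
    proof (rule Gal_eqI[OF G.m_closed[OF st] G.m_closed[OF st(2,1)]])
      fix x assume "x \<in> N"
      show "(s \<otimes>\<^bsub>Gal N F\<^esub> t) x = (t \<otimes>\<^bsub>Gal N F\<^esub> s) x"
      proof (rule hom_determined_by_M[OF _ _ _ \<open>x \<in> N\<close>])
        fix m assume m: "m \<in> M"
        have zF: "s m / m \<in> F" "t m / m \<in> F"
          using aut_on_radical(1)[OF a(1) fx(1) m M_N[OF m]] aut_on_radical(1)[OF a(2) fx(2) m M_N[OF m]] KC_F by auto
        have e: "s m = s m / m * m" "t m = t m / m * m" using M_nonzero[OF m] by simp_all
        have "s (t m) = t m / m * s m"
          using s.hom_mult[of "t m / m" m] zF F_N M_N[OF m] fx e(2) by (metis subsetD)
        moreover have "t (s m) = s m / m * t m"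
          using t.hom_mult[of "s m / m" m] zF F_N M_N[OF m] fx e(1) by (metis subsetD)
        ultimately show "(s \<otimes>\<^bsub>Gal N F\<^esub> t) m = (t \<otimes>\<^bsub>Gal N F\<^esub> s) m"
          using ap[OF M_N[OF m]] by simp
      qed (use Gal_field_aut[OF N_subfield] G.m_closed st in blast)+
    qed
  qed
qed

text \<open>
  Let \<open>L\<close> be abelian over \<open>F\<close> and \<open>x \<in> L\<close>.  If all conjugates of \<open>x\<close> are \<open>F\<close>-multiples of \<open>x\<close>, then a
  power of \<open>x\<close> is in \<open>F\<close>, namely up to a factor from \<open>F\<close> the product of the conjugates.  Otherwise some
  automorphism \<open>g\<close> moves the line of \<open>x\<close>, and \<open>x\<close> is the sum of its Lagrange resolvents \<open>P w x\<close>.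
  These are eigenvectors of \<open>g\<close>.  As \<open>P w\<close> commutes with all automorphisms, the conjugates of \<open>P w x\<close>
  span fewer lines than those of \<open>x\<close>, and induction applies.
\<close>
lemma abelian_subset_N:
  assumes "abelian_ext L F"
  shows "L \<subseteq> N"
proof
  have L: "is_subfield L" and FL: "F \<subseteq> L" and comm: "comm_group (Gal L F)"
    and gal: "\<And>x. x \<in> L \<Longrightarrow> \<exists>R. finite R \<and> R \<subseteq> L \<and> x \<in> R \<and> (\<Prod>r\<in>R. [:- r, 1:]) \<in> poly_over F"
    using assms by (auto simp: abelian_ext_def galois_ext_def)
  interpret L: set_field L by (rule set_field.intro[OF L])
  interpret GL: comm_group "Gal L F" by (rule comm)
  define G where "G = carrier (Gal UNIV F)"
  have aut: "field_aut UNIV g" if "g \<in> G" for g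
    using Gal_field_aut[OF is_subfield_UNIV] that by (simp add: G_def)
  have fx: "g x = x" if "g \<in> G" "x \<in> F" for g x using \<Omega>.Gal_fixes that by (simp add: G_def)
  have stable: "g x \<in> L" if g: "g \<in> G" and x: "x \<in> L" for g x
  proof -
    obtain R where R: "finite R" "R \<subseteq> L" "x \<in> R" "(\<Prod>r\<in>R. [:- r, 1:]) \<in> poly_over F" using gal[OF x] by blast
    have "poly (\<Prod>r\<in>R. [:- r, 1:]) x = 0" using R by (auto simp: poly_prod prod_zero_iff)
    then have "poly (\<Prod>r\<in>R. [:- r, 1:]) (g x) = 0" using \<Omega>.Gal_root[OF _ R(4)] g by (simp add: G_def)
    then show ?thesis using R by (auto simp: poly_prod prod_zero_iff)
  qed
  have res: "restrict g L \<in> carrier (Gal L F)" if "g \<in> G" for g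
    by (rule \<Omega>.restrict_Gal[OF L _ FL]) (use stable that fx in \<open>auto simp: G_def\<close>)
  have commute: "g (h x) = h (g x)" if "g \<in> G" "h \<in> G" "x \<in> L" for g h x
    using Gal_mult_apply[OF L FL res[OF that(1)] res[OF that(2)] that(3)]
      Gal_mult_apply[OF L FL res[OF that(2)] res[OF that(1)] that(3)]
      GL.m_comm[OF res[OF that(1)] res[OF that(2)]] stable that by simp
  have orbit: "\<Omega>.orbit x = {g x | g. g \<in> G}" for x by (simp add: \<Omega>.orbit_def G_def)
  define line where "line y = {c * y | c. c \<in> F \<and> c \<noteq> 0}" for y :: 'a
  have line_image: "line y = (\<lambda>c. c * y) ` (F - {0})" for y by (auto simp: line_def)
  have line_sub: "line (c * y) \<subseteq> line y" if "c \<in> F" "c \<noteq> 0" for c y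
  proof
    fix z assume "z \<in> line (c * y)"
    then obtain d where "d \<in> F" "d \<noteq> 0" "z = (d * c) * y" by (auto simp: line_def)
    then show "z \<in> line y" using that unfolding line_def by (auto intro!: exI[of _ "d * c"])
  qed
  have line_scale: "line (c * y) = line y" if "c \<in> F" "c \<noteq> 0" for c y
    using line_sub[OF that, of y] line_sub[of "inverse c" "c * y"] that by (simp add: F.inverse flip: mult.assoc)
  define lines where "lines x = line ` \<Omega>.orbit x" for x
  have fin: "finite (lines x)" for x unfolding lines_def using \<Omega>.orbit_finite by blast
  fix x assume "x \<in> L"
  then show "x \<in> N"
  proof (induction "card (lines x)" arbitrary: x rule: less_induct)
    case less
    show ?case
    proof (cases "\<forall>g\<in>G. g x \<in> line x")
      case True
      define R where "R = \<Omega>.orbit x"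
      have R: "finite R" "x \<in> R" using \<Omega>.orbit_finite \<Omega>.orbit_self by (auto simp: R_def)
      show ?thesis
      proof (cases "x = 0")
        case False
        have "\<exists>c. c \<in> F \<and> c \<noteq> 0 \<and> r = c * x" if "r \<in> R" for r
          using True that by (auto simp: R_def orbit line_def)
        then obtain c where c: "\<And>r. r \<in> R \<Longrightarrow> c r \<in> F \<and> c r \<noteq> 0 \<and> r = c r * x" by metis
        have "poly (\<Prod>r\<in>R. [:- r, 1:]) 0 \<in> F"
          using \<Omega>.orbit_poly[of x] by (intro F.poly_in) (auto simp: R_def)
        moreover have "poly (\<Prod>r\<in>R. [:- r, 1:]) 0 = (\<Prod>r\<in>R. - r)" by (simp add: poly_prod)
        also have "\<dots> = (\<Prod>r\<in>R. - c r * x)" by (rule prod.cong) (use c in \<open>auto simp flip: mult_minus_left\<close>)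
        also have "\<dots> = (\<Prod>r\<in>R. - c r) * x ^ card R" by (simp only: prod.distrib prod_constant)
        finally have "(\<Prod>r\<in>R. - c r) * x ^ card R \<in> F" .
        moreover have "(\<Prod>r\<in>R. - c r) \<in> F" "(\<Prod>r\<in>R. - c r) \<noteq> 0" using c R by (auto simp: prod_zero_iff)
        ultimately have "x ^ card R \<in> F" using F.mult_cancel by blast
        moreover have "card R \<ge> 1" using R by (auto simp: Suc_le_eq card_gt_0_iff)
        ultimately show ?thesis using False by (intro M_N) (auto simp: M_def)
      qed (use F_N in auto)
    next
      case False
      then obtain g where g: "g \<in> G" and gx: "g x \<notin> line x" by blast
      interpret g: field_aut UNIV g by (rule aut[OF g])
      have iter_orbit: "(g ^^ i) x \<in> \<Omega>.orbit x" for i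
        using \<Omega>.orbit_self[of x] \<Omega>.orbit_image[of g x] g by (induction i) (auto simp: G_def)
      have "\<not> inj_on (\<lambda>i. (g ^^ i) x) UNIV"
        using iter_orbit \<Omega>.orbit_finite[of x] by (metis UNIV_I finite_imageD finite_subset image_subsetI infinite_UNIV_nat)
      then obtain i j where ij: "i < j" "(g ^^ i) x = (g ^^ j) x"
        by (metis injI linorder_neqE_nat)
      define n where "n = j - i"
      have n: "n > 0" using ij by (simp add: n_def)
      have "(g ^^ (i + n)) x = (g ^^ i) ((g ^^ n) x)" by (simp add: funpow_add)
      then have "(g ^^ i) x = (g ^^ i) ((g ^^ n) x)" using ij by (simp add: n_def)
      moreover have "inj (g ^^ i)" using g.bij by (induction i) (auto simp: bij_betw_def intro: inj_compose)
      ultimately have gn: "(g ^^ n) x = x" by (metis injD)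
      \<comment> \<open>The powers of \<open>g\<close> act on \<open>x\<close> through a cyclic group of order dividing \<open>n\<close>; its characters are the \<open>w \<in> W\<close>.\<close>
      define W where "W = {w :: 'a. w ^ n = 1}"
      define P where "P w y = (\<Sum>i<n. inverse w ^ i * (g ^^ i) y) / of_nat n" for w y
      have W: "w \<in> F" "w \<noteq> 0" if "w \<in> W" for w
        using root_of_unity_C[of w n] that n KC_F by (auto simp: W_def power_0_left)
      have WL: "inverse w ^ i \<in> F" if "w \<in> W" for w i using W that by blast
      have gi: "(g ^^ i) y \<in> L" if "y \<in> L" for i y using that g stable by (induction i) auto
      have gi_lin: "(g ^^ i) (c * y) = c * (g ^^ i) y" if "c \<in> F" for i c y
        using that fx[OF g] by (induction i) (auto simp: g.hom_mult)
      have P_L: "P w y \<in> L" if "w \<in> W" "y \<in> L" for w y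
        unfolding P_def using gi WL that FL by (intro L.divide L.sum L.mult) auto
      have P_lin: "P w (c * y) = c * P w y" if "c \<in> F" for w c y
        unfolding P_def by (simp add: gi_lin[OF that] sum_distrib_left mult.left_commute)
      have P_comm: "h (P w y) = P w (h y)" if h: "h \<in> G" and w: "w \<in> W" and y: "y \<in> L" for h w y
      proof -
        interpret h: field_aut UNIV h by (rule aut[OF h])
        have "h ((g ^^ i) y) = (g ^^ i) (h y)" for i
          using commute[OF h g] gi[OF y] by (induction i) auto
        then show ?thesis unfolding P_def
          by (simp add: h.hom_divide h.hom_sum h.hom_mult fx[OF h WL[OF w]])
      qed
      have P_eigen: "g (P w x) = w * P w x" if w: "w \<in> W" for w
      proof -
        define a where "a i = inverse w ^ i * (g ^^ i) x" for i
        have an: "a n = a 0" using w gn by (simp add: a_def W_def power_inverse)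
        have shift: "g (a i) = w * a (Suc i)" for i
          using W(2)[OF w] by (simp add: a_def g.hom_mult fx[OF g WL[OF w]])
        have "g (\<Sum>i<n. a i) = (\<Sum>i<n. w * a (Suc i))"
          by (simp add: g.hom_sum shift)
        also have "\<dots> = w * (\<Sum>i<n. a (Suc i))" by (simp add: sum_distrib_left)
        also have "(\<Sum>i<n. a (Suc i)) = (\<Sum>i<n. a i)"
          using sum.lessThan_Suc_shift[of a n] an by simp
        finally show ?thesis unfolding P_def a_def[symmetric] by (simp add: g.hom_divide)
      qed
      have "P w x \<in> N" if w: "w \<in> W" for w
      proof (rule less.hyps)
        have line_P: "line (P w y) = P w ` line y" for y
          unfolding line_image image_image by (rule image_cong) (use P_lin in auto)
        have "\<Omega>.orbit (P w x) = P w ` \<Omega>.orbit x"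
          using P_comm[OF _ w less.prems] by (auto simp: orbit)
        moreover note line_P
        ultimately have im: "lines (P w x) = (`) (P w) ` lines x"
          by (simp add: lines_def image_image)
        have in_lines: "line x \<in> lines x" "line (g x) \<in> lines x"
          using \<Omega>.orbit_self[of x] g by (auto simp: lines_def orbit)
        have "P w ` line (g x) = line (P w (g x))" by (rule line_P[symmetric])
        also have "P w (g x) = w * P w x" using P_comm[OF g w less.prems] P_eigen[OF w] by simp
        also have "line (w * P w x) = line (P w x)" using W[OF w] by (rule line_scale)
        also have "\<dots> = P w ` line x" by (rule line_P)
        finally have same: "P w ` line (g x) = P w ` line x" .
        have "g x \<in> line (g x)" by (auto simp: line_def intro!: exI[of _ 1])
        then have ne: "line (g x) \<noteq> line x" using gx by blast
        have "(`) (P w) ` lines x \<subseteq> (`) (P w) ` (lines x - {line x})"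
        proof (rule image_subsetI)
          fix l assume "l \<in> lines x"
          then show "P w ` l \<in> (`) (P w) ` (lines x - {line x})"
            using same[symmetric] in_lines ne by (cases "l = line x") auto
        qed
        then have "card (lines (P w x)) \<le> card (lines x - {line x})"
          unfolding im using fin by (meson card_image_le card_mono finite_Diff finite_imageI order_trans)
        also have "\<dots> < card (lines x)" using in_lines fin by (intro card_Diff1_less) auto
        finally show "card (lines (P w x)) < card (lines x)" .
        show "P w x \<in> L" by (rule P_L[OF w less.prems])
      qed
      moreover have "(\<Sum>w\<in>W. P w x) = x"
      proof -
        have "(\<Sum>w\<in>W. P w x) = (\<Sum>w\<in>W. \<Sum>i<n. inverse w ^ i * (g ^^ i) x) / of_nat n"
          by (simp add: P_def sum_divide_distrib)
        also have "(\<Sum>w\<in>W. \<Sum>i<n. inverse w ^ i * (g ^^ i) x) = (\<Sum>i<n. (\<Sum>w\<in>W. inverse w ^ i) * (g ^^ i) x)"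
          by (subst sum.swap) (simp add: sum_distrib_right)
        also have "\<dots> = (\<Sum>i<n. if i = 0 then of_nat n * x else 0)"
          by (rule sum.cong) (use sum_roots_of_unity[OF rc n] in \<open>auto simp: W_def\<close>)
        also have "\<dots> = of_nat n * x" using n by simp
        finally show ?thesis using n by simp
      qed
      ultimately show ?thesis using N_sum[of W "\<lambda>w. P w x"] by simp
    qed
  qed
qed

lemma kbarX_ab_eq: "kbarX_ab k K = N"
  unfolding kbarX_ab_def max_abelian_ext_def using N_abelian abelian_subset_N by blast

lemma radical_group_eq: "radical_group k K = \<lparr>carrier = M, monoid.mult = (*), monoid.one = 1\<rparr>"
  unfolding radical_group_def kbarX_ab_eq using M_N by (auto simp: M_def)

end


section \<open>Tensor products of abelian groups\<close>

lemma (in group) rcoset_eqI: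
  assumes "subgroup H G" "x \<in> carrier G" "y \<in> carrier G" "x \<otimes> inv y \<in> H"
  shows "H #> x = H #> y"
proof -
  have "(x \<otimes> inv y) \<otimes> y \<in> H #> y" using assms(4) by (auto simp: r_coset_def)
  then have "x \<in> H #> y" using assms by (simp add: m_assoc)
  then show ?thesis using repr_independence assms by blast
qed

context
  fixes A :: "'a monoid" and B :: "'b monoid"
  assumes A: "comm_group A" and B: "comm_group B"
begin

interpretation A: comm_group A by (rule A)
interpretation B: comm_group B by (rule B)

abbreviation (input) FA where "FA \<equiv> free_Abelian_group (carrier A \<times> carrier B)"
abbreviation (input) NK where "NK \<equiv> tensor_kernel A B"

lemma bilinear_relations_closed: "bilinear_relations A B \<subseteq> carrier FA"
  unfolding bilinear_relations_def
  by (auto dest!: subsetD[OF keys_diff])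

lemma tensor_kernel_subgroup: "subgroup NK FA"
  unfolding tensor_kernel_def by (rule group.generate_is_subgroup[OF group_free_Abelian_group bilinear_relations_closed])

lemma tensor_comm_group: "comm_group (tensor_group A B)"
  unfolding tensor_group_def
  by (rule comm_group.abelian_FactGroup[OF abelian_free_Abelian_group tensor_kernel_subgroup])

lemma tensor_normal: "NK \<lhd> FA"
  using comm_group.normal_iff_subgroup[OF abelian_free_Abelian_group] tensor_kernel_subgroup by blast

lemma tensor_mult:
  assumes "x \<in> carrier FA" "y \<in> carrier FA"
  shows "(NK #>\<^bsub>FA\<^esub> x) \<otimes>\<^bsub>tensor_group A B\<^esub> (NK #>\<^bsub>FA\<^esub> y) = NK #>\<^bsub>FA\<^esub> (x + y)"
  using normal.rcos_sum[OF tensor_normal assms] by (simp add: tensor_group_def FactGroup_def)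

lemma tensor_one: "\<one>\<^bsub>tensor_group A B\<^esub> = NK"
  by (simp add: tensor_group_def FactGroup_def)

lemma tensor_carrier: "carrier (tensor_group A B) = {NK #>\<^bsub>FA\<^esub> x | x. x \<in> carrier FA}"
  by (auto simp: tensor_group_def FactGroup_def RCOSETS_def)

lemma tensor_coset_eqI:
  assumes "x \<in> carrier FA" "y \<in> carrier FA" "x - y \<in> NK"
  shows "NK #>\<^bsub>FA\<^esub> x = NK #>\<^bsub>FA\<^esub> y"
proof -
  have "x \<otimes>\<^bsub>FA\<^esub> inv\<^bsub>FA\<^esub> y = x - y" using assms(2) by simp
  then show ?thesis
    using group.rcoset_eqI[OF group_free_Abelian_group tensor_kernel_subgroup assms(1,2)] assms(3) by simp
qed

lemma free_closed:
  "p \<in> carrier A \<times> carrier B \<Longrightarrow> frag_of p \<in> carrier FA"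
  "x \<in> carrier FA \<Longrightarrow> y \<in> carrier FA \<Longrightarrow> x + y \<in> carrier FA"
  "x \<in> carrier FA \<Longrightarrow> y \<in> carrier FA \<Longrightarrow> x - y \<in> carrier FA"
  using keys_add[of x y] keys_diff[of x y] by auto

lemma tensor_coset_zero: "NK #>\<^bsub>FA\<^esub> 0 = \<one>\<^bsub>tensor_group A B\<^esub>"
proof -
  have "0 \<in> NK" using subgroup.one_closed[OF tensor_kernel_subgroup] by simp
  then show ?thesis
    unfolding tensor_one by (intro group.coset_join2[OF group_free_Abelian_group _ tensor_kernel_subgroup]) simp
qed

lemma pure_tensor_closed: "a \<in> carrier A \<Longrightarrow> b \<in> carrier B \<Longrightarrow> pure_tensor A B a b \<in> carrier (tensor_group A B)"
  unfolding pure_tensor_def tensor_carrier by auto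

lemma pure_tensor_left:
  assumes "a \<in> carrier A" "a' \<in> carrier A" "b \<in> carrier B"
  shows "pure_tensor A B (a \<otimes>\<^bsub>A\<^esub> a') b = pure_tensor A B a b \<otimes>\<^bsub>tensor_group A B\<^esub> pure_tensor A B a' b"
proof -
  have "frag_of (a \<otimes>\<^bsub>A\<^esub> a', b) - frag_of (a, b) - frag_of (a', b) \<in> bilinear_relations A B"
    using assms unfolding bilinear_relations_def by blast
  then have d: "frag_of (a \<otimes>\<^bsub>A\<^esub> a', b) - (frag_of (a, b) + frag_of (a', b)) \<in> NK"
    unfolding tensor_kernel_def by (auto intro: generate.incl simp: diff_diff_eq)
  have c: "frag_of (a \<otimes>\<^bsub>A\<^esub> a', b) \<in> carrier FA" "frag_of (a, b) \<in> carrier FA" "frag_of (a', b) \<in> carrier FA"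
    using assms by auto
  show ?thesis
    unfolding pure_tensor_def tensor_mult[OF c(2,3)]
    by (rule tensor_coset_eqI[OF c(1) free_closed(2)[OF c(2,3)] d])
qed

lemma pure_tensor_right:
  assumes "a \<in> carrier A" "b \<in> carrier B" "b' \<in> carrier B"
  shows "pure_tensor A B a (b \<otimes>\<^bsub>B\<^esub> b') = pure_tensor A B a b \<otimes>\<^bsub>tensor_group A B\<^esub> pure_tensor A B a b'"
proof -
  have "frag_of (a, b \<otimes>\<^bsub>B\<^esub> b') - frag_of (a, b) - frag_of (a, b') \<in> bilinear_relations A B"
    using assms unfolding bilinear_relations_def by blast
  then have d: "frag_of (a, b \<otimes>\<^bsub>B\<^esub> b') - (frag_of (a, b) + frag_of (a, b')) \<in> NK"
    unfolding tensor_kernel_def by (auto intro: generate.incl simp: diff_diff_eq)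
  have c: "frag_of (a, b \<otimes>\<^bsub>B\<^esub> b') \<in> carrier FA" "frag_of (a, b) \<in> carrier FA" "frag_of (a, b') \<in> carrier FA"
    using assms by auto
  show ?thesis
    unfolding pure_tensor_def tensor_mult[OF c(2,3)]
    by (rule tensor_coset_eqI[OF c(1) free_closed(2)[OF c(2,3)] d])
qed

lemma pure_tensor_one_left: "b \<in> carrier B \<Longrightarrow> pure_tensor A B \<one>\<^bsub>A\<^esub> b = \<one>\<^bsub>tensor_group A B\<^esub>"
  using pure_tensor_left[of "\<one>\<^bsub>A\<^esub>" "\<one>\<^bsub>A\<^esub>" b] pure_tensor_closed[of "\<one>\<^bsub>A\<^esub>" b]
    group.r_cancel_one'[OF comm_group.axioms(2)[OF tensor_comm_group]] by simp

text \<open>The universal property, in the form in which it detects nonzero pure tensors.\<close>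
lemma pure_tensor_trivial_imp:
  assumes G: "comm_group G" and f: "\<And>a b. a \<in> carrier A \<Longrightarrow> b \<in> carrier B \<Longrightarrow> f a b \<in> carrier G"
    and left: "\<And>a a' b. a \<in> carrier A \<Longrightarrow> a' \<in> carrier A \<Longrightarrow> b \<in> carrier B \<Longrightarrow> f (a \<otimes>\<^bsub>A\<^esub> a') b = f a b \<otimes>\<^bsub>G\<^esub> f a' b"
    and right: "\<And>a b b'. a \<in> carrier A \<Longrightarrow> b \<in> carrier B \<Longrightarrow> b' \<in> carrier B \<Longrightarrow> f a (b \<otimes>\<^bsub>B\<^esub> b') = f a b \<otimes>\<^bsub>G\<^esub> f a b'"
    and ab: "a \<in> carrier A" "b \<in> carrier B" "pure_tensor A B a b = \<one>\<^bsub>tensor_group A B\<^esub>"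
  shows "f a b = \<one>\<^bsub>G\<^esub>"
proof -
  interpret G: comm_group G by (rule G)
  obtain h where h: "h \<in> hom FA G" and hf: "\<And>p. p \<in> carrier A \<times> carrier B \<Longrightarrow> h (frag_of p) = case_prod f p"
    by (rule G.free_Abelian_group_universal[of "case_prod f" "carrier A \<times> carrier B"]) (use f in auto)
  interpret h: group_hom FA G h by (simp add: group_hom_def group_hom_axioms_def h)
  have sub: "h (x - y) = h x \<otimes>\<^bsub>G\<^esub> inv\<^bsub>G\<^esub> h y" if "x \<in> carrier FA" "y \<in> carrier FA" for x y
  proof -
    have "x - y = x \<otimes>\<^bsub>FA\<^esub> inv\<^bsub>FA\<^esub> y" using that by simp
    then show ?thesis by (simp only: h.hom_mult h.G.inv_closed that h.hom_inv)
  qed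
  have fo: "frag_of p \<in> carrier FA" if "p \<in> carrier A \<times> carrier B" for p using that by simp
  have dc: "x - y \<in> carrier FA" if "x \<in> carrier FA" "y \<in> carrier FA" for x y
    using that keys_diff[of x y] by auto
  have "bilinear_relations A B \<subseteq> kernel FA G h"
  proof
    fix r assume "r \<in> bilinear_relations A B"
    then consider (l) a a' b where "a \<in> carrier A" "a' \<in> carrier A" "b \<in> carrier B"
        "r = frag_of (a \<otimes>\<^bsub>A\<^esub> a', b) - frag_of (a, b) - frag_of (a', b)"
      | (r) a b b' where "a \<in> carrier A" "b \<in> carrier B" "b' \<in> carrier B"
        "r = frag_of (a, b \<otimes>\<^bsub>B\<^esub> b') - frag_of (a, b) - frag_of (a, b')"
      unfolding bilinear_relations_def by blast
    then have "r \<in> carrier FA \<and> h r = \<one>\<^bsub>G\<^esub>"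
    proof cases
      case l
      let ?x = "frag_of (a \<otimes>\<^bsub>A\<^esub> a', b)" and ?y = "frag_of (a, b)" and ?z = "frag_of (a', b)"
      have c: "?x \<in> carrier FA" "?y \<in> carrier FA" "?z \<in> carrier FA" using l by (auto intro!: fo)
      have "h r = f (a \<otimes>\<^bsub>A\<^esub> a') b \<otimes>\<^bsub>G\<^esub> inv\<^bsub>G\<^esub> f a b \<otimes>\<^bsub>G\<^esub> inv\<^bsub>G\<^esub> f a' b"
        unfolding l(4) by (simp only: sub dc c) (use l in \<open>simp add: hf\<close>)
      also have "\<dots> = \<one>\<^bsub>G\<^esub>" using l f by (simp add: left G.m_ac; simp flip: G.m_assoc)
      finally show ?thesis using c dc l(4) by blast
    next
      case r
      let ?x = "frag_of (a, b \<otimes>\<^bsub>B\<^esub> b')" and ?y = "frag_of (a, b)" and ?z = "frag_of (a, b')"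
      have c: "?x \<in> carrier FA" "?y \<in> carrier FA" "?z \<in> carrier FA" using r by (auto intro!: fo)
      have "h r = f a (b \<otimes>\<^bsub>B\<^esub> b') \<otimes>\<^bsub>G\<^esub> inv\<^bsub>G\<^esub> f a b \<otimes>\<^bsub>G\<^esub> inv\<^bsub>G\<^esub> f a b'"
        unfolding r(4) by (simp only: sub dc c) (use r in \<open>simp add: hf\<close>)
      also have "\<dots> = \<one>\<^bsub>G\<^esub>" using r f by (simp add: right G.m_ac; simp flip: G.m_assoc)
      finally show ?thesis using c dc r(4) by blast
    qed
    then show "r \<in> kernel FA G h" by (simp add: kernel_def)
  qed
  then have "NK \<subseteq> kernel FA G h"
    unfolding tensor_kernel_def by (rule h.G.generate_subgroup_incl[OF _ h.subgroup_kernel])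
  moreover have "frag_of (a, b) \<in> NK"
    using h.G.rcos_self[OF fo tensor_kernel_subgroup, of "(a, b)"] ab by (simp add: pure_tensor_def tensor_one)
  ultimately have "h (frag_of (a, b)) = \<one>\<^bsub>G\<^esub>" by (auto simp: kernel_def)
  then show ?thesis using hf ab by simp
qed

end


section \<open>The divisible hull of \<open>kbar(X)\<^sup>*/kbar\<^sup>*\<close>\<close>

lemma units_group_simps [simp]:
  "carrier (units_group E) = E - {0}" "\<one>\<^bsub>units_group E\<^esub> = 1" "x \<otimes>\<^bsub>units_group E\<^esub> y = x * y"
  by (simp_all add: units_group_def)

lemma (in set_field) units_comm_group: "comm_group (units_group F)"
  by (rule comm_groupI) (auto simp: mult.assoc mult.commute intro!: bexI[of _ "inverse _"])

lemma (in set_field) units_subgroup: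
  assumes "is_subfield C" "C \<subseteq> F"
  shows "subgroup (C - {0}) (units_group F)"
proof -
  interpret C: set_field C by (rule set_field.intro[OF assms(1)])
  interpret U: comm_group "units_group F" by (rule units_comm_group)
  have "inv\<^bsub>units_group F\<^esub> x = inverse x" if "x \<in> C - {0}" for x
    using that assms(2) by (intro U.inv_equality) auto
  then show ?thesis using assms(2) by (intro U.subgroupI) auto
qed

context geometric_setting
begin

definition coset :: "'a \<Rightarrow> 'a set" where
  "coset x = {c * x | c. c \<in> C \<and> c \<noteq> 0}"

lemma r_coset_units: "(C - {0}) #>\<^bsub>units_group E\<^esub> x = coset x"
  by (auto simp: r_coset_def coset_def)

lemma coset_eq_iff: "x \<noteq> 0 \<Longrightarrow> y \<noteq> 0 \<Longrightarrow> coset x = coset y \<longleftrightarrow> x / y \<in> C"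
proof
  assume nz: "x \<noteq> 0" "y \<noteq> 0" and eq: "coset x = coset y"
  have "x \<in> coset x" by (auto simp: coset_def intro!: exI[of _ 1])
  then have "x \<in> coset y" using eq by simp
  then show "x / y \<in> C" using nz by (auto simp: coset_def)
next
  assume nz: "x \<noteq> 0" "y \<noteq> 0" and q: "x / y \<in> C"
  have sub: "coset u \<subseteq> coset v" if "v \<noteq> 0" "u \<noteq> 0" "u / v \<in> C" for u v
  proof
    fix z assume "z \<in> coset u"
    then obtain c where "c \<in> C" "c \<noteq> 0" "z = c * u" by (auto simp: coset_def)
    moreover from this have "z = (c * (u / v)) * v" using that by simp
    ultimately show "z \<in> coset v" using that C.mult unfolding coset_def by (auto intro!: exI[of _ "c * (u / v)"])
  qed
  have "y / x \<in> C" using C.inverse[OF q] by simp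
  then show "coset x = coset y" using sub q nz by blast
qed

context
  fixes E :: "'a set"
  assumes E: "is_subfield E" "C \<subseteq> E"
begin

lemma units_quotient_comm_group: "comm_group (units_group E Mod (C - {0}))"
  by (intro comm_group.abelian_FactGroup set_field.units_comm_group set_field.units_subgroup set_field.intro C.F E)

lemma units_quotient_carrier: "carrier (units_group E Mod (C - {0})) = coset ` (E - {0})"
  by (auto simp: FactGroup_def RCOSETS_def r_coset_units)

lemma units_quotient_one: "\<one>\<^bsub>units_group E Mod (C - {0})\<^esub> = coset 1"
  by (auto simp: FactGroup_def coset_def)

lemma units_quotient_mult:
  assumes "x \<in> E - {0}" "y \<in> E - {0}"
  shows "coset x \<otimes>\<^bsub>units_group E Mod (C - {0})\<^esub> coset y = coset (x * y)"
proof -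
  interpret E: set_field E by (rule set_field.intro[OF E(1)])
  have "(C - {0}) \<lhd> units_group E"
    using comm_group.normal_iff_subgroup[OF E.units_comm_group] E.units_subgroup[OF C.F E(2)] by blast
  from normal.rcos_sum[OF this, of x y] assms show ?thesis
    by (simp add: FactGroup_def r_coset_units)
qed

end

abbreviation A where "A \<equiv> quot_units k K"
abbreviation V where "V \<equiv> quot_units_rat k K"

lemma
  shows A_comm_group: "comm_group A"
    and A_carrier: "carrier A = coset ` (F - {0})"
    and A_one: "\<one>\<^bsub>A\<^esub> = coset 1"
    and A_mult: "x \<in> F - {0} \<Longrightarrow> y \<in> F - {0} \<Longrightarrow> coset x \<otimes>\<^bsub>A\<^esub> coset y = coset (x * y)"
  unfolding quot_units_def
  by (rule units_quotient_comm_group units_quotient_carrier units_quotient_one units_quotient_mult;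
      (rule F_subfield KC_F)?; assumption?)+

lemma rat_comm_group: "comm_group rat_group"
  by (rule comm_groupI) (auto intro: exI[of _ "- _"])

lemmas A_rat = A_comm_group rat_comm_group

lemma V_comm_group: "comm_group V"
  unfolding quot_units_rat_def by (rule tensor_comm_group[OF A_rat])

sublocale V: comm_group V by (rule V_comm_group)

lemma tensor_rat_eq: "tensor_rat k K x q = pure_tensor A rat_group (coset x) q"
  by (simp add: tensor_rat_def quot_class_def r_coset_units)

lemma tensor_rat_closed: "x \<in> F \<Longrightarrow> x \<noteq> 0 \<Longrightarrow> tensor_rat k K x q \<in> carrier V"
  unfolding tensor_rat_eq quot_units_rat_def by (rule pure_tensor_closed[OF A_rat]) (auto simp: A_carrier)

lemma tensor_rat_mult:
  assumes "x \<in> F" "x \<noteq> 0" "y \<in> F" "y \<noteq> 0"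
  shows "tensor_rat k K (x * y) q = tensor_rat k K x q \<otimes>\<^bsub>V\<^esub> tensor_rat k K y q"
  using pure_tensor_left[OF A_rat, of "coset x" "coset y" q] A_mult[of x y] assms
  unfolding tensor_rat_eq quot_units_rat_def by (auto simp: A_carrier)

lemma tensor_rat_add:
  assumes "x \<in> F" "x \<noteq> 0"
  shows "tensor_rat k K x (q + q') = tensor_rat k K x q \<otimes>\<^bsub>V\<^esub> tensor_rat k K x q'"
  using pure_tensor_right[OF A_rat, of "coset x" q q'] assms
  unfolding tensor_rat_eq quot_units_rat_def by (auto simp: A_carrier)

lemma tensor_rat_C: "x \<in> C \<Longrightarrow> x \<noteq> 0 \<Longrightarrow> tensor_rat k K x q = \<one>\<^bsub>V\<^esub>"
  using pure_tensor_one_left[OF A_rat, of q] coset_eq_iff[of x 1]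
  unfolding tensor_rat_eq quot_units_rat_def by (simp add: A_one)

lemma tensor_rat_zero: "x \<in> F \<Longrightarrow> x \<noteq> 0 \<Longrightarrow> tensor_rat k K x 0 = \<one>\<^bsub>V\<^esub>"
  using tensor_rat_add[of x 0 0] tensor_rat_closed[of x 0] V.r_cancel_one' by simp

lemma tensor_rat_power:
  assumes "x \<in> F" "x \<noteq> 0"
  shows "tensor_rat k K (x ^ n) q = tensor_rat k K x (of_nat n * q)"
proof (induction n)
  case 0
  then show ?case using tensor_rat_C[of 1 q] tensor_rat_zero[OF assms] by simp
next
  case (Suc n)
  then show ?case using tensor_rat_mult[OF assms F.power[OF assms(1)], of n q] tensor_rat_add[OF assms, of q "of_nat n * q"] assms
    by (simp add: algebra_simps)
qed

lemma tensor_rat_inverse: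
  assumes "x \<in> F" "x \<noteq> 0"
  shows "tensor_rat k K (inverse x) q = tensor_rat k K x (- q)"
proof -
  have "tensor_rat k K (inverse x) q \<otimes>\<^bsub>V\<^esub> tensor_rat k K x q = \<one>\<^bsub>V\<^esub>"
    using tensor_rat_mult[of "inverse x" x q] tensor_rat_C[of 1 q] assms by (simp add: F.inverse)
  moreover have "tensor_rat k K x (- q) \<otimes>\<^bsub>V\<^esub> tensor_rat k K x q = \<one>\<^bsub>V\<^esub>"
    using tensor_rat_add[OF assms, of "- q" q] tensor_rat_zero[OF assms] by simp
  ultimately show ?thesis using tensor_rat_closed assms F.inverse
    by (metis V.r_cancel inverse_nonzero_iff_nonzero)
qed

lemma tensor_rat_normal_form:
  assumes "x \<in> F" "x \<noteq> 0"
  obtains y n where "y \<in> F" "y \<noteq> 0" "n \<ge> 1" "tensor_rat k K x q = tensor_rat k K y (1 / of_nat n)"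
proof -
  obtain m n where mn: "quotient_of q = (m, n)" by (cases "quotient_of q")
  then have n: "n > 0" and q: "q = of_int m / of_int n" using quotient_of_denom_pos quotient_of_div by blast+
  define l where "l = nat \<bar>m\<bar>"
  have n1: "nat n \<ge> 1" using n by simp
  show ?thesis
  proof (cases "m \<ge> 0")
    case True
    then have "q = of_nat l * (1 / of_nat (nat n))" using n q by (simp add: l_def)
    then have "tensor_rat k K x q = tensor_rat k K (x ^ l) (1 / of_nat (nat n))"
      using tensor_rat_power[OF assms, of l] by simp
    then show ?thesis using assms by (intro that[of "x ^ l" "nat n"] n1) auto
  next
    case False
    then have "- q = of_nat l * (1 / of_nat (nat n))" using n q by (simp add: l_def)
    then have "tensor_rat k K (inverse x) (- q) = tensor_rat k K (inverse x ^ l) (1 / of_nat (nat n))"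
      using tensor_rat_power[of "inverse x" l] assms F.inverse by simp
    then show ?thesis using assms tensor_rat_inverse[OF assms, of "- q"]
      by (intro that[of "inverse x ^ l" "nat n"] n1) auto
  qed
qed

text \<open>
  Generators \<open>x \<otimes> q\<close> have this form after extracting the numerator of \<open>q\<close>, and differences keep it,
  by passing to a common denominator.
\<close>
lemma V_elements:
  assumes "v \<in> carrier V"
  obtains x n where "x \<in> F" "x \<noteq> 0" "n \<ge> 1" "v = tensor_rat k K x (1 / of_nat n)"
proof -
  let ?FA = "free_Abelian_group (carrier A \<times> (carrier rat_group))"
  let ?NK = "tensor_kernel A rat_group"
  let ?P = "\<lambda>c. \<exists>x n. x \<in> F \<and> x \<noteq> 0 \<and> n \<ge> (1::nat) \<and> ?NK #>\<^bsub>?FA\<^esub> c = tensor_rat k K x (1 / of_nat n)"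
  obtain c where c: "v = ?NK #>\<^bsub>?FA\<^esub> c" "c \<in> carrier ?FA"
    using assms tensor_carrier[OF A_rat] unfolding quot_units_rat_def by auto
  have "Poly_Mapping.keys c \<subseteq> carrier A \<times> carrier rat_group \<and> ?P c"
  proof (rule frag_induction[of c "carrier A \<times> carrier rat_group"])
    show "Poly_Mapping.keys c \<subseteq> carrier A \<times> carrier rat_group" using c(2) by simp
    have "?NK #>\<^bsub>?FA\<^esub> 0 = \<one>\<^bsub>V\<^esub>"
      unfolding quot_units_rat_def by (rule tensor_coset_zero[OF A_rat])
    then show "Poly_Mapping.keys (0 :: ('a set \<times> rat) \<Rightarrow>\<^sub>0 int) \<subseteq> carrier A \<times> carrier rat_group \<and> ?P 0"
      using tensor_rat_C[of 1 1] by (auto intro!: exI[of _ 1])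
  next
    fix p assume p: "p \<in> carrier A \<times> carrier rat_group"
    then obtain x q where x: "p = (coset x, q)" "x \<in> F" "x \<noteq> 0" by (auto simp: A_carrier)
    then have "?NK #>\<^bsub>?FA\<^esub> frag_of p = tensor_rat k K x q" by (simp add: tensor_rat_eq pure_tensor_def)
    moreover obtain y n where "y \<in> F" "y \<noteq> 0" "n \<ge> 1" "tensor_rat k K x q = tensor_rat k K y (1 / of_nat n)"
      by (rule tensor_rat_normal_form[OF x(2,3)])
    ultimately show "Poly_Mapping.keys (frag_of p) \<subseteq> carrier A \<times> carrier rat_group \<and> ?P (frag_of p)" using p by auto
  next
    fix a b
    assume a: "Poly_Mapping.keys a \<subseteq> carrier A \<times> carrier rat_group \<and> ?P a"
      and b: "Poly_Mapping.keys b \<subseteq> carrier A \<times> carrier rat_group \<and> ?P b"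
    then obtain x n y l where x: "x \<in> F" "x \<noteq> 0" "n \<ge> 1" "?NK #>\<^bsub>?FA\<^esub> a = tensor_rat k K x (1 / of_nat n)"
      and y: "y \<in> F" "y \<noteq> 0" "l \<ge> 1" "?NK #>\<^bsub>?FA\<^esub> b = tensor_rat k K y (1 / of_nat l)" by blast
    have ab: "Poly_Mapping.keys (a - b) \<subseteq> carrier A \<times> carrier rat_group" using a b keys_diff[of a b] by blast
    define z q where "z = x ^ l * inverse (y ^ n)" and "q = 1 / (of_nat (n * l) :: rat)"
    have z: "z \<in> F" "z \<noteq> 0" using x y by (auto simp: z_def intro!: F.mult F.inverse F.power)
    have "(?NK #>\<^bsub>?FA\<^esub> (a - b)) \<otimes>\<^bsub>V\<^esub> (?NK #>\<^bsub>?FA\<^esub> b) = ?NK #>\<^bsub>?FA\<^esub> a"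
      unfolding quot_units_rat_def using tensor_mult[OF A_rat, of "a - b" b] a b ab by simp
    moreover have "tensor_rat k K z q \<otimes>\<^bsub>V\<^esub> tensor_rat k K y (1 / of_nat l) = tensor_rat k K x (1 / of_nat n)"
    proof -
      have "tensor_rat k K y (1 / of_nat l) = tensor_rat k K (y ^ n) q"
        "tensor_rat k K x (1 / of_nat n) = tensor_rat k K (x ^ l) q"
        using tensor_rat_power x y by (simp_all add: q_def)
      moreover have "z * y ^ n = x ^ l" using y by (simp add: z_def)
      ultimately show ?thesis using tensor_rat_mult[OF z F.power[OF y(1)], of n q] y(2) by simp
    qed
    moreover have "?NK #>\<^bsub>?FA\<^esub> (a - b) \<in> carrier V"
      using tensor_carrier[OF A_rat] ab unfolding quot_units_rat_def by auto
    ultimately have "?NK #>\<^bsub>?FA\<^esub> (a - b) = tensor_rat k K z q"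
      using V.r_cancel tensor_rat_closed z x y by (metis (no_types, lifting))
    moreover have "n * l \<ge> 1" using x y by simp
    ultimately show "Poly_Mapping.keys (a - b) \<subseteq> carrier A \<times> carrier rat_group \<and> ?P (a - b)"
      using ab z unfolding q_def by blast
  qed
  then show ?thesis using that c(1) by blast
qed

text \<open>
  \<open>y\<close> represents \<open>x \<otimes> q\<close> modulo constants.  This realises \<open>(kbar(X)\<^sup>*/kbar\<^sup>*) \<otimes> \<rat>\<close> by
  multiplicative means and so detects which pure tensors vanish.
\<close>
definition is_root :: "'a \<Rightarrow> rat \<Rightarrow> 'a \<Rightarrow> bool" where
  "is_root x q y \<longleftrightarrow> y \<noteq> 0 \<and> (\<exists>m n. n \<ge> (1::nat) \<and> q = of_int m / of_nat n \<and> y ^ n / x powi m \<in> C)"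

lemma power_C_iff: "n \<ge> 1 \<Longrightarrow> z ^ n \<in> C \<longleftrightarrow> z \<in> C"
  using root_of_C C.power by blast

lemma is_root_iff:
  assumes n: "n \<ge> (1::nat)" and q: "q = of_int m / of_nat n" and x: "x \<noteq> 0"
  shows "is_root x q y \<longleftrightarrow> y \<noteq> 0 \<and> y ^ n / x powi m \<in> C"
proof -
  have "y ^ n' / x powi m' \<in> C \<longleftrightarrow> y ^ n / x powi m \<in> C" if n': "n' \<ge> 1" and q': "q = of_int m' / of_nat n'" for m' n'
  proof -
    have "of_int m * of_nat n' = (of_int m' * of_nat n :: rat)" using q q' n n' by (simp add: field_simps)
    then have "(of_int (m * int n') :: rat) = of_int (m' * int n)" by simp
    then have mn: "m * int n' = m' * int n" by (simp only: of_int_eq_iff)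
    have "(y ^ n' / x powi m') ^ n = y ^ (n' * n) / x powi (m' * int n)"
      using x by (simp add: power_divide power_mult power_int_mult)
    also have "\<dots> = (y ^ n / x powi m) ^ n'"
      unfolding mn[symmetric] using x by (simp add: power_divide power_int_mult mult.commute[of n'] power_mult)
    finally show ?thesis using power_C_iff[OF n] power_C_iff[OF n'] by metis
  qed
  then show ?thesis unfolding is_root_def using n q by blast
qed

lemma common_denominator:
  fixes q q' :: rat
  obtains m m' n where "n \<ge> (1::nat)" "q = of_int m / of_nat n" "q' = of_int m' / of_nat n"
proof -
  obtain a b a' b' where ab: "quotient_of q = (a, b)" "quotient_of q' = (a', b')" by (metis surj_pair)
  then have b: "b > 0" "b' > 0" and q: "q = of_int a / of_int b" "q' = of_int a' / of_int b'"
    using quotient_of_denom_pos quotient_of_div by blast+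
  have "of_nat (nat (b * b')) = (of_int (b * b') :: rat)" using b by simp
  then have "q = of_int (a * b') / of_nat (nat (b * b'))" "q' = of_int (a' * b) / of_nat (nat (b * b'))"
    using b q by (simp_all add: field_simps)
  moreover have "nat (b * b') \<ge> 1" using b by (simp add: Suc_le_eq)
  ultimately show ?thesis using that by blast
qed

text \<open>
  Sending \<open>x \<otimes> q\<close> to the class modulo \<open>C\<^sup>*\<close> of any \<open>y\<close> with \<open>is_root x q y\<close> is well defined, because \<open>C\<close>
  contains all roots of its elements, and bilinear.  A vanishing tensor \<open>x \<otimes> 1/n\<close> must go to the
  trivial class.
\<close>
lemma tensor_rat_trivial:
  assumes x: "x \<in> F" "x \<noteq> 0" and n: "n \<ge> 1" and triv: "tensor_rat k K x (1 / of_nat n) = \<one>\<^bsub>V\<^esub>"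
    and y: "y ^ n = x"
  shows "y \<in> C"
proof -
  let ?G = "units_group UNIV Mod (C - {0})"
  note G = units_quotient_comm_group[OF is_subfield_UNIV subset_UNIV]
    units_quotient_carrier[OF is_subfield_UNIV subset_UNIV] units_quotient_one[OF is_subfield_UNIV]
    units_quotient_mult[OF is_subfield_UNIV subset_UNIV]
  define f where "f c q = coset (SOME y. \<exists>x\<in>c. x \<noteq> 0 \<and> is_root x q y)" for c and q :: rat
  have unique: "coset y = coset y'" if "is_root x q y" "is_root (d * x) q y'" "d \<in> C" "d \<noteq> 0" "x \<noteq> 0" for x q y d y'
  proof -
    obtain n :: nat and m where n: "n \<ge> 1" "q = of_int m / of_nat n" using common_denominator[of q q] by metis
    have r: "y \<noteq> 0" "y' \<noteq> 0" "y ^ n / x powi m \<in> C" "y' ^ n / (d * x) powi m \<in> C"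
      using that is_root_iff[OF n, of x y] is_root_iff[OF n, of "d * x" y'] by auto
    have "(y / y') ^ n = (y ^ n / x powi m) / ((y' ^ n / (d * x) powi m) * d powi m)"
      using that r by (simp add: power_divide power_int_mult_distrib field_simps)
    also have "\<dots> \<in> C" by (rule C.divide[OF r(3) C.mult[OF r(4) C.power_int[OF that(3)]]])
    finally have "y / y' \<in> C" using power_C_iff[OF n(1)] by blast
    then show ?thesis using coset_eq_iff r by blast
  qed
  have f: "f (coset x) q = coset y" if "is_root x q y" "x \<noteq> 0" for x q y
  proof -
    let ?Q = "\<lambda>y. \<exists>z\<in>coset x. z \<noteq> 0 \<and> is_root z q y"
    have "x \<in> coset x" by (auto simp: coset_def intro!: exI[of _ 1])
    then have "?Q y" using that by blast
    then have "?Q (SOME y. ?Q y)" by (rule someI)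
    then obtain z where "z \<in> coset x" "is_root z q (SOME y. ?Q y)" by blast
    then obtain d where "d \<in> C" "d \<noteq> 0" "is_root (d * x) q (SOME y. ?Q y)" by (auto simp: coset_def)
    then show ?thesis using unique[OF that(1) _ _ _ that(2)] by (simp add: f_def)
  qed
  have ex: "\<exists>y. is_root x q y" if "x \<noteq> 0" for x q
  proof -
    obtain n :: nat and m where n: "n \<ge> 1" "q = of_int m / of_nat n" using common_denominator[of q q] by metis
    obtain y where "y ^ n = x powi m" using nth_root_ex[OF n(1)] by blast
    then show ?thesis using is_root_iff[OF n that, of y] that n(1) by (auto intro!: exI[of _ y] simp: power_0_left)
  qed
  have "f (coset x) (1 / of_nat n) = \<one>\<^bsub>?G\<^esub>"
  proof (rule pure_tensor_trivial_imp[OF A_rat G(1), where f = f])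
    show "coset x \<in> carrier A" using x by (auto simp: A_carrier)
    show "pure_tensor A rat_group (coset x) (1 / of_nat n) = \<one>\<^bsub>tensor_group A rat_group\<^esub>"
      using triv by (simp add: tensor_rat_eq quot_units_rat_def)
    fix a q assume a: "a \<in> carrier A"
    then obtain u where u: "a = coset u" "u \<in> F" "u \<noteq> 0" by (auto simp: A_carrier)
    obtain v where v: "is_root u q v" using ex u by blast
    then have v0: "v \<noteq> 0" by (simp add: is_root_def)
    show "f a q \<in> carrier ?G" using f[OF v u(3)] v0 u G(2) by auto
    show "f a (q \<otimes>\<^bsub>rat_group\<^esub> q') = f a q \<otimes>\<^bsub>?G\<^esub> f a q'" for q'
    proof -
      obtain v' where v': "is_root u q' v'" using ex u by blast
      then have v0': "v' \<noteq> 0" by (simp add: is_root_def)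
      obtain n :: nat and m m' where n: "n \<ge> 1" "q = of_int m / of_nat n" "q' = of_int m' / of_nat n"
        using common_denominator[of q q'] by metis
      have qq: "q + q' = of_int (m + m') / of_nat n" using n by (simp add: add_divide_distrib)
      have "(v * v') ^ n / u powi (m + m') = (v ^ n / u powi m) * (v' ^ n / u powi m')"
        using u(3) by (simp add: power_int_add power_mult_distrib)
      also have "\<dots> \<in> C" using v v' is_root_iff[OF n(1,2) u(3)] is_root_iff[OF n(1,3) u(3)] by blast
      finally have "is_root u (q + q') (v * v')" using is_root_iff[OF n(1) qq u(3)] v0 v0' by simp
      then show ?thesis using f v v' u v0 v0' G(4)[of v v'] by simp
    qed
    fix a' assume a': "a' \<in> carrier A"
    then obtain u' where u': "a' = coset u'" "u' \<in> F" "u' \<noteq> 0" by (auto simp: A_carrier)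
    show "f (a \<otimes>\<^bsub>A\<^esub> a') q = f a q \<otimes>\<^bsub>?G\<^esub> f a' q"
    proof -
      obtain v' where v': "is_root u' q v'" using ex u' by blast
      then have v0': "v' \<noteq> 0" by (simp add: is_root_def)
      obtain n :: nat and m where n: "n \<ge> 1" "q = of_int m / of_nat n" using common_denominator[of q q] by metis
      have "(v * v') ^ n / (u * u') powi m = (v ^ n / u powi m) * (v' ^ n / u' powi m)"
        by (simp add: power_int_mult_distrib power_mult_distrib)
      also have "\<dots> \<in> C" using v v' is_root_iff[OF n u(3)] is_root_iff[OF n u'(3)] by blast
      finally have "is_root (u * u') q (v * v')" using is_root_iff[OF n, of "u * u'"] v0 v0' u u' by simp
      then show ?thesis using f v v' u u' v0 v0' G(4)[of v v'] A_mult[of u u'] by simp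
    qed
  qed simp
  moreover have y0: "y \<noteq> 0" using y x n by (auto simp: power_0_left)
  moreover have "is_root x (1 / of_nat n) y" using is_root_iff[OF n, of "1 / of_nat n" 1 x y] x y y0 by simp
  ultimately have "coset y = coset 1" using f x G(3) by simp
  then show ?thesis using coset_eq_iff[OF y0, of 1] by simp
qed

text \<open>
  Both exponents may be replaced by their product.
\<close>
lemma radical_proj_eq:
  assumes "f \<noteq> 0" "n \<ge> 1" "f ^ n \<in> F"
  shows "radical_proj k K f = tensor_rat k K (f ^ n) (1 / of_nat n)"
proof -
  define l where "l = (SOME n. n \<ge> 1 \<and> f ^ n \<in> F)"
  have l: "l \<ge> 1 \<and> f ^ l \<in> F" unfolding l_def by (rule someI) (use assms in blast)
  have "tensor_rat k K (f ^ l) (1 / of_nat l) = tensor_rat k K ((f ^ l) ^ n) (1 / of_nat (l * n))"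
    using tensor_rat_power[of "f ^ l" n "1 / of_nat (l * n)"] l assms by simp
  also have "(f ^ l) ^ n = (f ^ n) ^ l" by (simp add: mult.commute flip: power_mult)
  also have "tensor_rat k K ((f ^ n) ^ l) (1 / of_nat (l * n)) = tensor_rat k K (f ^ n) (1 / of_nat n)"
    using tensor_rat_power[of "f ^ n" l "1 / of_nat (l * n)"] l assms by simp
  finally show ?thesis by (simp add: radical_proj_def l_def Let_def)
qed

end


section \<open>The Krull topology\<close>

lemma Gal_PiE: "\<sigma> \<in> carrier (Gal L F) \<Longrightarrow> \<sigma> \<in> L \<rightarrow>\<^sub>E L"
  by (auto simp: Gal_iff PiE_def bij_betw_def)

lemma topspace_krull: "topspace (krull_topology L F) = carrier (Gal L F)"
  using Gal_PiE[of _ L F] by (auto simp: krull_topology_def topspace_product_topology)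

lemma openin_krull:
  "openin (krull_topology L F) U \<longleftrightarrow> U \<subseteq> carrier (Gal L F) \<and>
     (\<forall>\<sigma>\<in>U. \<exists>S. finite S \<and> S \<subseteq> L \<and> (\<forall>\<tau>\<in>carrier (Gal L F). (\<forall>x\<in>S. \<tau> x = \<sigma> x) \<longrightarrow> \<tau> \<in> U))"
proof
  assume U: "openin (krull_topology L F) U"
  then obtain T where T: "openin (product_topology (\<lambda>_. discrete_topology L) L) T" "U = T \<inter> carrier (Gal L F)"
    by (auto simp: krull_topology_def openin_subtopology)
  show "U \<subseteq> carrier (Gal L F) \<and>
     (\<forall>\<sigma>\<in>U. \<exists>S. finite S \<and> S \<subseteq> L \<and> (\<forall>\<tau>\<in>carrier (Gal L F). (\<forall>x\<in>S. \<tau> x = \<sigma> x) \<longrightarrow> \<tau> \<in> U))"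
  proof (intro conjI ballI)
    show "U \<subseteq> carrier (Gal L F)" using T by blast
    fix \<sigma> assume "\<sigma> \<in> U"
    then obtain V where V: "finite {i \<in> L. V i \<noteq> L}" "\<sigma> \<in> Pi\<^sub>E L V" "Pi\<^sub>E L V \<subseteq> T"
      using T unfolding openin_product_topology_alt by fastforce
    have "\<tau> \<in> U" if t: "\<tau> \<in> carrier (Gal L F)" "\<forall>x\<in>{i \<in> L. V i \<noteq> L}. \<tau> x = \<sigma> x" for \<tau>
    proof -
      have "\<tau> i \<in> V i" if "i \<in> L" for i
        using t(2) V(2) Gal_PiE[OF t(1)] that by (cases "V i = L") (auto simp: PiE_def Pi_def)
      then have "\<tau> \<in> Pi\<^sub>E L V" using Gal_PiE[OF t(1)] by (auto simp: PiE_def)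
      then show ?thesis using V(3) T(2) t(1) by blast
    qed
    then show "\<exists>S. finite S \<and> S \<subseteq> L \<and> (\<forall>\<tau>\<in>carrier (Gal L F). (\<forall>x\<in>S. \<tau> x = \<sigma> x) \<longrightarrow> \<tau> \<in> U)"
      using V(1) by (intro exI[of _ "{i \<in> L. V i \<noteq> L}"]) auto
  qed
next
  assume R: "U \<subseteq> carrier (Gal L F) \<and>
     (\<forall>\<sigma>\<in>U. \<exists>S. finite S \<and> S \<subseteq> L \<and> (\<forall>\<tau>\<in>carrier (Gal L F). (\<forall>x\<in>S. \<tau> x = \<sigma> x) \<longrightarrow> \<tau> \<in> U))"
  then obtain S where S: "\<And>\<sigma>. \<sigma> \<in> U \<Longrightarrow> finite (S \<sigma>) \<and> S \<sigma> \<subseteq> L \<and>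
      (\<forall>\<tau>\<in>carrier (Gal L F). (\<forall>x\<in>S \<sigma>. \<tau> x = \<sigma> x) \<longrightarrow> \<tau> \<in> U)" by metis
  define B where "B \<sigma> = Pi\<^sub>E L (\<lambda>i. if i \<in> S \<sigma> then {\<sigma> i} else L)" for \<sigma>
  have "openin (product_topology (\<lambda>_. discrete_topology L) L) (B \<sigma>)" if s: "\<sigma> \<in> U" for \<sigma>
    unfolding openin_product_topology_alt
  proof (intro ballI exI conjI)
    fix x assume "x \<in> B \<sigma>"
    then show "x \<in> Pi\<^sub>E L (\<lambda>i. if i \<in> S \<sigma> then {\<sigma> i} else L)" by (simp add: B_def)
    show "finite {i \<in> L. (if i \<in> S \<sigma> then {\<sigma> i} else L) \<noteq> topspace (discrete_topology L)}"
      by (rule finite_subset[of _ "S \<sigma>"]) (use S[OF s] in auto)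
    have "\<sigma> i \<in> L" if "i \<in> L" for i using Gal_PiE[of \<sigma> L F] R s that by (auto simp: PiE_def Pi_def)
    then show "openin (discrete_topology L) (if i \<in> S \<sigma> then {\<sigma> i} else L)" if "i \<in> L" for i using that by auto
  qed (simp add: B_def)
  then have "openin (product_topology (\<lambda>_. discrete_topology L) L) (\<Union>\<sigma>\<in>U. B \<sigma>)" by (intro openin_Union) auto
  moreover have "U = (\<Union>\<sigma>\<in>U. B \<sigma>) \<inter> carrier (Gal L F)"
  proof (intro Set.set_eqI iffI)
    fix \<tau> assume t: "\<tau> \<in> U"
    then have "\<tau> \<in> L \<rightarrow>\<^sub>E L" using R Gal_PiE by blast
    then have "\<tau> \<in> B \<tau>" by (auto simp: B_def PiE_def Pi_def)
    then show "\<tau> \<in> (\<Union>\<sigma>\<in>U. B \<sigma>) \<inter> carrier (Gal L F)" using t R by blast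
  next
    fix \<tau> assume "\<tau> \<in> (\<Union>\<sigma>\<in>U. B \<sigma>) \<inter> carrier (Gal L F)"
    then obtain \<sigma> where s: "\<sigma> \<in> U" "\<tau> \<in> B \<sigma>" "\<tau> \<in> carrier (Gal L F)" by blast
    have "\<tau> x = \<sigma> x" if "x \<in> S \<sigma>" for x
      using s(2) S[OF s(1)] that by (force simp: B_def PiE_def Pi_def split: if_splits)
    then show "\<tau> \<in> U" using S[OF s(1)] s(3) by blast
  qed
  ultimately show "openin (krull_topology L F) U" by (auto simp: krull_topology_def openin_subtopology)
qed

lemma continuous_krull_iff:
  "continuous_map (krull_topology L F) (krull_topology L' F') s \<longleftrightarrow>
     s ` carrier (Gal L F) \<subseteq> carrier (Gal L' F') \<and>
     (\<forall>\<sigma>\<in>carrier (Gal L F). \<forall>x\<in>L'. \<exists>S. finite S \<and> S \<subseteq> L \<and>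
        (\<forall>\<tau>\<in>carrier (Gal L F). (\<forall>c\<in>S. \<tau> c = \<sigma> c) \<longrightarrow> s \<tau> x = s \<sigma> x))"
proof
  assume c: "continuous_map (krull_topology L F) (krull_topology L' F') s"
  then have im: "s ` carrier (Gal L F) \<subseteq> carrier (Gal L' F')"
    by (metis continuous_map_image_subset_topspace topspace_krull)
  moreover have "\<exists>S. finite S \<and> S \<subseteq> L \<and> (\<forall>\<tau>\<in>carrier (Gal L F). (\<forall>c\<in>S. \<tau> c = \<sigma> c) \<longrightarrow> s \<tau> x = s \<sigma> x)"
    if s: "\<sigma> \<in> carrier (Gal L F)" and x: "x \<in> L'" for \<sigma> x
  proof -
    have "openin (krull_topology L' F') {\<tau> \<in> carrier (Gal L' F'). \<tau> x = s \<sigma> x}"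
      unfolding openin_krull using x by (auto intro!: exI[of _ "{x}"])
    from openin_continuous_map_preimage[OF c this]
    have "openin (krull_topology L F) {\<tau> \<in> carrier (Gal L F). s \<tau> \<in> carrier (Gal L' F') \<and> s \<tau> x = s \<sigma> x}"
      (is "openin _ ?W") by (simp add: topspace_krull)
    moreover have "\<sigma> \<in> ?W" using s im by blast
    ultimately obtain S where "finite S" "S \<subseteq> L"
      "\<And>\<tau>. \<tau> \<in> carrier (Gal L F) \<Longrightarrow> (\<forall>c\<in>S. \<tau> c = \<sigma> c) \<Longrightarrow> \<tau> \<in> ?W"
      unfolding openin_krull by meson
    then show ?thesis by (intro exI[of _ S]) simp
  qed
  ultimately show "s ` carrier (Gal L F) \<subseteq> carrier (Gal L' F') \<and>
     (\<forall>\<sigma>\<in>carrier (Gal L F). \<forall>x\<in>L'. \<exists>S. finite S \<and> S \<subseteq> L \<and>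
        (\<forall>\<tau>\<in>carrier (Gal L F). (\<forall>c\<in>S. \<tau> c = \<sigma> c) \<longrightarrow> s \<tau> x = s \<sigma> x))" by blast
next
  assume R: "s ` carrier (Gal L F) \<subseteq> carrier (Gal L' F') \<and>
     (\<forall>\<sigma>\<in>carrier (Gal L F). \<forall>x\<in>L'. \<exists>S. finite S \<and> S \<subseteq> L \<and>
        (\<forall>\<tau>\<in>carrier (Gal L F). (\<forall>c\<in>S. \<tau> c = \<sigma> c) \<longrightarrow> s \<tau> x = s \<sigma> x))"
  show "continuous_map (krull_topology L F) (krull_topology L' F') s"
    unfolding continuous_map
  proof (intro conjI allI impI)
    show "s ` topspace (krull_topology L F) \<subseteq> topspace (krull_topology L' F')" using R by (simp add: topspace_krull)
    fix U assume U: "openin (krull_topology L' F') U"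
    show "openin (krull_topology L F) {\<sigma> \<in> topspace (krull_topology L F). s \<sigma> \<in> U}"
      unfolding topspace_krull openin_krull[of L F]
    proof (intro conjI ballI)
      fix \<sigma> assume "\<sigma> \<in> {\<sigma> \<in> carrier (Gal L F). s \<sigma> \<in> U}"
      then have s: "\<sigma> \<in> carrier (Gal L F)" "s \<sigma> \<in> U" by auto
      then obtain S' where S': "finite S'" "S' \<subseteq> L'"
        "\<And>\<tau>. \<tau> \<in> carrier (Gal L' F') \<Longrightarrow> (\<forall>x\<in>S'. \<tau> x = s \<sigma> x) \<Longrightarrow> \<tau> \<in> U"
        using conjunct2[OF U[unfolded openin_krull], rule_format, OF s(2)] by blast
      have "\<exists>S. finite S \<and> S \<subseteq> L \<and> (\<forall>\<tau>\<in>carrier (Gal L F). (\<forall>c\<in>S. \<tau> c = \<sigma> c) \<longrightarrow> s \<tau> x = s \<sigma> x)" if "x \<in> S'" for x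
        by (rule bspec[OF bspec[OF conjunct2[OF R] s(1)] subsetD[OF S'(2) that]])
      then obtain S where S: "\<And>x. x \<in> S' \<Longrightarrow> finite (S x) \<and> S x \<subseteq> L \<and>
          (\<forall>\<tau>\<in>carrier (Gal L F). (\<forall>c\<in>S x. \<tau> c = \<sigma> c) \<longrightarrow> s \<tau> x = s \<sigma> x)" by metis
      show "\<exists>S. finite S \<and> S \<subseteq> L \<and>
         (\<forall>\<tau>\<in>carrier (Gal L F). (\<forall>x\<in>S. \<tau> x = \<sigma> x) \<longrightarrow> \<tau> \<in> {\<sigma> \<in> carrier (Gal L F). s \<sigma> \<in> U})"
      proof (intro exI[of _ "\<Union>x\<in>S'. S x"] conjI ballI impI)
        fix \<tau> assume t: "\<tau> \<in> carrier (Gal L F)" "\<forall>x\<in>\<Union>x\<in>S'. S x. \<tau> x = \<sigma> x"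
        then have "\<forall>x\<in>S'. s \<tau> x = s \<sigma> x" using S by blast
        moreover have "s \<tau> \<in> carrier (Gal L' F')" using R t by blast
        ultimately show "\<tau> \<in> {\<sigma> \<in> carrier (Gal L F). s \<sigma> \<in> U}" using S'(3) t(1) by blast
      qed (use S S'(1) in auto)
    qed auto
  qed
qed


section \<open>Splittings and the group of radicals\<close>

context geometric_setting
begin

sublocale Gk: group "G_base k" by (rule Gal_group[OF C.F Ck.FL])

lemma K_N: "K \<subseteq> N" using KC_F F_N by blast

sublocale GN: group "Gal N K" by (rule Gal_group[OF N_subfield K_N])

lemma act_image_coset:
  assumes s: "\<sigma> \<in> carrier (G_base k)" and x: "x \<in> F"
  shows "act_kbarX k K \<sigma> ` coset x = coset (act_kbarX k K \<sigma> x)"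
proof -
  interpret t: field_aut F "act_kbarX k K \<sigma>" using Gal_field_aut[OF F_subfield act_kbarX(1)[OF s]] .
  interpret s: field_aut C \<sigma> using Gal_field_aut[OF C.F s] .
  have mult: "act_kbarX k K \<sigma> (c * x) = \<sigma> c * act_kbarX k K \<sigma> x" if "c \<in> C" for c
    using t.hom_mult[of c x] that KC_F x act_kbarX(2)[OF s that] by auto
  have "\<exists>d. d \<in> C \<and> d \<noteq> 0 \<and> c = \<sigma> d" if "c \<in> C" "c \<noteq> 0" for c
    using s.surj[OF that(1)] that(2) by auto
  then show ?thesis using mult by (fastforce simp: coset_def image_iff)
qed

text \<open>
  The map induced by \<open>\<sigma>\<close> on the free abelian group permutes the bilinear relations, so it preserves
  the subgroup that they generate.
\<close>
lemma act_tensor_rat: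
  assumes s: "\<sigma> \<in> carrier (G_base k)" and x: "x \<in> F" "x \<noteq> 0"
  shows "act_quot_units_rat k K \<sigma> (tensor_rat k K x q) = tensor_rat k K (act_kbarX k K \<sigma> x) q"
proof -
  let ?FA = "free_Abelian_group (carrier A \<times> carrier rat_group)"
  let ?NK = "tensor_kernel A rat_group"
  let ?R = "bilinear_relations A rat_group"
  define \<theta> where "\<theta> = act_kbarX k K \<sigma>"
  interpret t: field_aut F \<theta> using Gal_field_aut[OF F_subfield act_kbarX(1)[OF s]] by (simp add: \<theta>_def)
  have im: "\<theta> ` coset x = coset (\<theta> x)" if "x \<in> F" for x
    using act_image_coset[OF s that] by (simp add: \<theta>_def)
  define \<phi> where "\<phi> = frag_extend (\<lambda>(c, q). frag_of (\<theta> ` c, q :: rat))"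
  have \<phi>: "\<phi> (frag_of (c, q)) = frag_of (\<theta> ` c, q)" for c q by (simp add: \<phi>_def)
  have \<phi>add: "\<phi> (u + v) = \<phi> u + \<phi> v" and \<phi>diff: "\<phi> (u - v) = \<phi> u - \<phi> v" for u v
    by (simp_all add: \<phi>_def frag_extend_add frag_extend_diff)
  have car: "\<theta> ` a \<in> carrier A" if a: "a \<in> carrier A" for a
  proof -
    obtain u where u: "a = coset u" "u \<in> F" "u \<noteq> 0" using a by (auto simp: A_carrier)
    then have "\<theta> u \<in> F - {0}" by simp
    then show ?thesis using im u by (auto simp: A_carrier)
  qed
  have surj: "\<exists>a'\<in>carrier A. a = \<theta> ` a'" if a: "a \<in> carrier A" for a
  proof -
    obtain u where u: "a = coset u" "u \<in> F" "u \<noteq> 0" using a by (auto simp: A_carrier)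
    obtain v where v: "v \<in> F" "\<theta> v = u" using t.surj[OF u(2)] by blast
    then have "v \<noteq> 0" using u(3) by auto
    then show ?thesis using u v im by (intro bexI[of _ "coset v"]) (auto simp: A_carrier)
  qed
  have mult: "\<theta> ` (a \<otimes>\<^bsub>A\<^esub> a') = \<theta> ` a \<otimes>\<^bsub>A\<^esub> \<theta> ` a'" if a: "a \<in> carrier A" "a' \<in> carrier A" for a a'
  proof -
    obtain u v where uv: "a = coset u" "u \<in> F" "u \<noteq> 0" "a' = coset v" "v \<in> F" "v \<noteq> 0"
      using a by (auto simp: A_carrier)
    then show ?thesis using im A_mult[of u v] A_mult[of "\<theta> u" "\<theta> v"] by (simp add: t.hom_mult F.mult)
  qed
  have keys: "Poly_Mapping.keys (\<phi> u) \<subseteq> carrier A \<times> carrier rat_group"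
    if "Poly_Mapping.keys u \<subseteq> carrier A \<times> carrier rat_group" for u
  proof (rule frag_induction[OF that])
    show "Poly_Mapping.keys (\<phi> 0) \<subseteq> carrier A \<times> carrier rat_group" by (simp add: \<phi>_def)
    show "Poly_Mapping.keys (\<phi> (frag_of p)) \<subseteq> carrier A \<times> carrier rat_group"
      if "p \<in> carrier A \<times> carrier rat_group" for p
      using that car by (cases p) (auto simp: \<phi>)
    show "Poly_Mapping.keys (\<phi> (a - b)) \<subseteq> carrier A \<times> carrier rat_group"
      if "Poly_Mapping.keys (\<phi> a) \<subseteq> carrier A \<times> carrier rat_group"
        "Poly_Mapping.keys (\<phi> b) \<subseteq> carrier A \<times> carrier rat_group" for a b
      using keys_diff[of "\<phi> a" "\<phi> b"] that unfolding \<phi>diff by blast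
  qed
  have hom: "\<phi> \<in> hom ?FA ?FA" using keys by (intro homI) (auto simp: \<phi>add)
  interpret \<phi>: group_hom ?FA ?FA \<phi> by (intro group_hom.intro group_hom_axioms.intro group_free_Abelian_group hom)
  have "\<phi> ` ?R = ?R"
  proof
    show "\<phi> ` ?R \<subseteq> ?R"
    proof
      fix w assume "w \<in> \<phi> ` ?R"
      then obtain r where r: "r \<in> ?R" "w = \<phi> r" by blast
      from r(1) consider (l) a a' b where "a \<in> carrier A" "a' \<in> carrier A" "b \<in> carrier rat_group"
          "r = frag_of (a \<otimes>\<^bsub>A\<^esub> a', b) - frag_of (a, b) - frag_of (a', b)"
        | (r) a b b' where "a \<in> carrier A" "b \<in> carrier rat_group" "b' \<in> carrier rat_group"
          "r = frag_of (a, b \<otimes>\<^bsub>rat_group\<^esub> b') - frag_of (a, b) - frag_of (a, b')"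
        unfolding bilinear_relations_def by blast
      then show "w \<in> ?R"
      proof cases
        case l
        have "w = frag_of (\<theta> ` a \<otimes>\<^bsub>A\<^esub> \<theta> ` a', b) - frag_of (\<theta> ` a, b) - frag_of (\<theta> ` a', b)"
          unfolding r(2) l(4) \<phi>diff \<phi> mult[OF l(1,2)] ..
        then show ?thesis unfolding bilinear_relations_def using car l by blast
      next
        case r': r
        have "w = frag_of (\<theta> ` a, b \<otimes>\<^bsub>rat_group\<^esub> b') - frag_of (\<theta> ` a, b) - frag_of (\<theta> ` a, b')"
          unfolding r(2) r'(4) \<phi>diff \<phi> ..
        then show ?thesis unfolding bilinear_relations_def using car r' by blast
      qed
    qed
    show "?R \<subseteq> \<phi> ` ?R"
    proof
      fix w assume "w \<in> ?R"
      then consider (l) a a' b where "a \<in> carrier A" "a' \<in> carrier A" "b \<in> carrier rat_group"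
          "w = frag_of (a \<otimes>\<^bsub>A\<^esub> a', b) - frag_of (a, b) - frag_of (a', b)"
        | (r) a b b' where "a \<in> carrier A" "b \<in> carrier rat_group" "b' \<in> carrier rat_group"
          "w = frag_of (a, b \<otimes>\<^bsub>rat_group\<^esub> b') - frag_of (a, b) - frag_of (a, b')"
        unfolding bilinear_relations_def by blast
      then show "w \<in> \<phi> ` ?R"
      proof cases
        case l
        obtain c where c1: "c \<in> carrier A" "a = \<theta> ` c" using surj[OF l(1)] ..
        obtain c' where c2: "c' \<in> carrier A" "a' = \<theta> ` c'" using surj[OF l(2)] ..
        note c = c1 c2
        have "w = \<phi> (frag_of (c \<otimes>\<^bsub>A\<^esub> c', b) - frag_of (c, b) - frag_of (c', b))"
          unfolding l(4) \<phi>diff \<phi> mult[OF c(1,3)] c(2,4) ..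
        moreover have "frag_of (c \<otimes>\<^bsub>A\<^esub> c', b) - frag_of (c, b) - frag_of (c', b) \<in> ?R"
          unfolding bilinear_relations_def using c l by blast
        ultimately show ?thesis by blast
      next
        case r
        obtain c where c: "c \<in> carrier A" "a = \<theta> ` c" using surj[OF r(1)] ..
        have "w = \<phi> (frag_of (c, b \<otimes>\<^bsub>rat_group\<^esub> b') - frag_of (c, b) - frag_of (c, b'))"
          unfolding r(4) \<phi>diff \<phi> c(2) ..
        moreover have "frag_of (c, b \<otimes>\<^bsub>rat_group\<^esub> b') - frag_of (c, b) - frag_of (c, b') \<in> ?R"
          unfolding bilinear_relations_def using c r by blast
        ultimately show ?thesis by blast
      qed
    qed
  qed
  then have NK: "\<phi> ` ?NK = ?NK"
    using \<phi>.generate_img[OF bilinear_relations_closed[OF A_rat]] unfolding tensor_kernel_def by simp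
  have "\<phi> ` (?NK #>\<^bsub>?FA\<^esub> frag_of (coset x, q)) = \<phi> ` ?NK #>\<^bsub>?FA\<^esub> \<phi> (frag_of (coset x, q))"
    by (auto simp: r_coset_def image_UN \<phi>add)
  also have "\<dots> = ?NK #>\<^bsub>?FA\<^esub> frag_of (coset (\<theta> x), q)" by (simp only: NK \<phi> im[OF x(1)])
  finally show ?thesis
    unfolding act_quot_units_rat_def tensor_rat_eq pure_tensor_def \<phi>_def \<theta>_def .
qed

end

context geometric_setting
begin

lemma splittings_iff:
  "s \<in> splittings k K \<longleftrightarrow> s \<in> extensional (carrier (G_base k)) \<and> s \<in> hom (G_base k) (Gal N K) \<and>
     continuous_map (krull_topology C k) (krull_topology N K) s \<and>
     (\<forall>\<sigma> \<in> carrier (G_base k). restrict (s \<sigma>) C = \<sigma>)"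
  by (simp add: splittings_def kbarX_ab_eq)

lemma splitting_Gal: "s \<in> splittings k K \<Longrightarrow> \<sigma> \<in> carrier (G_base k) \<Longrightarrow> s \<sigma> \<in> carrier (Gal N K)"
  by (auto simp: splittings_iff hom_def)

lemma splitting_aut: "s \<in> splittings k K \<Longrightarrow> \<sigma> \<in> carrier (G_base k) \<Longrightarrow> field_aut N (s \<sigma>)"
  using Gal_field_aut[OF N_subfield] splitting_Gal by blast

lemma splitting_mult:
  assumes "s \<in> splittings k K" "\<sigma> \<in> carrier (G_base k)" "\<tau> \<in> carrier (G_base k)" "x \<in> N"
  shows "s (\<sigma> \<otimes>\<^bsub>G_base k\<^esub> \<tau>) x = s \<sigma> (s \<tau> x)"
proof -
  have "s \<in> hom (G_base k) (Gal N K)" using assms(1) by (simp add: splittings_iff)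
  from hom_mult[OF this assms(2,3)] show ?thesis
    using Gal_mult_apply[OF N_subfield K_N splitting_Gal[OF assms(1,2)] splitting_Gal[OF assms(1,3)] assms(4)] by simp
qed

lemma splitting_C:
  assumes "s \<in> splittings k K" "\<sigma> \<in> carrier (G_base k)" "c \<in> C" shows "s \<sigma> c = \<sigma> c"
  using assms by (auto simp: splittings_iff dest!: bspec[of _ _ \<sigma>] fun_cong[of _ _ c])

text \<open>
  Both sides fix \<open>K\<close> and act as \<open>\<sigma>\<close> on \<open>C\<close>, and these generate \<open>F\<close>.
\<close>
lemma splitting_F:
  assumes s: "s \<in> splittings k K" and \<sigma>: "\<sigma> \<in> carrier (G_base k)" and x: "x \<in> F"
  shows "s \<sigma> x = act_kbarX k K \<sigma> x"
proof -
  interpret a: field_aut N "s \<sigma>" using splitting_aut[OF s \<sigma>] .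
  interpret b: field_aut F "act_kbarX k K \<sigma>" using Gal_field_aut[OF F_subfield act_kbarX(1)[OF \<sigma>]] .
  have FN: "x \<in> N" if "x \<in> F" for x using that F_N by blast
  have "is_subring {x \<in> F. s \<sigma> x = act_kbarX k K \<sigma> x}"
    unfolding is_subring_iff
    by (auto simp: a.hom_add b.hom_add a.hom_mult b.hom_mult a.hom_uminus b.hom_uminus FN)
  moreover have "s \<sigma> x = x" "act_kbarX k K \<sigma> x = x" if "x \<in> K" for x
    using splitting_Gal[OF s \<sigma>] act_kbarX(1)[OF \<sigma>] that by (auto simp: Gal_iff)
  then have "K \<subseteq> {x \<in> F. s \<sigma> x = act_kbarX k K \<sigma> x}" using KC_F by auto
  moreover have "C \<subseteq> {x \<in> F. s \<sigma> x = act_kbarX k K \<sigma> x}"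
    using KC_F splitting_C[OF s \<sigma>] act_kbarX(2)[OF \<sigma>] by auto
  ultimately show ?thesis using F_least x by blast
qed

lemma act_F: "\<sigma> \<in> carrier (G_base k) \<Longrightarrow> x \<in> F \<Longrightarrow> act_kbarX k K \<sigma> x \<in> F"
  using field_aut.closed[OF Gal_field_aut[OF F_subfield act_kbarX(1)]] by blast

lemma splitting_M:
  assumes s: "s \<in> splittings k K" and \<sigma>: "\<sigma> \<in> carrier (G_base k)" and m: "m \<in> M"
  shows "s \<sigma> m \<in> M"
proof -
  interpret a: field_aut N "s \<sigma>" using splitting_aut[OF s \<sigma>] .
  obtain n where n: "n \<ge> 1" "m ^ n \<in> F" using M_power[OF m] .
  have "s \<sigma> m ^ n = act_kbarX k K \<sigma> (m ^ n)"
    using splitting_F[OF s \<sigma> n(2)] a.hom_power[OF M_N[OF m]] by simp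
  then have "s \<sigma> m ^ n \<in> F" using act_F[OF \<sigma> n(2)] by simp
  then show ?thesis using n(1) M_nonzero[OF m] M_N[OF m] by (auto simp: M_def)
qed

lemma splitting_inv:
  assumes s: "s \<in> splittings k K" and \<sigma>: "\<sigma> \<in> carrier (G_base k)" and x: "x \<in> N"
  shows "s \<sigma> (s (inv\<^bsub>G_base k\<^esub> \<sigma>) x) = x"
proof -
  have "s \<one>\<^bsub>G_base k\<^esub> = \<one>\<^bsub>Gal N K\<^esub>"
    using s by (intro hom_one[OF _ Gk.group_axioms GN.group_axioms]) (simp add: splittings_iff)
  then show ?thesis
    using splitting_mult[OF s \<sigma> Gk.inv_closed[OF \<sigma>] x] \<sigma> x by (simp add: Gal_one[OF N_subfield K_N])
qed

lemma splitting_bij: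
  assumes s: "s \<in> splittings k K" and \<sigma>: "\<sigma> \<in> carrier (G_base k)"
  shows "bij_betw (s \<sigma>) M M"
proof -
  interpret a: field_aut N "s \<sigma>" using splitting_aut[OF s \<sigma>] .
  have "m \<in> s \<sigma> ` M" if "m \<in> M" for m
    using splitting_inv[OF s \<sigma> M_N[OF that]] splitting_M[OF s Gk.inv_closed[OF \<sigma>] that] by (metis image_eqI)
  then show ?thesis using splitting_M[OF s \<sigma>] a.inj M_N by (auto simp: bij_betw_def inj_on_def)
qed

abbreviation R where "R \<equiv> radical_group k K"

lemma R_simps [simp]: "carrier R = M" "x \<otimes>\<^bsub>R\<^esub> y = x * y" "\<one>\<^bsub>R\<^esub> = 1"
  by (simp_all add: radical_group_eq)

lemma one_M [simp]: "1 \<in> M"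
  by (rule F_M) auto

lemma R_comm_group: "comm_group R"
proof (rule comm_groupI)
  fix x assume "x \<in> carrier R"
  then show "\<exists>y\<in>carrier R. y \<otimes>\<^bsub>R\<^esub> x = \<one>\<^bsub>R\<^esub>"
    using M_inverse[of x] M_nonzero[of x] by (intro bexI[of _ "inverse x"]) auto
qed (auto simp: mult.assoc mult.commute M_mult)

sublocale R: comm_group R by (rule R_comm_group)

lemma radical_proj_closed: "f \<in> M \<Longrightarrow> radical_proj k K f \<in> carrier V"
  using M_power[of f] radical_proj_eq[of f] tensor_rat_closed M_nonzero by (metis power_not_zero)

lemma radical_proj_hom: "radical_proj k K \<in> hom R V"
proof (rule homI)
  fix f g assume fg: "f \<in> carrier R" "g \<in> carrier R"
  then obtain n where n: "n \<ge> 1" "f ^ n \<in> F" "g ^ n \<in> F" using common_exponent[of f g] by auto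
  have nz: "f \<noteq> 0" "g \<noteq> 0" using fg M_nonzero by auto
  have "radical_proj k K (f * g) = tensor_rat k K (f ^ n * g ^ n) (1 / of_nat n)"
    using radical_proj_eq[of "f * g" n] n nz F.mult by (simp add: power_mult_distrib)
  also have "\<dots> = radical_proj k K f \<otimes>\<^bsub>V\<^esub> radical_proj k K g"
    using tensor_rat_mult[of "f ^ n" "g ^ n"] n nz radical_proj_eq[of f n] radical_proj_eq[of g n] by simp
  finally show "radical_proj k K (f \<otimes>\<^bsub>R\<^esub> g) = radical_proj k K f \<otimes>\<^bsub>V\<^esub> radical_proj k K g" by simp
qed (use radical_proj_closed in auto)

lemma radical_proj_F: "x \<in> F \<Longrightarrow> x \<noteq> 0 \<Longrightarrow> radical_proj k K x = tensor_rat k K x 1"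
  using radical_proj_eq[of x 1] by simp

lemma radical_proj_trivial_iff: "f \<in> M \<Longrightarrow> radical_proj k K f = \<one>\<^bsub>V\<^esub> \<longleftrightarrow> f \<in> C"
proof
  assume f: "f \<in> M" and triv: "radical_proj k K f = \<one>\<^bsub>V\<^esub>"
  obtain n where n: "n \<ge> 1" "f ^ n \<in> F" using M_power[OF f] .
  then show "f \<in> C"
    using tensor_rat_trivial[of "f ^ n" n f] radical_proj_eq[of f n] M_nonzero[OF f] triv by simp
next
  assume "f \<in> M" "f \<in> C"
  then show "radical_proj k K f = \<one>\<^bsub>V\<^esub>"
    using radical_proj_F[of f] tensor_rat_C[of f 1] M_nonzero KC_F by auto
qed

lemma radical_proj_surj: "v \<in> carrier V \<Longrightarrow> \<exists>f\<in>M. radical_proj k K f = v"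
proof -
  assume v: "v \<in> carrier V"
  obtain x n where x: "x \<in> F" "x \<noteq> 0" "n \<ge> 1" "v = tensor_rat k K x (1 / of_nat n)"
    by (rule V_elements[OF v])
  obtain y where y: "y ^ n = x" using nth_root_ex[OF x(3)] .
  have "y \<noteq> 0" using x y by (auto simp: power_0_left)
  then show ?thesis using x y radical_proj_eq[of y n] by (intro bexI[of _ y]) (auto simp: M_def)
qed

lemma radical_triple_simps [simp]:
  "emodule (radical_triple k K s) = R" "eincl (radical_triple k K s) x = x"
  "eproj (radical_triple k K s) = radical_proj k K" "eaction (radical_triple k K s) \<sigma> = restrict (s \<sigma>) M"
  by (simp_all add: radical_triple_def)

lemma radical_triple_is_ext_triple:
  assumes s: "s \<in> splittings k K"
  shows "is_ext_triple k K (radical_triple k K s)"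
  unfolding is_ext_triple_def
proof (intro conjI ballI)
  let ?act = "\<lambda>\<sigma>. restrict (s \<sigma>) M"
  have bij: "?act \<sigma> \<in> Bij M" if "\<sigma> \<in> carrier (G_base k)" for \<sigma>
    using splitting_bij[OF s that] by (simp add: Bij_def cong: bij_betw_cong)
  have hom: "?act \<sigma> \<in> hom R R" if \<sigma>: "\<sigma> \<in> carrier (G_base k)" for \<sigma>
  proof -
    interpret a: field_aut N "s \<sigma>" using splitting_aut[OF s \<sigma>] .
    show ?thesis using splitting_M[OF s \<sigma>] M_N M_mult by (intro homI) (auto simp: a.hom_mult)
  qed
  have "eaction (radical_triple k K s) \<in> hom (G_base k) (BijGroup M)"
  proof (rule homI)
    fix \<sigma> \<tau> assume st: "\<sigma> \<in> carrier (G_base k)" "\<tau> \<in> carrier (G_base k)"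
    show "eaction (radical_triple k K s) (\<sigma> \<otimes>\<^bsub>G_base k\<^esub> \<tau>)
      = eaction (radical_triple k K s) \<sigma> \<otimes>\<^bsub>BijGroup M\<^esub> eaction (radical_triple k K s) \<tau>"
      using bij st splitting_mult[OF s st M_N] splitting_M[OF s st(2)]
      by (auto simp: BijGroup_def compose_def fun_eq_iff)
  qed (use bij in \<open>simp add: BijGroup_def\<close>)
  moreover have "openin (krull_topology C k) {\<sigma> \<in> carrier (G_base k). ?act \<sigma> e = e}" if e: "e \<in> M" for e
    unfolding openin_krull
  proof (intro conjI ballI)
    fix \<sigma> assume "\<sigma> \<in> {\<sigma> \<in> carrier (G_base k). ?act \<sigma> e = e}"
    then have \<sigma>: "\<sigma> \<in> carrier (G_base k)" "s \<sigma> e = e" using e by auto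
    have "continuous_map (krull_topology C k) (krull_topology N K) s" using s by (simp add: splittings_iff)
    then obtain S where S: "finite S" "S \<subseteq> C"
      "\<forall>\<tau>\<in>carrier (G_base k). (\<forall>c\<in>S. \<tau> c = \<sigma> c) \<longrightarrow> s \<tau> e = s \<sigma> e"
      using M_N[OF e] \<sigma>(1) unfolding continuous_krull_iff by blast
    show "\<exists>S. finite S \<and> S \<subseteq> C \<and> (\<forall>\<tau>\<in>carrier (G_base k). (\<forall>x\<in>S. \<tau> x = \<sigma> x) \<longrightarrow>
      \<tau> \<in> {\<sigma> \<in> carrier (G_base k). ?act \<sigma> e = e})"
      using S \<sigma>(2) e by (intro exI[of _ S]) auto
  qed auto
  ultimately show "discrete_module k (emodule (radical_triple k K s)) (eaction (radical_triple k K s))"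
    unfolding discrete_module_def group_action_def
    using hom R_comm_group Gk.group_axioms group_BijGroup
    by (auto intro!: group_hom.intro group_hom_axioms.intro)
  show "eincl (radical_triple k K s) \<in> hom (units_group F) (emodule (radical_triple k K s))"
    by (rule homI) (auto intro: F_M)
  show "eproj (radical_triple k K s) \<in> hom (emodule (radical_triple k K s)) V"
    using radical_proj_hom by simp
  show "eproj (radical_triple k K s) (eincl (radical_triple k K s) x) = tensor_rat k K x 1" if "x \<in> F - {0}" for x
    using radical_proj_F that by simp
  show "inj_on (eincl (radical_triple k K s)) (C - {0})" by (simp add: inj_on_def)
  show "eincl (radical_triple k K s) ` (C - {0})
      = kernel (emodule (radical_triple k K s)) V (eproj (radical_triple k K s))"
  proof -
    have "f \<in> M \<and> radical_proj k K f = \<one>\<^bsub>V\<^esub> \<longleftrightarrow> f \<in> C - {0}" for f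
      using radical_proj_trivial_iff[of f] KC_F F_M[of f] M_nonzero[of f] by blast
    then show ?thesis unfolding kernel_def radical_triple_simps R_simps by auto
  qed
  show "eproj (radical_triple k K s) ` carrier (emodule (radical_triple k K s)) = carrier V"
    unfolding radical_triple_simps R_simps using radical_proj_surj radical_proj_closed by blast
  fix \<sigma> assume \<sigma>: "\<sigma> \<in> carrier (G_base k)"
  show "eincl (radical_triple k K s) (act_kbarX k K \<sigma> x)
      = eaction (radical_triple k K s) \<sigma> (eincl (radical_triple k K s) x)" if "x \<in> F - {0}" for x
    using splitting_F[OF s \<sigma>] that F_M by auto
  show "eproj (radical_triple k K s) (eaction (radical_triple k K s) \<sigma> e)
      = act_quot_units_rat k K \<sigma> (eproj (radical_triple k K s) e)"
    if "e \<in> carrier (emodule (radical_triple k K s))" for e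
  proof -
    interpret a: field_aut N "s \<sigma>" using splitting_aut[OF s \<sigma>] .
    have e: "e \<in> M" using that by simp
    obtain n where n: "n \<ge> 1" "e ^ n \<in> F" using M_power[OF e] .
    have "s \<sigma> e ^ n = act_kbarX k K \<sigma> (e ^ n)"
      using splitting_F[OF s \<sigma> n(2)] a.hom_power[OF M_N[OF e]] by simp
    moreover have "s \<sigma> e ^ n \<in> F" using calculation act_F[OF \<sigma> n(2)] by simp
    ultimately show ?thesis
      using radical_proj_eq[of "s \<sigma> e" n] radical_proj_eq[of e n] n act_tensor_rat[OF \<sigma> n(2)] M_nonzero
        splitting_M[OF s \<sigma> e] e by simp
  qed
qed


section \<open>Conjugate splittings and isomorphic triples\<close>

text \<open>
  The isomorphism is the restriction to \<open>M\<close> of the conjugating element \<open>g\<close>.  It is compatible with the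
  projections because \<open>g\<close> fixes \<open>m\<^sup>n \<in> F\<close>.
\<close>
lemma conjugate_imp_triple_iso:
  assumes "(s, s') \<in> conj_rel k K"
  shows "triple_iso k K (radical_triple k K s) (radical_triple k K s')"
proof -
  obtain g where s: "s \<in> splittings k K" "s' \<in> splittings k K" and g: "g \<in> carrier (Gal N F)"
    and conj: "\<And>\<sigma>. \<sigma> \<in> carrier (G_base k) \<Longrightarrow> s' \<sigma> = g \<otimes>\<^bsub>Gal N K\<^esub> s \<sigma> \<otimes>\<^bsub>Gal N K\<^esub> inv\<^bsub>Gal N K\<^esub> g"
    using assms by (auto simp: conj_rel_def kbarX_ab_eq)
  interpret g: field_aut N g using Gal_field_aut[OF N_subfield g] .
  have gF: "g x = x" if "x \<in> F" for x using g that by (simp add: Gal_iff)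
  have gK: "g \<in> carrier (Gal N K)" using g KC_F by (auto simp: Gal_iff)
  have gM: "g m \<in> M" if "m \<in> M" for m by (rule aut_on_radical(2)[OF g.field_aut_axioms gF that M_N[OF that]])
  have gpow: "\<exists>n\<ge>1. m ^ n \<in> F \<and> g m ^ n = m ^ n" if m: "m \<in> M" for m
  proof -
    obtain n where "n \<ge> 1" "m ^ n \<in> F" using M_power[OF m] .
    then show ?thesis using g.hom_power[OF M_N[OF m]] gF by metis
  qed
  have "m \<in> g ` M" if m: "m \<in> M" for m
  proof -
    obtain y where y: "y \<in> N" "g y = m" using g.surj M_N[OF m] by blast
    obtain n where n: "n \<ge> 1" "m ^ n \<in> F" using M_power[OF m] .
    have "g (y ^ n) = g (m ^ n)" using g.hom_power[OF y(1)] y(2) gF[OF n(2)] by simp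
    then have "y ^ n = m ^ n" using g.inj y(1) M_N[OF m] N.power by blast
    then show ?thesis using n y M_nonzero[OF m] by (intro image_eqI[of _ _ y]) (auto simp: M_def)
  qed
  then have "bij_betw g M M" using gM g.inj M_N by (auto simp: bij_betw_def inj_on_def)
  then have "g \<in> iso R R" using M_N by (auto simp: iso_def hom_def gM g.hom_mult)
  moreover have "g (s \<sigma> m) = s' \<sigma> (g m)" if \<sigma>: "\<sigma> \<in> carrier (G_base k)" and m: "m \<in> M" for \<sigma> m
  proof -
    note sN = splitting_Gal[OF s(1) \<sigma>]
    have "s' \<sigma> (g m) = g (s \<sigma> ((inv\<^bsub>Gal N K\<^esub> g) (g m)))"
      using Gal_mult_apply[OF N_subfield K_N] gK sN M_N[OF gM[OF m]] Gal_inv_apply[OF N_subfield K_N gK]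
      by (simp add: conj[OF \<sigma>] M_N[OF m])
    then show ?thesis using Gal_inv_apply(1)[OF N_subfield K_N gK M_N[OF m]] by simp
  qed
  moreover have "radical_proj k K (g m) = radical_proj k K m" if m: "m \<in> M" for m
  proof -
    obtain n where "n \<ge> 1" "m ^ n \<in> F" "g m ^ n = m ^ n" using gpow[OF m] by blast
    then show ?thesis using radical_proj_eq[of m n] radical_proj_eq[of "g m" n] M_nonzero m gM by metis
  qed
  ultimately show ?thesis
    unfolding triple_iso_def using gF splitting_M[OF s(1)] gM
    by (intro bexI[of _ g]) auto
qed

text \<open>
  An isomorphism of triples fixes \<open>F\<^sup>*\<close>, so by Kummer theory it is the restriction of an automorphism
  \<open>g\<close> of \<open>N\<close> over \<open>F\<close>.  That \<open>g\<close> conjugates \<open>s\<close> to \<open>s'\<close> can be checked on \<open>M\<close>, where it is equivariance.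
\<close>
lemma triple_iso_imp_conjugate:
  assumes s: "s \<in> splittings k K" "s' \<in> splittings k K"
    and iso: "triple_iso k K (radical_triple k K s) (radical_triple k K s')"
  shows "(s, s') \<in> conj_rel k K"
proof -
  obtain h where h: "h \<in> iso R R" and hF: "\<And>x. x \<in> F \<Longrightarrow> x \<noteq> 0 \<Longrightarrow> h x = x"
    and eq: "\<And>\<sigma> e. \<sigma> \<in> carrier (G_base k) \<Longrightarrow> e \<in> M \<Longrightarrow> h (restrict (s \<sigma>) M e) = restrict (s' \<sigma>) M (h e)"
    using iso by (auto simp: triple_iso_def)
  have hM: "h m \<in> M" if "m \<in> M" for m using h that by (auto simp: iso_def hom_def)
  have hs: "h (s \<sigma> m) = s' \<sigma> (h m)" if "\<sigma> \<in> carrier (G_base k)" "m \<in> M" for \<sigma> m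
    using eq[OF that] hM that by simp
  have id: "field_aut F (\<lambda>x. x)" by (rule field_aut.intro) (use F_subfield in \<open>auto simp: bij_betw_def\<close>)
  obtain g where g: "g \<in> carrier (Gal N F)" "\<And>m. m \<in> M \<Longrightarrow> g m = h m"
    by (rule kummer_extension[OF id, of h F]) (use h hF in \<open>auto simp: iso_def hom_def\<close>)
  have gK: "g \<in> carrier (Gal N K)" using g(1) KC_F by (auto simp: Gal_iff)
  have "s' \<sigma> = g \<otimes>\<^bsub>Gal N K\<^esub> s \<sigma> \<otimes>\<^bsub>Gal N K\<^esub> inv\<^bsub>Gal N K\<^esub> g" (is "_ = ?r") if \<sigma>: "\<sigma> \<in> carrier (G_base k)" for \<sigma>
  proof -
    note sG = splitting_Gal[OF s(1) \<sigma>] splitting_Gal[OF s(2) \<sigma>]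
    have rG: "?r \<in> carrier (Gal N K)" using gK sG by simp
    show ?thesis
    proof (rule Gal_eqI[OF sG(2) rG])
      fix x assume "x \<in> N"
      then show "s' \<sigma> x = ?r x"
      proof (rule hom_determined_by_M[OF splitting_aut[OF s(2) \<sigma>] Gal_field_aut[OF N_subfield rG], rotated])
        fix m assume m: "m \<in> M"
        obtain m' where m': "m' \<in> M" "m = h m'" using h m by (auto simp: iso_def bij_betw_def)
        then have inv: "(inv\<^bsub>Gal N K\<^esub> g) m = m'"
          using Gal_inv_apply(1)[OF N_subfield K_N gK M_N[OF m'(1)]] g(2) by simp
        have "?r m = g (s \<sigma> ((inv\<^bsub>Gal N K\<^esub> g) m))"
          using Gal_mult_apply[OF N_subfield K_N] gK sG M_N[OF m] Gal_inv_apply(3)[OF N_subfield K_N gK] by simp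
        also have "\<dots> = s' \<sigma> m"
          using inv hs[OF \<sigma> m'(1)] m'(2) g(2) splitting_M[OF s(1) \<sigma> m'(1)] by simp
        finally show "s' \<sigma> m = ?r m" by simp
      qed
    qed
  qed
  then show ?thesis using s g(1) by (auto simp: conj_rel_def kbarX_ab_eq)
qed

end


section \<open>From triples to splittings\<close>

locale extension_triple = geometric_setting k K for k K :: "'a::field_char_0 set" +
  fixes T :: "('a, 'e) ext_triple"
  assumes T: "is_ext_triple k K T"
begin

abbreviation E where "E \<equiv> emodule T"
abbreviation i where "i \<equiv> eincl T"
abbreviation p where "p \<equiv> eproj T"
abbreviation act where "act \<equiv> eaction T"

lemma
  shows E_comm_group: "comm_group E"
    and i_hom: "i \<in> hom (units_group F) E"
    and p_hom: "p \<in> hom E V"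
    and p_i: "x \<in> F \<Longrightarrow> x \<noteq> 0 \<Longrightarrow> p (i x) = tensor_rat k K x 1"
    and i_inj: "inj_on i (C - {0})"
    and p_kernel: "i ` (C - {0}) = kernel E V p"
    and p_surj: "p ` carrier E = carrier V"
    and i_act: "\<sigma> \<in> carrier (G_base k) \<Longrightarrow> x \<in> F \<Longrightarrow> x \<noteq> 0 \<Longrightarrow> i (act_kbarX k K \<sigma> x) = act \<sigma> (i x)"
    and act_hom: "\<sigma> \<in> carrier (G_base k) \<Longrightarrow> act \<sigma> \<in> hom E E"
    and act_group_hom: "group_hom (G_base k) (BijGroup (carrier E)) act"
    and act_open: "e \<in> carrier E \<Longrightarrow> openin (krull_topology C k) {\<sigma> \<in> carrier (G_base k). act \<sigma> e = e}"
  using T by (simp_all add: is_ext_triple_def discrete_module_def group_action_def)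

sublocale E: comm_group E by (rule E_comm_group)
sublocale p: group_hom E V p by (simp add: group_hom_def group_hom_axioms_def p_hom E.group_axioms V.group_axioms)

lemma i_closed: "x \<in> F \<Longrightarrow> x \<noteq> 0 \<Longrightarrow> i x \<in> carrier E"
  and i_mult: "x \<in> F \<Longrightarrow> x \<noteq> 0 \<Longrightarrow> y \<in> F \<Longrightarrow> y \<noteq> 0 \<Longrightarrow> i (x * y) = i x \<otimes>\<^bsub>E\<^esub> i y"
  using i_hom by (auto simp: hom_def)

lemma i_one: "i 1 = \<one>\<^bsub>E\<^esub>"
  using i_mult[of 1 1] i_closed[of 1] by simp

lemma i_power: "x \<in> F \<Longrightarrow> x \<noteq> 0 \<Longrightarrow> i (x ^ n) = i x [^]\<^bsub>E\<^esub> n"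
proof (induction n)
  case (Suc n)
  then show ?case using i_mult[of "x ^ n" x] by (simp add: F.power mult.commute)
qed (simp add: i_one)

lemma p_trivial: assumes "e \<in> carrier E" "p e = \<one>\<^bsub>V\<^esub>" obtains c where "c \<in> C" "c \<noteq> 0" "e = i c"
proof -
  have "e \<in> i ` (C - {0})" unfolding p_kernel using assms by (simp add: kernel_def)
  then show ?thesis using that by blast
qed

lemma p_i_C: "c \<in> C \<Longrightarrow> c \<noteq> 0 \<Longrightarrow> p (i c) = \<one>\<^bsub>V\<^esub>"
  using p_i[of c] tensor_rat_C[of c 1] KC_F by auto

lemma radical_proj_power: "m \<in> M \<Longrightarrow> radical_proj k K (m ^ n) = radical_proj k K m [^]\<^bsub>V\<^esub> n"
proof (induction n)
  case 0
  then show ?case using radical_proj_trivial_iff[of 1] by simp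
next
  case (Suc n)
  have "m ^ n \<in> M" using Suc.prems by (induction n) (auto intro: M_mult)
  then show ?case using hom_mult[OF radical_proj_hom, of "m ^ n" m] Suc by (simp add: mult.commute)
qed

lemma M_pow: "m \<in> M \<Longrightarrow> m ^ n \<in> M"
  by (induction n) (auto intro: M_mult)

text \<open>
  Partial homomorphisms \<open>M \<rightarrow> E\<close> over \<open>V\<close> that extend \<open>i\<close>, as graphs ordered by inclusion.  Inverses need no
  separate condition, since every element of \<open>M\<close> has a power in \<open>F\<^sup>*\<close>.
\<close>
definition partial_lift :: "('a \<times> 'e) set \<Rightarrow> bool" where
  "partial_lift G \<longleftrightarrow> G \<subseteq> M \<times> carrier E \<and> (\<forall>x\<in>F - {0}. (x, i x) \<in> G) \<and>
     (\<forall>m e m' e'. (m, e) \<in> G \<longrightarrow> (m', e') \<in> G \<longrightarrow> (m * m', e \<otimes>\<^bsub>E\<^esub> e') \<in> G) \<and>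
     (\<forall>e. (1, e) \<in> G \<longrightarrow> e = \<one>\<^bsub>E\<^esub>) \<and> (\<forall>m e. (m, e) \<in> G \<longrightarrow> p e = radical_proj k K m)"

context
  fixes G assumes G: "partial_lift G"
begin

lemma
  shows lift_M: "(m, e) \<in> G \<Longrightarrow> m \<in> M \<and> e \<in> carrier E"
    and lift_F: "x \<in> F \<Longrightarrow> x \<noteq> 0 \<Longrightarrow> (x, i x) \<in> G"
    and lift_mult: "(m, e) \<in> G \<Longrightarrow> (m', e') \<in> G \<Longrightarrow> (m * m', e \<otimes>\<^bsub>E\<^esub> e') \<in> G"
    and lift_one: "(1, e) \<in> G \<Longrightarrow> e = \<one>\<^bsub>E\<^esub>"
    and lift_p: "(m, e) \<in> G \<Longrightarrow> p e = radical_proj k K m"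
  using G by (auto simp: partial_lift_def)

lemma lift_power: "(m, e) \<in> G \<Longrightarrow> (m ^ n, e [^]\<^bsub>E\<^esub> n) \<in> G"
proof (induction n)
  case 0
  then show ?case using lift_F[of 1] i_one by simp
next
  case (Suc n)
  then show ?case using lift_mult[of "m ^ n" "e [^]\<^bsub>E\<^esub> n" m e] by (simp add: mult.commute)
qed

lemma lift_inverse: assumes me: "(m, e) \<in> G" shows "(inverse m, inv\<^bsub>E\<^esub> e) \<in> G"
proof -
  have m: "m \<in> M" "e \<in> carrier E" "m \<noteq> 0" using lift_M[OF me] M_nonzero by auto
  obtain n where n: "n \<ge> 1" "m ^ n \<in> F" using M_power[OF m(1)] .
  define x where "x = inverse (m ^ n)"
  have x: "x \<in> F" "x \<noteq> 0" using n m by (auto simp: x_def)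
  define e' where "e' = e [^]\<^bsub>E\<^esub> (n - 1) \<otimes>\<^bsub>E\<^esub> i x"
  have "(m ^ (n - 1) * x, e') \<in> G" unfolding e'_def using lift_mult[OF lift_power[OF me] lift_F[OF x]] .
  moreover have "m * m ^ (n - 1) = m ^ n" using n(1) by (simp flip: power_Suc)
  then have "m ^ (n - 1) * x = inverse m" using m(3) by (simp add: x_def field_simps)
  ultimately have inv: "(inverse m, e') \<in> G" by simp
  then have "e' \<otimes>\<^bsub>E\<^esub> e = \<one>\<^bsub>E\<^esub>" using lift_one lift_mult[OF inv me] m(3) by simp
  then have "inv\<^bsub>E\<^esub> e = e'" using E.inv_equality m(2) lift_M[OF inv] by blast
  then show ?thesis using inv by simp
qed

lemma lift_fun: assumes "(m, e) \<in> G" "(m, e') \<in> G" shows "e = e'"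
proof -
  have m: "m \<noteq> 0" "e \<in> carrier E" "e' \<in> carrier E" using lift_M assms M_nonzero by blast+
  have "e \<otimes>\<^bsub>E\<^esub> inv\<^bsub>E\<^esub> e' = \<one>\<^bsub>E\<^esub>"
    using lift_one lift_mult[OF assms(1) lift_inverse[OF assms(2)]] m(1) by simp
  then show ?thesis using m by (metis E.inv_closed E.inv_equality E.inv_inv E.r_inv)
qed

text \<open>
  If \<open>n\<close> is the order of \<open>f\<close> modulo the domain, the value at \<open>f\<close> must be an \<open>n\<close>-th root of the given
  value at \<open>f\<^sup>n\<close>.  Every \<open>e\<^sub>1\<close> over \<open>p(f)\<close> is one up to a constant from \<open>kbar\<^sup>*\<close>, which itself has an
  \<open>n\<close>-th root in \<open>kbar\<^sup>*\<close>.
\<close>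
lemma partial_lift_extend:
  assumes f: "f \<in> M"
  obtains G' e where "partial_lift G'" "G \<subseteq> G'" "(f, e) \<in> G'"
proof -
  define D where "D = fst ` G"
  have D: "m \<in> D \<longleftrightarrow> (\<exists>e. (m, e) \<in> G)" for m by (force simp: D_def)
  obtain n0 where n0: "n0 \<ge> 1" "f ^ n0 \<in> F" using M_power[OF f] .
  then have "f ^ n0 \<in> D" using lift_F[OF n0(2)] M_nonzero[OF f] D by auto
  define n where "n = (LEAST n. n \<ge> 1 \<and> f ^ n \<in> D)"
  have n: "n \<ge> 1" "f ^ n \<in> D"
    using LeastI[of "\<lambda>n. n \<ge> 1 \<and> f ^ n \<in> D" n0] n0 \<open>f ^ n0 \<in> D\<close> by (auto simp: n_def)
  have least: "n \<le> r" if "r \<ge> 1" "f ^ r \<in> D" for r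
    unfolding n_def by (rule Least_le) (use that in blast)
  obtain e0 where e0: "(f ^ n, e0) \<in> G" using n D by blast
  have e0E: "e0 \<in> carrier E" using lift_M[OF e0] by blast
  obtain e1 where e1: "e1 \<in> carrier E" "p e1 = radical_proj k K f"
    using p_surj radical_proj_closed[OF f] by (metis imageE)
  have "p (e1 [^]\<^bsub>E\<^esub> n \<otimes>\<^bsub>E\<^esub> inv\<^bsub>E\<^esub> e0) = \<one>\<^bsub>V\<^esub>"
    using e1 e0E lift_p[OF e0] radical_proj_power[OF f] radical_proj_closed[OF f] by (simp add: p.hom_nat_pow)
  then obtain c where c: "c \<in> C" "c \<noteq> 0" "e1 [^]\<^bsub>E\<^esub> n \<otimes>\<^bsub>E\<^esub> inv\<^bsub>E\<^esub> e0 = i c"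
    using p_trivial[of "e1 [^]\<^bsub>E\<^esub> n \<otimes>\<^bsub>E\<^esub> inv\<^bsub>E\<^esub> e0"] e1 e0E by (metis E.inv_closed E.m_closed E.nat_pow_closed)
  obtain d where d: "d ^ n = c" using nth_root_ex[OF n(1)] .
  have dC: "d \<in> C" "d \<noteq> 0" using root_of_C[of d n] d c n(1) by (auto simp: power_0_left)
  then have dF: "d \<in> F" using KC_F by blast
  have idE: "i d \<in> carrier E" using i_closed dF dC by blast
  define e where "e = e1 \<otimes>\<^bsub>E\<^esub> inv\<^bsub>E\<^esub> i d"
  have eE: "e \<in> carrier E" using e1 idE by (simp add: e_def)
  have pe: "p e = radical_proj k K f" using e1 idE p_i_C[OF dC] radical_proj_closed[OF f] by (simp add: e_def)
  have en: "e [^]\<^bsub>E\<^esub> n = e0"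
  proof -
    have "e [^]\<^bsub>E\<^esub> n = e1 [^]\<^bsub>E\<^esub> n \<otimes>\<^bsub>E\<^esub> inv\<^bsub>E\<^esub> i c"
      using e1 idE i_power[OF dF dC(2), of n] d by (simp add: e_def E.nat_pow_distrib E.nat_pow_inv)
    also have "i c = e1 [^]\<^bsub>E\<^esub> n \<otimes>\<^bsub>E\<^esub> inv\<^bsub>E\<^esub> e0" using c by simp
    finally show ?thesis using e1 e0E by (simp add: E.inv_mult E.m_assoc[symmetric])
  qed
  define G' where "G' = {(m * f ^ j, a \<otimes>\<^bsub>E\<^esub> e [^]\<^bsub>E\<^esub> j) | m a (j::nat). (m, a) \<in> G}"
  have "partial_lift G'"
    unfolding partial_lift_def
  proof (intro conjI allI impI ballI)
    show "G' \<subseteq> M \<times> carrier E"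
      unfolding G'_def using lift_M eE M_mult M_pow[OF f] by auto
    show "(x, i x) \<in> G'" if "x \<in> F - {0}" for x
      using that lift_F[of x] i_closed[of x] unfolding G'_def
      by (auto intro!: exI[of _ x] exI[of _ "i x"] exI[of _ "0::nat"])
    show "p b = radical_proj k K m" if "(m, b) \<in> G'" for m b
    proof -
      obtain m' a j where *: "(m', a) \<in> G" "m = m' * f ^ j" "b = a \<otimes>\<^bsub>E\<^esub> e [^]\<^bsub>E\<^esub> j"
        using \<open>(m, b) \<in> G'\<close> unfolding G'_def by blast
      have "radical_proj k K m = radical_proj k K m' \<otimes>\<^bsub>V\<^esub> radical_proj k K f [^]\<^bsub>V\<^esub> j"
        using hom_mult[OF radical_proj_hom, of m' "f ^ j"] lift_M[OF *(1)] M_pow[OF f] radical_proj_power[OF f] *(2) by simp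
      then show ?thesis using *(3) lift_M[OF *(1)] lift_p[OF *(1)] eE pe by (simp add: p.hom_nat_pow)
    qed
    show "b = \<one>\<^bsub>E\<^esub>" if b: "(1, b) \<in> G'" for b
    proof -
      obtain m a j where *: "(m, a) \<in> G" "1 = m * f ^ j" "b = a \<otimes>\<^bsub>E\<^esub> e [^]\<^bsub>E\<^esub> j"
        using b unfolding G'_def by blast
      have m: "m \<in> M" "a \<in> carrier E" using lift_M[OF *(1)] by auto
      \<comment> \<open>\<open>f\<^sup>j\<close> is in the domain, so \<open>j\<close> is a multiple of the order \<open>n\<close> of \<open>f\<close>.\<close>
      define q r where "q = j div n" and "r = j mod n"
      have j: "j = n * q + r" by (simp add: q_def r_def)
      have fnz: "f \<noteq> 0" using M_nonzero[OF f] .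
      have "f ^ j = inverse m" using *(2) M_nonzero[OF m(1)] by (simp add: field_simps)
      then have "f ^ r * (f ^ n) ^ q = inverse m" by (simp add: j power_add power_mult mult.commute)
      then have "f ^ r = inverse m * inverse ((f ^ n) ^ q)"
        using fnz by (metis mult.assoc mult.right_neutral power_not_zero right_inverse)
      moreover have "(inverse m * inverse ((f ^ n) ^ q), inv\<^bsub>E\<^esub> a \<otimes>\<^bsub>E\<^esub> inv\<^bsub>E\<^esub> (e0 [^]\<^bsub>E\<^esub> q)) \<in> G"
        by (intro lift_mult lift_inverse lift_power e0 *(1))
      ultimately have "f ^ r \<in> D" using D by auto
      moreover have "r < n" using n(1) by (simp add: r_def)
      ultimately have "r = 0" using least[of r] by (cases "r = 0") auto
      then have j: "j = n * q" using j by simp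
      have "(m * (f ^ n) ^ q, a \<otimes>\<^bsub>E\<^esub> e0 [^]\<^bsub>E\<^esub> q) \<in> G" by (intro lift_mult lift_power e0 *(1))
      moreover have "m * (f ^ n) ^ q = 1" using *(2) by (simp add: j power_mult)
      ultimately have "a \<otimes>\<^bsub>E\<^esub> e0 [^]\<^bsub>E\<^esub> q = \<one>\<^bsub>E\<^esub>" using lift_one by simp
      moreover have "e [^]\<^bsub>E\<^esub> j = e0 [^]\<^bsub>E\<^esub> q" unfolding j using E.nat_pow_pow[OF eE, of n q] en by simp
      ultimately show ?thesis using *(3) by simp
    qed
    fix m b m' b' assume "(m, b) \<in> G'" "(m', b') \<in> G'"
    then obtain u a j u' a' j' where *: "(u, a) \<in> G" "m = u * f ^ j" "b = a \<otimes>\<^bsub>E\<^esub> e [^]\<^bsub>E\<^esub> j"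
      "(u', a') \<in> G" "m' = u' * f ^ j'" "b' = a' \<otimes>\<^bsub>E\<^esub> e [^]\<^bsub>E\<^esub> j'" unfolding G'_def by blast
    have "m * m' = (u * u') * f ^ (j + j')" using * by (simp add: power_add mult_ac)
    moreover have "b \<otimes>\<^bsub>E\<^esub> b' = (a \<otimes>\<^bsub>E\<^esub> a') \<otimes>\<^bsub>E\<^esub> e [^]\<^bsub>E\<^esub> (j + j')"
      using *(3,6) lift_M[OF *(1)] lift_M[OF *(4)] eE by (simp add: E.nat_pow_mult[symmetric] E.m_ac)
    ultimately show "(m * m', b \<otimes>\<^bsub>E\<^esub> b') \<in> G'" unfolding G'_def using lift_mult[OF *(1,4)] by blast
  qed
  moreover have "G \<subseteq> G'"
  proof
    fix g assume "g \<in> G"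
    then obtain m a where g: "g = (m, a)" "(m, a) \<in> G" by (cases g) auto
    then have "g = (m * f ^ 0, a \<otimes>\<^bsub>E\<^esub> e [^]\<^bsub>E\<^esub> (0::nat))" using lift_M[OF g(2)] by simp
    then show "g \<in> G'" unfolding G'_def using g(2) by blast
  qed
  moreover have "(1, \<one>\<^bsub>E\<^esub>) \<in> G" using lift_F[of 1] i_one by simp
  then have "(f, e) \<in> G'" unfolding G'_def mem_Collect_eq
    by (intro exI[of _ 1] exI[of _ "\<one>\<^bsub>E\<^esub>"] exI[of _ "1::nat"]) (use eE in simp)
  ultimately show ?thesis using that by blast
qed

end

lemma partial_lift_ex: "partial_lift {(x, i x) | x. x \<in> F \<and> x \<noteq> 0}"
  unfolding partial_lift_def
  using i_closed i_mult i_one F_M radical_proj_F p_i F.mult by auto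

text \<open>
  A maximal partial lift is defined on all of \<open>M\<close>.  It is bijective by the five lemma, because \<open>M\<close> and \<open>E\<close>
  are both extensions of \<open>V\<close> by \<open>C\<^sup>*\<close>.
\<close>
lemma comparison_iso:
  obtains h where "h \<in> iso R E" "\<And>x. x \<in> F \<Longrightarrow> x \<noteq> 0 \<Longrightarrow> h x = i x"
    "\<And>m. m \<in> M \<Longrightarrow> p (h m) = radical_proj k K m"
proof -
  define P where "P = {G. partial_lift G}"
  have "\<exists>G\<in>P. \<forall>H\<in>P. G \<subseteq> H \<longrightarrow> H = G"
  proof (rule subset_Zorn_nonempty)
    show "P \<noteq> {}" using partial_lift_ex by (auto simp: P_def)
    fix Ch assume C: "Ch \<noteq> {}" "subset.chain P Ch"
    have emb: "partial_lift G" if "G \<in> Ch" for G using C that by (auto simp: subset.chain_def P_def)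
    have two: "\<exists>G\<in>Ch. u \<in> G \<and> v \<in> G" if uv: "u \<in> \<Union>Ch" "v \<in> \<Union>Ch" for u v
    proof -
      obtain G H where GH: "G \<in> Ch" "u \<in> G" "H \<in> Ch" "v \<in> H" using uv by blast
      then have "G \<subseteq> H \<or> H \<subseteq> G" using C(2) by (auto simp: subset.chain_def)
      then show ?thesis using GH by blast
    qed
    have "partial_lift (\<Union>Ch)"
      unfolding partial_lift_def
    proof (intro conjI allI impI ballI)
      show "\<Union>Ch \<subseteq> M \<times> carrier E" using emb unfolding partial_lift_def by blast
      show "(x, i x) \<in> \<Union>Ch" if "x \<in> F - {0}" for x using emb C(1) that unfolding partial_lift_def by blast
      show "e = \<one>\<^bsub>E\<^esub>" if "(1, e) \<in> \<Union>Ch" for e using emb that lift_one by blast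
      show "p e = radical_proj k K m" if "(m, e) \<in> \<Union>Ch" for m e using emb that lift_p by blast
      fix m e m' e' assume "(m, e) \<in> \<Union>Ch" "(m', e') \<in> \<Union>Ch"
      then obtain G where "G \<in> Ch" "(m, e) \<in> G" "(m', e') \<in> G" using two by blast
      then show "(m * m', e \<otimes>\<^bsub>E\<^esub> e') \<in> \<Union>Ch" using emb lift_mult by blast
    qed
    then show "\<Union>Ch \<in> P" by (simp add: P_def)
  qed
  then obtain G where G: "partial_lift G" and max: "\<And>H. partial_lift H \<Longrightarrow> G \<subseteq> H \<Longrightarrow> H = G"
    by (auto simp: P_def)
  have ex: "\<exists>e. (m, e) \<in> G" if m: "m \<in> M" for m
  proof -
    obtain G' e where "partial_lift G'" "G \<subseteq> G'" "(m, e) \<in> G'" by (rule partial_lift_extend[OF G m])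
    then show ?thesis using max by blast
  qed
  define h where "h m = (SOME e. (m, e) \<in> G)" for m
  have h: "(m, h m) \<in> G" if "m \<in> M" for m using someI_ex[OF ex[OF that]] by (simp add: h_def)
  have hG: "h m = e" if "(m, e) \<in> G" for m e
    using that lift_fun[OF G h that] lift_M[OF G that] by blast
  have hE: "h m \<in> carrier E" if "m \<in> M" for m using lift_M[OF G h[OF that]] by blast
  have hmult: "h (m * m') = h m \<otimes>\<^bsub>E\<^esub> h m'" if "m \<in> M" "m' \<in> M" for m m'
    using hG lift_mult[OF G h h] that by blast
  have hF: "h x = i x" if "x \<in> F" "x \<noteq> 0" for x using hG lift_F[OF G that] by blast
  have hp: "p (h m) = radical_proj k K m" if "m \<in> M" for m using lift_p[OF G h[OF that]] .
  have "inj_on h M"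
  proof (rule inj_onI)
    fix m m' assume mm: "m \<in> M" "m' \<in> M" "h m = h m'"
    have nz: "m \<noteq> 0" "m' \<noteq> 0" using mm M_nonzero by auto
    have q: "m / m' \<in> M" using mm M_divide by blast
    have "h (m / m') \<otimes>\<^bsub>E\<^esub> h m' = h m" using hmult[OF q mm(2)] nz by simp
    then have one: "h (m / m') = \<one>\<^bsub>E\<^esub>" using mm(3) hE[OF q] hE[OF mm(2)] by (simp add: E.r_cancel_one)
    then have "m / m' \<in> C" using radical_proj_trivial_iff[OF q] hp[OF q] by simp
    moreover have "i (m / m') = i 1" using one hF[of "m / m'"] nz calculation KC_F i_one by auto
    ultimately have "m / m' = 1" using inj_onD[OF i_inj, of "m / m'" 1] nz by simp
    then show "m = m'" using nz by simp
  qed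
  moreover have "\<exists>m\<in>M. h m = e" if e: "e \<in> carrier E" for e
  proof -
    obtain m where m: "m \<in> M" "radical_proj k K m = p e" using radical_proj_surj p.hom_closed[OF e] by blast
    have "p (e \<otimes>\<^bsub>E\<^esub> inv\<^bsub>E\<^esub> h m) = \<one>\<^bsub>V\<^esub>" using e hE[OF m(1)] hp[OF m(1)] m(2) by simp
    then obtain c where c: "c \<in> C" "c \<noteq> 0" "e \<otimes>\<^bsub>E\<^esub> inv\<^bsub>E\<^esub> h m = i c"
      using p_trivial[of "e \<otimes>\<^bsub>E\<^esub> inv\<^bsub>E\<^esub> h m"] e hE[OF m(1)] by (metis E.inv_closed E.m_closed)
    have cF: "c \<in> F" using c KC_F by blast
    have "h (c * m) = (e \<otimes>\<^bsub>E\<^esub> inv\<^bsub>E\<^esub> h m) \<otimes>\<^bsub>E\<^esub> h m"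
      using hmult[OF F_M[OF cF c(2)] m(1)] hF[OF cF c(2)] c(3) by simp
    also have "\<dots> = e" using e hE[OF m(1)] by (simp add: E.m_assoc)
    finally show ?thesis using M_mult[OF F_M[OF cF c(2)] m(1)] by blast
  qed
  ultimately have "bij_betw h M (carrier E)" using hE by (auto simp: bij_betw_def)
  then have "h \<in> iso R E" using hE hmult by (auto simp: iso_def hom_def)
  then show ?thesis using that hF hp by blast
qed

lemma act_closed: "\<sigma> \<in> carrier (G_base k) \<Longrightarrow> e \<in> carrier E \<Longrightarrow> act \<sigma> e \<in> carrier E"
  using act_hom by (auto simp: hom_def)

lemma act_mult:
  assumes "\<sigma> \<in> carrier (G_base k)" "\<tau> \<in> carrier (G_base k)" "e \<in> carrier E"
  shows "act (\<sigma> \<otimes>\<^bsub>G_base k\<^esub> \<tau>) e = act \<sigma> (act \<tau> e)"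
proof -
  interpret a: group_hom "G_base k" "BijGroup (carrier E)" act by (rule act_group_hom)
  have "act \<sigma> \<in> Bij (carrier E)" "act \<tau> \<in> Bij (carrier E)"
    using a.hom_closed[OF assms(1)] a.hom_closed[OF assms(2)] by (simp_all add: BijGroup_def)
  then show ?thesis using a.hom_mult[OF assms(1,2)] assms(3) by (simp add: BijGroup_def compose_def)
qed

lemma act_bij: assumes "\<sigma> \<in> carrier (G_base k)" shows "bij_betw (act \<sigma>) (carrier E) (carrier E)"
proof -
  interpret a: group_hom "G_base k" "BijGroup (carrier E)" act by (rule act_group_hom)
  show ?thesis using a.hom_closed[OF assms] by (simp add: BijGroup_def Bij_def)
qed

text \<open>
  The stabiliser of \<open>e\<close> contains a basic neighbourhood of the identity; translate it by \<open>\<sigma>\<close>.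
\<close>
lemma act_locally_constant:
  assumes \<sigma>: "\<sigma> \<in> carrier (G_base k)" and e: "e \<in> carrier E"
  obtains S where "finite S" "S \<subseteq> C"
    "\<And>\<tau>. \<tau> \<in> carrier (G_base k) \<Longrightarrow> (\<And>c. c \<in> S \<Longrightarrow> \<tau> c = \<sigma> c) \<Longrightarrow> act \<tau> e = act \<sigma> e"
proof -
  interpret a: group_hom "G_base k" "BijGroup (carrier E)" act by (rule act_group_hom)
  have one: "\<one>\<^bsub>G_base k\<^esub> \<in> {\<sigma> \<in> carrier (G_base k). act \<sigma> e = e}"
    using a.hom_one e by (simp add: BijGroup_def)
  obtain S where S: "finite S" "S \<subseteq> C"
    "\<And>\<tau>. \<tau> \<in> carrier (G_base k) \<Longrightarrow> (\<forall>c\<in>S. \<tau> c = \<one>\<^bsub>G_base k\<^esub> c) \<Longrightarrow> \<tau> \<in> {\<sigma> \<in> carrier (G_base k). act \<sigma> e = e}"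
    using bspec[OF conjunct2[OF act_open[OF e, unfolded openin_krull]] one] by blast
  have "act \<tau> e = act \<sigma> e" if t: "\<tau> \<in> carrier (G_base k)" "\<And>c. c \<in> S \<Longrightarrow> \<tau> c = \<sigma> c" for \<tau>
  proof -
    let ?r = "inv\<^bsub>G_base k\<^esub> \<sigma> \<otimes>\<^bsub>G_base k\<^esub> \<tau>"
    have r: "?r \<in> carrier (G_base k)" using \<sigma> t by simp
    have "?r c = \<one>\<^bsub>G_base k\<^esub> c" if "c \<in> S" for c
    proof -
      have c: "c \<in> C" using that S(2) by blast
      have "?r c = (inv\<^bsub>G_base k\<^esub> \<sigma>) (\<sigma> c)"
        using Gal_mult_apply[OF C.F Ck.FL Gk.inv_closed[OF \<sigma>] t(1) c] t(2)[OF that] by simp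
      then show ?thesis using Gal_inv_apply(1)[OF C.F Ck.FL \<sigma> c] c by (simp add: Gal_one[OF C.F Ck.FL])
    qed
    then have "act ?r e = e" using S(3)[OF r] by blast
    moreover have "\<sigma> \<otimes>\<^bsub>G_base k\<^esub> ?r = \<tau>" using \<sigma> t(1) by (simp flip: Gk.m_assoc)
    ultimately show ?thesis using act_mult[OF \<sigma> r e] by simp
  qed
  then show ?thesis using that S(1,2) by blast
qed

text \<open>
  Transport the action on \<open>E\<close> to \<open>M\<close> along the comparison isomorphism.  On \<open>F\<^sup>*\<close> it becomes the natural
  action, so each transported automorphism extends to a field automorphism of \<open>N\<close> over \<open>K\<close>, and
  these form a splitting, because they are determined by their values on \<open>M\<close>.  Continuity holds
  because each element of \<open>N\<close> is a sum of finitely many elements of \<open>M\<close>, whose stabilisers are open.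
\<close>
lemma ext_triple_from_splitting:
  obtains s where "s \<in> splittings k K" "triple_iso k K (radical_triple k K s) T"
proof -
  obtain h where h: "h \<in> iso R E" and hF: "\<And>x. x \<in> F \<Longrightarrow> x \<noteq> 0 \<Longrightarrow> h x = i x"
    and hp: "\<And>m. m \<in> M \<Longrightarrow> p (h m) = radical_proj k K m" by (rule comparison_iso) blast
  have hbij: "bij_betw h M (carrier E)" and hmult: "\<And>m m'. m \<in> M \<Longrightarrow> m' \<in> M \<Longrightarrow> h (m * m') = h m \<otimes>\<^bsub>E\<^esub> h m'"
    using h by (auto simp: iso_def hom_def)
  have hE: "h m \<in> carrier E" if "m \<in> M" for m using hbij that by (auto simp: bij_betw_def)
  define h' where "h' = inv_into M h"
  have h': "h' e \<in> M" "h (h' e) = e" if "e \<in> carrier E" for e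
    using hbij that by (auto simp: h'_def bij_betw_def inv_into_into f_inv_into_f)
  have h'h: "h' (h m) = m" if "m \<in> M" for m using hbij that by (simp add: h'_def bij_betw_inv_into_left)
  define \<rho> where "\<rho> \<sigma> m = h' (act \<sigma> (h m))" for \<sigma> m
  have \<rho>M: "\<rho> \<sigma> m \<in> M" and h\<rho>: "h (\<rho> \<sigma> m) = act \<sigma> (h m)" if "\<sigma> \<in> carrier (G_base k)" "m \<in> M" for \<sigma> m
    using h' act_closed hE that by (simp_all add: \<rho>_def)
  have hinj: "m = m'" if "m \<in> M" "m' \<in> M" "h m = h m'" for m m' using h'h that by metis
  have \<rho>F: "\<rho> \<sigma> x = act_kbarX k K \<sigma> x" if \<sigma>: "\<sigma> \<in> carrier (G_base k)" and x: "x \<in> F" "x \<noteq> 0" for \<sigma> x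
  proof -
    interpret b: field_aut F "act_kbarX k K \<sigma>" using Gal_field_aut[OF F_subfield act_kbarX(1)[OF \<sigma>]] .
    have nz: "act_kbarX k K \<sigma> x \<in> F" "act_kbarX k K \<sigma> x \<noteq> 0" using x by auto
    have "h (\<rho> \<sigma> x) = h (act_kbarX k K \<sigma> x)"
      using h\<rho>[OF \<sigma> F_M[OF x]] hF[OF x] i_act[OF \<sigma> x] hF[OF nz] by simp
    then show ?thesis using hinj \<rho>M[OF \<sigma> F_M[OF x]] F_M[OF nz] by blast
  qed
  have "\<exists>\<theta>. \<theta> \<in> carrier (Gal N K) \<and> (\<forall>m\<in>M. \<theta> m = \<rho> \<sigma> m)" if \<sigma>: "\<sigma> \<in> carrier (G_base k)" for \<sigma>
  proof -
    have aut: "field_aut F (act_kbarX k K \<sigma>)" using Gal_field_aut[OF F_subfield act_kbarX(1)[OF \<sigma>]] .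
    have "\<rho> \<sigma> (f * g) = \<rho> \<sigma> f * \<rho> \<sigma> g" if fg: "f \<in> M" "g \<in> M" for f g
    proof (rule hinj)
      show "h (\<rho> \<sigma> (f * g)) = h (\<rho> \<sigma> f * \<rho> \<sigma> g)"
        using fg \<sigma> by (simp add: h\<rho> hmult M_mult \<rho>M hom_mult[OF act_hom[OF \<sigma>]] hE)
    qed (use fg \<sigma> \<rho>M M_mult in auto)
    moreover have "bij_betw (\<rho> \<sigma>) M M"
    proof -
      have "bij_betw (h' \<circ> (act \<sigma> \<circ> h)) M M"
        unfolding h'_def
        by (rule bij_betw_trans[OF bij_betw_trans[OF hbij act_bij[OF \<sigma>]] bij_betw_inv_into[OF hbij]])
      then show ?thesis by (simp add: \<rho>_def[abs_def] o_def)
    qed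
    moreover have "act_kbarX k K \<sigma> x = x" if "x \<in> K" for x
      using act_kbarX(1)[OF \<sigma>] that by (simp add: Gal_iff)
    ultimately obtain \<theta> where "\<theta> \<in> carrier (Gal N K)" "\<And>m. m \<in> M \<Longrightarrow> \<theta> m = \<rho> \<sigma> m"
      using kummer_extension[OF aut, of "\<rho> \<sigma>" K] \<rho>F[OF \<sigma>] KC_F(1) by metis
    then show ?thesis by blast
  qed
  then obtain \<theta> where \<theta>: "\<And>\<sigma>. \<sigma> \<in> carrier (G_base k) \<Longrightarrow> \<theta> \<sigma> \<in> carrier (Gal N K)"
    "\<And>\<sigma> m. \<sigma> \<in> carrier (G_base k) \<Longrightarrow> m \<in> M \<Longrightarrow> \<theta> \<sigma> m = \<rho> \<sigma> m" by metis
  have aut: "field_aut N (\<theta> \<sigma>)" if "\<sigma> \<in> carrier (G_base k)" for \<sigma>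
    using Gal_field_aut[OF N_subfield \<theta>(1)[OF that]] .
  define s where "s = restrict \<theta> (carrier (G_base k))"
  have s: "s \<sigma> = \<theta> \<sigma>" if "\<sigma> \<in> carrier (G_base k)" for \<sigma> using that by (simp add: s_def)
  have hom: "s \<in> hom (G_base k) (Gal N K)"
  proof (rule homI)
    fix \<sigma> \<tau> assume st: "\<sigma> \<in> carrier (G_base k)" "\<tau> \<in> carrier (G_base k)"
    note st' = Gk.m_closed[OF st]
    have r: "\<theta> \<sigma> \<otimes>\<^bsub>Gal N K\<^esub> \<theta> \<tau> \<in> carrier (Gal N K)" using \<theta>(1) st by blast
    have "\<theta> (\<sigma> \<otimes>\<^bsub>G_base k\<^esub> \<tau>) = \<theta> \<sigma> \<otimes>\<^bsub>Gal N K\<^esub> \<theta> \<tau>"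
    proof (rule Gal_eqI[OF \<theta>(1)[OF st'] r])
      fix x assume "x \<in> N"
      then show "\<theta> (\<sigma> \<otimes>\<^bsub>G_base k\<^esub> \<tau>) x = (\<theta> \<sigma> \<otimes>\<^bsub>Gal N K\<^esub> \<theta> \<tau>) x"
      proof (rule hom_determined_by_M[OF aut[OF st'] Gal_field_aut[OF N_subfield r], rotated])
        fix m assume m: "m \<in> M"
        have "\<rho> (\<sigma> \<otimes>\<^bsub>G_base k\<^esub> \<tau>) m = \<rho> \<sigma> (\<rho> \<tau> m)"
        proof (rule hinj)
          show "h (\<rho> (\<sigma> \<otimes>\<^bsub>G_base k\<^esub> \<tau>) m) = h (\<rho> \<sigma> (\<rho> \<tau> m))"
            by (simp add: h\<rho> st st' m \<rho>M act_mult[OF st hE[OF m]])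
        qed (use \<rho>M st st' m in auto)
        then show "\<theta> (\<sigma> \<otimes>\<^bsub>G_base k\<^esub> \<tau>) m = (\<theta> \<sigma> \<otimes>\<^bsub>Gal N K\<^esub> \<theta> \<tau>) m"
          using Gal_mult_apply[OF N_subfield K_N \<theta>(1)[OF st(1)] \<theta>(1)[OF st(2)] M_N[OF m]]
          by (simp add: \<theta>(2) st st' m \<rho>M)
      qed
    qed
    then show "s (\<sigma> \<otimes>\<^bsub>G_base k\<^esub> \<tau>) = s \<sigma> \<otimes>\<^bsub>Gal N K\<^esub> s \<tau>" by (simp add: s st st')
  qed (simp add: s \<theta>(1))
  have cont: "continuous_map (krull_topology C k) (krull_topology N K) s"
    unfolding continuous_krull_iff
  proof (intro conjI ballI)
    show "s ` carrier (G_base k) \<subseteq> carrier (Gal N K)" using s \<theta>(1) by auto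
    fix \<sigma> x assume \<sigma>: "\<sigma> \<in> carrier (G_base k)" and "x \<in> N"
    then obtain ms where ms: "x = sum_list ms" "set ms \<subseteq> M" by (auto simp: N_def)
    have "\<exists>S. finite S \<and> S \<subseteq> C \<and> (\<forall>\<tau>\<in>carrier (G_base k). (\<forall>c\<in>S. \<tau> c = \<sigma> c) \<longrightarrow> act \<tau> (h m) = act \<sigma> (h m))"
      if m: "m \<in> set ms" for m
    proof -
      have "h m \<in> carrier E" using hE ms m by blast
      from act_locally_constant[OF \<sigma> this] show ?thesis by metis
    qed
    then obtain S where S: "\<And>m. m \<in> set ms \<Longrightarrow> finite (S m) \<and> S m \<subseteq> C \<and>
        (\<forall>\<tau>\<in>carrier (G_base k). (\<forall>c\<in>S m. \<tau> c = \<sigma> c) \<longrightarrow> act \<tau> (h m) = act \<sigma> (h m))" by metis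
    show "\<exists>S. finite S \<and> S \<subseteq> C \<and> (\<forall>\<tau>\<in>carrier (G_base k). (\<forall>c\<in>S. \<tau> c = \<sigma> c) \<longrightarrow> s \<tau> x = s \<sigma> x)"
    proof (intro exI[of _ "\<Union>m\<in>set ms. S m"] conjI ballI impI)
      fix \<tau> assume \<tau>: "\<tau> \<in> carrier (G_base k)" and agree: "\<forall>c\<in>\<Union>m\<in>set ms. S m. \<tau> c = \<sigma> c"
      have msN: "set ms \<subseteq> N" using ms(2) M_N by auto
      have eq: "map (\<theta> \<tau>) ms = map (\<theta> \<sigma>) ms"
      proof (rule map_cong[OF refl])
        fix m assume m: "m \<in> set ms"
        then have "act \<tau> (h m) = act \<sigma> (h m)" using S[OF m] \<tau> agree by blast
        then show "\<theta> \<tau> m = \<theta> \<sigma> m" using \<theta>(2) \<tau> \<sigma> m ms(2) by (auto simp: \<rho>_def)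
      qed
      show "s \<tau> x = s \<sigma> x"
        using field_aut.hom_sum_list[OF aut[OF \<tau>] msN] field_aut.hom_sum_list[OF aut[OF \<sigma>] msN]
        by (simp only: s \<tau> \<sigma> ms(1) eq)
    qed (use S in auto)
  qed
  have "restrict (s \<sigma>) C = \<sigma>" if \<sigma>: "\<sigma> \<in> carrier (G_base k)" for \<sigma>
  proof (rule extensionalityI[of _ C])
    show "\<sigma> \<in> extensional C" using \<sigma> by (simp add: Gal_iff)
    fix c assume c: "c \<in> C"
    interpret a: field_aut N "\<theta> \<sigma>" by (rule aut[OF \<sigma>])
    interpret b: field_aut C \<sigma> using Gal_field_aut[OF C.F \<sigma>] .
    have "\<theta> \<sigma> c = \<sigma> c"
    proof (cases "c = 0")
      case False
      have cF: "c \<in> F" using c KC_F by blast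
      show ?thesis using \<theta>(2)[OF \<sigma> F_M[OF cF False]] \<rho>F[OF \<sigma> cF False] act_kbarX(2)[OF \<sigma> c] by simp
    qed simp
    then show "restrict (s \<sigma>) C c = \<sigma> c" using c by (simp add: s \<sigma>)
  qed simp
  then have "s \<in> splittings k K" using hom cont by (simp add: splittings_iff s_def)
  moreover have "triple_iso k K (radical_triple k K s) T"
    unfolding triple_iso_def
  proof (intro bexI[of _ h] conjI ballI)
    show "h \<in> iso (emodule (radical_triple k K s)) E" using h by simp
    show "h (eaction (radical_triple k K s) \<sigma> e) = act \<sigma> (h e)"
      if "\<sigma> \<in> carrier (G_base k)" "e \<in> carrier (emodule (radical_triple k K s))" for \<sigma> e
      using that s \<theta>(2) h\<rho> by simp
    show "h (eincl (radical_triple k K s) x) = i x" if "x \<in> F - {0}" for x using hF that by simp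
    show "p (h e) = eproj (radical_triple k K s) e" if "e \<in> carrier (emodule (radical_triple k K s))" for e
      using hp that by simp
  qed
  ultimately show ?thesis using that by blast
qed

end


section \<open>The correspondence\<close>

context geometric_setting
begin

lemma triple_iso_refl: "triple_iso k K T T"
  unfolding triple_iso_def by (intro bexI[of _ "\<lambda>x. x"]) (auto intro: iso_set_refl)

lemma triple_iso_trans:
  assumes "triple_iso k K T T'" "triple_iso k K T' T''"
  shows "triple_iso k K T T''"
proof -
  obtain h where h: "h \<in> iso (emodule T) (emodule T')"
    "\<And>\<sigma> e. \<sigma> \<in> carrier (G_base k) \<Longrightarrow> e \<in> carrier (emodule T) \<Longrightarrow> h (eaction T \<sigma> e) = eaction T' \<sigma> (h e)"
    "\<And>x. x \<in> F - {0} \<Longrightarrow> h (eincl T x) = eincl T' x"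
    "\<And>e. e \<in> carrier (emodule T) \<Longrightarrow> eproj T' (h e) = eproj T e"
    using assms(1) by (auto simp: triple_iso_def)
  obtain g where g: "g \<in> iso (emodule T') (emodule T'')"
    "\<And>\<sigma> e. \<sigma> \<in> carrier (G_base k) \<Longrightarrow> e \<in> carrier (emodule T') \<Longrightarrow> g (eaction T' \<sigma> e) = eaction T'' \<sigma> (g e)"
    "\<And>x. x \<in> F - {0} \<Longrightarrow> g (eincl T' x) = eincl T'' x"
    "\<And>e. e \<in> carrier (emodule T') \<Longrightarrow> eproj T'' (g e) = eproj T' e"
    using assms(2) by (auto simp: triple_iso_def)
  have "g \<circ> h \<in> iso (emodule T) (emodule T'')" using iso_set_trans[OF h(1) g(1)] by (simp add: comp_def)
  moreover have "h e \<in> carrier (emodule T')" if "e \<in> carrier (emodule T)" for e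
    using h(1) that by (auto simp: iso_def hom_def)
  ultimately show ?thesis unfolding triple_iso_def
    using h g by (intro bexI[of _ "g \<circ> h"]) auto
qed

lemma triple_iso_sym:
  assumes T: "is_ext_triple k K T" and iso: "triple_iso k K T T'"
  shows "triple_iso k K T' T"
proof -
  obtain h where h: "h \<in> iso (emodule T) (emodule T')"
    and hact: "\<And>\<sigma> e. \<sigma> \<in> carrier (G_base k) \<Longrightarrow> e \<in> carrier (emodule T) \<Longrightarrow> h (eaction T \<sigma> e) = eaction T' \<sigma> (h e)"
    and hincl: "\<And>x. x \<in> F - {0} \<Longrightarrow> h (eincl T x) = eincl T' x"
    and hproj: "\<And>e. e \<in> carrier (emodule T) \<Longrightarrow> eproj T' (h e) = eproj T e"
    using iso by (auto simp: triple_iso_def)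
  interpret T: extension_triple k K T
    by (intro extension_triple.intro extension_triple_axioms.intro geometric_setting_axioms T)
  define g where "g = inv_into (carrier (emodule T)) h"
  have bij: "bij_betw h (carrier (emodule T)) (carrier (emodule T'))" using h by (simp add: iso_def)
  have gh: "g (h e) = e" if "e \<in> carrier (emodule T)" for e
    using bij that by (simp add: g_def bij_betw_inv_into_left)
  have hg: "g e \<in> carrier (emodule T)" "h (g e) = e" if "e \<in> carrier (emodule T')" for e
    using bij that by (auto simp: g_def bij_betw_def inv_into_into f_inv_into_f)
  have "g \<in> iso (emodule T') (emodule T)" unfolding g_def by (rule T.E.iso_set_sym[OF h])
  moreover have "g (eaction T' \<sigma> e) = eaction T \<sigma> (g e)"
    if "\<sigma> \<in> carrier (G_base k)" "e \<in> carrier (emodule T')" for \<sigma> e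
    using hact[OF that(1) hg(1)[OF that(2)]] gh[OF T.act_closed[OF that(1) hg(1)[OF that(2)]]] hg(2)[OF that(2)] by simp
  moreover have "g (eincl T' x) = eincl T x" if "x \<in> F - {0}" for x
  proof -
    have "eincl T x \<in> carrier (emodule T)" using T.i_closed[of x] that by simp
    from gh[OF this] show ?thesis by (simp add: hincl[OF that])
  qed
  moreover have "eproj T (g e) = eproj T' e" if "e \<in> carrier (emodule T')" for e
    using hproj[OF hg(1)[OF that]] hg(2)[OF that] by simp
  ultimately show ?thesis unfolding triple_iso_def by blast
qed

lemma triple_iso_rel_equiv: "equiv {T :: ('a, 'a) ext_triple. is_ext_triple k K T} (triple_iso_rel k K)"
proof (rule equivI)
  show "triple_iso_rel k K \<subseteq> {T. is_ext_triple k K T} \<times> {T. is_ext_triple k K T}"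
    by (auto simp: triple_iso_rel_def)
qed (auto simp: triple_iso_rel_def refl_on_def sym_def trans_def
    intro: triple_iso_refl triple_iso_sym triple_iso_trans)

lemma conj_rel_iff:
  "(s, s') \<in> conj_rel k K \<longleftrightarrow> s \<in> splittings k K \<and> s' \<in> splittings k K \<and>
     triple_iso k K (radical_triple k K s) (radical_triple k K s')"
proof
  assume c: "(s, s') \<in> conj_rel k K"
  then have "s \<in> splittings k K" "s' \<in> splittings k K" by (simp_all add: conj_rel_def)
  then show "s \<in> splittings k K \<and> s' \<in> splittings k K \<and>
     triple_iso k K (radical_triple k K s) (radical_triple k K s')"
    using conjugate_imp_triple_iso[OF c] by blast
qed (blast intro: triple_iso_imp_conjugate)

lemma conj_rel_iff_iso_rel:
  "(s, s') \<in> conj_rel k K \<longleftrightarrow> s \<in> splittings k K \<and> s' \<in> splittings k K \<and>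
     (radical_triple k K s, radical_triple k K s') \<in> triple_iso_rel k K"
  by (auto simp: conj_rel_iff triple_iso_rel_def intro: radical_triple_is_ext_triple)

lemma ext_triple_classification:
  assumes "is_ext_triple k K T"
  shows "\<exists>s\<in>splittings k K. triple_iso k K (radical_triple k K s) T"
proof -
  interpret extension_triple k K T
    by (intro extension_triple.intro extension_triple_axioms.intro geometric_setting_axioms assms)
  show ?thesis by (rule ext_triple_from_splitting) blast
qed

end

lemma bij_betw_quotients:
  assumes B: "equiv B rB" and f: "\<And>s. s \<in> A \<Longrightarrow> f s \<in> B"
    and rel: "\<And>s s'. (s, s') \<in> rA \<longleftrightarrow> s \<in> A \<and> s' \<in> A \<and> (f s, f s') \<in> rB"
    and surj: "\<And>t. t \<in> B \<Longrightarrow> \<exists>s\<in>A. (f s, t) \<in> rB"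
  shows "bij_betw (\<lambda>c. \<Union>s\<in>c. rB `` {f s}) (A // rA) (B // rB)"
proof -
  have cls: "(\<Union>s\<in>rA `` {s0}. rB `` {f s}) = rB `` {f s0}" if "s0 \<in> A" for s0
  proof -
    have "rB `` {f s} = rB `` {f s0}" if "s \<in> rA `` {s0}" for s
      using that rel equiv_class_eq[OF B] by blast
    moreover have "s0 \<in> rA `` {s0}" using rel f[OF that] that B by (auto simp: equiv_def refl_on_def)
    ultimately show ?thesis by blast
  qed
  show ?thesis
    unfolding bij_betw_def
  proof
    show "inj_on (\<lambda>c. \<Union>s\<in>c. rB `` {f s}) (A // rA)"
    proof (rule inj_onI)
      fix c d assume "c \<in> A // rA" "d \<in> A // rA" and eq: "(\<Union>s\<in>c. rB `` {f s}) = (\<Union>s\<in>d. rB `` {f s})"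
      then obtain s t where st: "s \<in> A" "c = rA `` {s}" "t \<in> A" "d = rA `` {t}" by (auto elim!: quotientE)
      then have "rB `` {f s} = rB `` {f t}" using eq cls by simp
      then have "(f s, f u) \<in> rB \<longleftrightarrow> (f t, f u) \<in> rB" for u by blast
      then show "c = d" unfolding st using rel st(1,3) by blast
    qed
    show "(\<lambda>c. \<Union>s\<in>c. rB `` {f s}) ` (A // rA) = B // rB"
    proof (intro Set.set_eqI iffI)
      fix d assume "d \<in> (\<lambda>c. \<Union>s\<in>c. rB `` {f s}) ` (A // rA)"
      then obtain s where "s \<in> A" "d = rB `` {f s}" using cls by (auto elim!: quotientE)
      then show "d \<in> B // rB" using f by (auto intro: quotientI)
    next
      fix d assume "d \<in> B // rB"
      then obtain t where t: "t \<in> B" "d = rB `` {t}" by (auto elim!: quotientE)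
      obtain s where s: "s \<in> A" "(f s, t) \<in> rB" using surj[OF t(1)] by blast
      then have "d = (\<Union>s\<in>rA `` {s}. rB `` {f s})" using cls[OF s(1)] equiv_class_eq[OF B s(2)] t(2) by simp
      then show "d \<in> (\<lambda>c. \<Union>s\<in>c. rB `` {f s}) ` (A // rA)" using s(1) by (auto intro: quotientI)
    qed
  qed
qed

lemma fraction_field_subfield:
  assumes "is_subring A" shows "is_subfield (fraction_field A)" "A \<subseteq> fraction_field A"
proof -
  note A = assms[unfolded is_subring_iff]
  show sub: "A \<subseteq> fraction_field A"
  proof
    fix x assume "x \<in> A"
    then show "x \<in> fraction_field A"
      unfolding fraction_field_def using A by (intro CollectI exI[of _ x] exI[of _ 1]) simp
  qed
  have in_frac: "a / b \<in> fraction_field A" if "a \<in> A" "b \<in> A" "b \<noteq> 0" for a b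
    using that by (auto simp: fraction_field_def)
  have "x + y \<in> fraction_field A \<and> x * y \<in> fraction_field A \<and> - x \<in> fraction_field A \<and> inverse x \<in> fraction_field A"
    if xy: "x \<in> fraction_field A" "y \<in> fraction_field A" for x y
  proof -
    obtain a b c d where x: "x = a / b" "a \<in> A" "b \<in> A" "b \<noteq> 0" and y: "y = c / d" "c \<in> A" "d \<in> A" "d \<noteq> 0"
      using xy by (auto simp: fraction_field_def)
    have e: "x + y = (a * d + c * b) / (b * d)" "x * y = (a * c) / (b * d)" "- x = (- a) / b"
      using x y by (simp_all add: add_frac_eq)
    have "x + y \<in> fraction_field A" "x * y \<in> fraction_field A" "- x \<in> fraction_field A"
      unfolding e by (rule in_frac; use x y A in simp)+
    moreover have "inverse x \<in> fraction_field A"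
    proof (cases "a = 0")
      case True
      then show ?thesis using x A sub by auto
    next
      case False
      then show ?thesis using in_frac[OF x(3,2)] x by simp
    qed
    ultimately show ?thesis by blast
  qed
  then show "is_subfield (fraction_field A)"
    unfolding is_subfield_iff is_subring_iff using A sub by blast
qed

lemma geometric_settingI:
  fixes k K :: "'a::field_char_0 set" and X :: "'a set set"
  assumes kf: "is_subfield k" and X: "variety k X" "geometrically_irreducible k X" "K = function_field X"
    and sc: "is_separable_closure (kbarX k K) UNIV"
  shows "geometric_setting k K"
proof -
  have "\<exists>\<A>. finite \<A> \<and> \<A> \<noteq> {} \<and> X = (\<Union>A\<in>\<A>. localizations A) \<and>
      (\<forall>A\<in>\<A>. fg_algebra k A \<and> fraction_field A = function_field X)"
    using X(1) unfolding variety_def by (rule conjunct1)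
  then obtain \<A> where \<A>: "finite \<A> \<and> \<A> \<noteq> {} \<and> X = (\<Union>A\<in>\<A>. localizations A) \<and>
      (\<forall>A\<in>\<A>. fg_algebra k A \<and> fraction_field A = function_field X)" ..
  then obtain A where A: "A \<in> \<A>" by auto
  have fg: "fg_algebra k A" and frac: "fraction_field A = K" using \<A> A X(3) by auto
  have "localizations A \<subseteq> X" using \<A> A by auto
  then have irr: "irreducible_Spec (tensor_algebra k A (sep_closure k))"
    using X(2) fg by (auto simp: geometrically_irreducible_def affine_open_def)
  obtain S where S: "A = subring_gen (k \<union> S)" using fg by (auto simp: fg_algebra_def)
  have Ar: "is_subring A" and kA: "k \<subseteq> A"
    using subring_gen_is_subring subring_gen_superset[of "k \<union> S"] by (auto simp: S)
  show ?thesis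
  proof (rule geometric_setting.intro)
    show "is_subfield k" by fact
    show "is_subfield K" "k \<subseteq> K" using fraction_field_subfield[OF Ar] frac kA by auto
    show "is_separable_closure (kbarX k K) UNIV" by fact
    fix x assume x: "x \<in> K" "x \<in> sep_closure k"
    then obtain a b where ab: "x = a / b" "a \<in> A" "b \<in> A" "b \<noteq> 0"
      using frac by (auto simp: fraction_field_def)
    show "x \<in> k"
      using irreducible_tensor_algebra_imp_disjoint[OF kf Ar kA separably_closed_imp_root_closed[OF sc] irr ab(2-4)] x ab(1)
      by blast
  qed
qed

theorem lemma3p4:
  fixes k K :: "'a::field_char_0 set" and X :: "'a set set"
  assumes "is_subfield k"
    and "variety k X"
    and "smooth_variety k X"
    and "geometrically_irreducible k X"
    and "K = function_field X"
    and "is_separable_closure (kbarX k K) UNIV"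
  shows "(\<forall>s \<in> splittings k K. is_ext_triple k K (radical_triple k K s)) \<and>
    bij_betw (\<lambda>C. \<Union>s\<in>C. triple_iso_rel k K `` {radical_triple k K s})
      (splittings k K // conj_rel k K)
      ({T :: ('a, 'a) ext_triple. is_ext_triple k K T} // triple_iso_rel k K) \<and>
    (\<forall>T :: ('a, 'e) ext_triple. is_ext_triple k K T \<longrightarrow>
      (\<exists>s \<in> splittings k K. triple_iso k K (radical_triple k K s) T))"
proof -
  interpret geometric_setting k K
    by (rule geometric_settingI) (use assms in blast)+
  have "bij_betw (\<lambda>C. \<Union>s\<in>C. triple_iso_rel k K `` {radical_triple k K s})
      (splittings k K // conj_rel k K)
      ({T :: ('a, 'a) ext_triple. is_ext_triple k K T} // triple_iso_rel k K)"
  proof (rule bij_betw_quotients[OF triple_iso_rel_equiv])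
    show "radical_triple k K s \<in> {T. is_ext_triple k K T}" if "s \<in> splittings k K" for s
      using radical_triple_is_ext_triple[OF that] by simp
    show "\<exists>s\<in>splittings k K. (radical_triple k K s, T) \<in> triple_iso_rel k K"
      if "T \<in> {T. is_ext_triple k K T}" for T :: "('a, 'a) ext_triple"
      using ext_triple_classification that radical_triple_is_ext_triple by (fastforce simp: triple_iso_rel_def)
  qed (rule conj_rel_iff_iso_rel)
  then show ?thesis using radical_triple_is_ext_triple ext_triple_classification by blast
qed

end
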